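(* Let $1\le p\le\infty$, $k\in\mathbb{N}$, $r\in\mathbb{N}_0$, $N\in\mathbb{N}$, and let $\phi\in\Phi$ be such that $$\int_0^1\frac{r\,\phi(u)}{u^{r+1}}\,du<+\infty$$ (i.e., if $r=0$, this condition is not needed). Let $f\in L_p[-1,1]$. If $$E_n(f)_p\le\phi\left(\frac1n\right)\quad\text{for all } n\ge N,$$ then one of the representatives of $f$ has a locally absolutely continuous derivative $f^{(r-1)}$ in $(-1,1)$ (no assertion if $r=0$), $f\in\mathbb{B}_p^r$, and $$\omega^\varphi_{k,r}(f^{(r)},t)_p\le c\int_0^t\frac{r\,\phi(u)}{u^{r+1}}\,du+c\,t^k\int_t^1\frac{\phi(u)}{u^{k+r+1}}\,du+c(N)\,t^kE_{k+r}(f)_p,\qquad t\in[0,1/2].$$ If, in addition, $N\le k+r$, then $$\omega^\varphi_{k,r}(f^{(r)},t)_p\le c\int_0^t\frac{r\,\phi(u)}{u^{r+1}}\,du+c\,t^k\int_t^1\frac{\phi(u)}{u^{k+r+1}}\,du,\qquad t\in[0,1/2].$$ Here $c$ denotes constants depending only on $k$, $r$, $p$, and $c(N)$ a constant depending only on $N$, $k$, $r$, $p$ (in particular, all are independent of $f$, $\phi$ and $t$).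
   Context: Notation. $\mathbb{N}=\{1,2,\dots\}$, $\mathbb{N}_0=\mathbb{N}\cup\{0\}$, $\|\cdot\|_p=\|\cdot\|_{L_p[-1,1]}$, $\varphi(x)=\sqrt{1-x^2}$. $\Phi$ is the set of nondecreasing functions $\phi:[0,1]\to[0,\infty)$ with $\phi(0+)=0$. When $r=0$ the terms $\int r\phi(u)u^{-r-1}du$ are equal to $0$. For $t=0$ the modulus below is $0$ and the inequalities are trivial (right-hand sides read with $0\cdot\infty=0$). Function classes: $\mathbb{B}_p^0=L_p[-1,1]$, and for $r\ge1$, $\mathbb{B}_p^r$ is the set of functions $f$ such that $f^{(r-1)}$ is locally absolutely continuous in $(-1,1)$ and $\|f^{(r)}\varphi^r\|_p<\infty$. For $f\in L_p[-1,1]$, "$f\in\mathbb{B}^r_p$" means that $f$ coincides almost everywhere with such a function, with which it is then identified. Degree of approximation: $E_n(f)_p=\inf\|f-P\|_p$, the infimum being over all algebraic polynomials $P$ of degree $<n$. Symmetric difference: for $h\ge0$, $\Delta_h^k(g,x)=\sum_{i=0}^k\binom{k}{i}(-1)^{k-i}g(x+(i-k/2)h)$ if $x\pm kh/2\in[-1,1]$, and $\Delta_h^k(g,x)=0$ otherwise. For $\delta>0$: $\mathfrak{D}_\delta=\{x: 1-\delta\varphi(x)/2\ge|x|\}\setminus\{\pm1\}=\{x:|x|\le (4-\delta^2)/(4+\delta^2)\}$ (empty if $\delta>2$), and $\mathcal{W}_\delta(x)=\bigl((1-x-\delta\varphi(x)/2)(1+x-\delta\varphi(x)/2)\bigr)^{1/2}$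 for $x\in\mathfrak{D}_\delta$. Modulus of smoothness: for $f\in\mathbb{B}_p^r$ and $t>0$, $$\omega^\varphi_{k,r}(f^{(r)},t)_p=\sup_{0<h\le t}\bigl\|\mathcal{W}^r_{kh}(\cdot)\,\Delta^k_{h\varphi(\cdot)}(f^{(r)},\cdot)\bigr\|_{L_p(\mathfrak{D}_{kh})},$$ and $\omega^\varphi_{k,r}(f^{(r)},0)_p=0$.
   Formalization: The second inequality (case N ≤ k+r) is stated only for k+r ≥ 2, which excludes exactly k=1, r=0, N=1; there it is false: take f(x)=x, φ=0 on [0,1), φ(1)=‖x‖_p, so the right side is 0 and the modulus is positive. *)

theory Defs
  imports "HOL-Analysis.Analysis" "HOL-Probability.Essential_Supremum"
    "HOL-Computational_Algebra.Polynomial"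
begin

definition Lp_norm :: "ennreal \<Rightarrow> real set \<Rightarrow> (real \<Rightarrow> real) \<Rightarrow> ennreal" where
  "Lp_norm p S f =
    (if p = \<infinity> then esssup (lebesgue_on S) (\<lambda>x. ennreal \<bar>f x\<bar>)
     else (let I = \<integral>\<^sup>+x. ennreal (\<bar>f x\<bar> powr enn2real p) \<partial>lebesgue_on S
           in if I = \<infinity> then \<infinity> else ennreal (enn2real I powr (1 / enn2real p))))"

definition Lp :: "ennreal \<Rightarrow> real set \<Rightarrow> (real \<Rightarrow> real) set" where
  "Lp p S = {f. f \<in> borel_measurable (lebesgue_on S) \<and> Lp_norm p S f < \<infinity>}"

text \<open>In the next definition, \<open>d division_of \<Union>d\<close> says that \<open>d\<close> is a finite set of nonempty
  compact intervals with pairwise disjoint interiors.\<close>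

definition absolutely_continuous_on :: "real set \<Rightarrow> (real \<Rightarrow> real) \<Rightarrow> bool" where
  "absolutely_continuous_on S g \<longleftrightarrow>
    (\<forall>\<epsilon>>0. \<exists>\<delta>>0. \<forall>d. d division_of \<Union>d \<and> \<Union>d \<subseteq> S \<and> (\<Sum>K\<in>d. Sup K - Inf K) < \<delta>
      \<longrightarrow> (\<Sum>K\<in>d. \<bar>g (Sup K) - g (Inf K)\<bar>) < \<epsilon>)"

definition locally_absolutely_continuous :: "(real \<Rightarrow> real) \<Rightarrow> bool" where
  "locally_absolutely_continuous g \<longleftrightarrow>
    (\<forall>a b. -1 < a \<and> a < b \<and> b < 1 \<longrightarrow> absolutely_continuous_on {a..b} g)"

definition varphi :: "real \<Rightarrow> real" where
  "varphi x = sqrt (1 - x\<^sup>2)"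

text \<open>The \<open>r\<close>-th derivative of \<open>g\<close> is \<open>(deriv ^^ r) g\<close>. The derivatives of order less than \<open>r\<close>
  exist everywhere on the open interval. The one of order \<open>r\<close> exists almost everywhere there, and
  on the exceptional null set \<open>deriv\<close> has an unspecified value, which affects no norm below. Only
  the values of \<open>g\<close> on the closed interval \<open>[-1, 1]\<close> matter, and for \<open>r > 0\<close> only those on the
  open interval.\<close>

definition B_space :: "ennreal \<Rightarrow> nat \<Rightarrow> (real \<Rightarrow> real) set" where
  "B_space p r =
    (if r = 0 then Lp p {-1..1}
     else {g. (\<forall>j<r - 1. \<forall>x\<in>{-1<..<1}. (deriv ^^ j) g field_differentiable at x) \<and>
              locally_absolutely_continuous ((deriv ^^ (r - 1)) g) \<and>
              (\<lambda>x. (deriv ^^ r) g x * varphi x ^ r) \<in> Lp p {-1..1}})"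

definition best_approx :: "nat \<Rightarrow> (real \<Rightarrow> real) \<Rightarrow> ennreal \<Rightarrow> ennreal" where
  "best_approx n f p =
    (INF P\<in>{P :: real poly. P = 0 \<or> degree P < n}. Lp_norm p {-1..1} (\<lambda>x. f x - poly P x))"

definition symm_difference :: "nat \<Rightarrow> real \<Rightarrow> (real \<Rightarrow> real) \<Rightarrow> real \<Rightarrow> real" where
  "symm_difference k h g x =
    (if x - real k * h / 2 \<in> {-1..1} \<and> x + real k * h / 2 \<in> {-1..1}
     then \<Sum>i\<le>k. real (k choose i) * (-1) ^ (k - i) * g (x + (real i - real k / 2) * h)
     else 0)"

definition D_set :: "real \<Rightarrow> real set" where
  "D_set \<delta> = {x \<in> {-1..1}. 1 - \<delta> * varphi x / 2 \<ge> \<bar>x\<bar>} - {-1, 1}"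

definition W_weight :: "real \<Rightarrow> real \<Rightarrow> real" where
  "W_weight \<delta> x = sqrt ((1 - x - \<delta> * varphi x / 2) * (1 + x - \<delta> * varphi x / 2))"

text \<open>The argument \<open>F\<close> stands for the derivative of order \<open>r\<close>. For \<open>t = 0\<close> the supremum is
  over the empty set, hence 0.\<close>

definition omega :: "nat \<Rightarrow> nat \<Rightarrow> (real \<Rightarrow> real) \<Rightarrow> real \<Rightarrow> ennreal \<Rightarrow> ennreal" where
  "omega k r F t p =
    (SUP h\<in>{0<..t}. Lp_norm p (D_set (real k * h))
       (\<lambda>x. W_weight (real k * h) x ^ r * symm_difference k (h * varphi x) F x))"

definition Phi :: "(real \<Rightarrow> real) set" where
  "Phi = {\<phi>. mono_on {0..1} \<phi> \<and> (\<forall>u\<in>{0..1}. 0 \<le> \<phi> u) \<and> (\<phi> \<longlongrightarrow> 0) (at_right 0)}"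

end

theory Submission
  imports Defs
begin

text \<open>Let $P_n$ be a near-best approximation of degree less than $n$. The theorem follows by
  summing over the telescoping differences of $P_{2^j}$ once two estimates are available for
  polynomials $Q$ of degree less than $n$: the Bernstein inequality
  $\|\varphi^s Q^{(s)}\|_p \le (4n)^s \|Q\|_p$, and
  $\|\mathcal{W}^r_{kh} \Delta^k_{h\varphi} Q^{(r)}\|_p \le c\,(hn)^k n^r \|Q\|_p$ for $hn \le 2$.
  The second one follows from the first by expanding the difference into its Taylor series at $x$,
  since the constants $(4n)^s$ grow only geometrically and $\mathcal{W}_{kh} \le \varphi$.

  For the Bernstein inequality, Lebesgue measure on $[-1, 1]$ is the distribution of a coordinate
  on the sphere. Rotating by an angle $\alpha$ therefore acts on $Q$ without increasing its $L_p$
  norm, and turns it into a trigonometric polynomial in $\alpha$ with values in functions of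
  $x$ and of the longitude. The $s$-th derivative at $\alpha = 0$, projected onto the $s$-th
  harmonic of the longitude, is a multiple of $\varphi^s Q^{(s)}$, so the estimate reduces to
  Bernstein's inequality for trigonometric polynomials with values in a normed space.

  The weighted norm of $\mathcal{W}^r_{kh} \Delta^k_{h\varphi} F$ is bounded by that of
  $F \varphi^r$ through the substitutions $y = x + c\,\varphi(x)$, whose derivatives are at least
  $1/2$ on $\mathfrak{D}_{kh}$. This controls the tail $f - P_{2^j}$.\<close>

section \<open>The $L_p$ norm\<close>

text \<open>One Bernstein inequality has to serve every p from 1 to \<infinity>. The substitution x
  = cos u would leave the weight sin u in the integral and call for a weighted inequality for
  trigonometric polynomials. On the sphere this weight is absorbed by the surface measure, and
  convexity treats all p at once, with constants that do not depend on p.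

  The k-th difference annihilates the r-th derivative of a polynomial of degree less than k + r. The
  low-degree part is therefore seen only through the distance of f to such polynomials, which is the
  origin of the last term of the first estimate. The starting degree 2^J must be at least N and at
  least k + r, and the passage from there to degree k + r is the only step whose constant involves
  N.

  For r \<ge> 1 the derivative of order r exists only almost everywhere: orders below r are reached
  by locally uniform convergence, order r by convergence in L_1.

  Norms are bounded by explicit real numbers throughout, so that infinite values stay out of the
  algebra.\<close>

lemma Lp_norm_infinity_le_iff:
  assumes "f \<in> borel_measurable (lebesgue_on S)" "0 \<le> B"
  shows "Lp_norm \<infinity> S f \<le> ennreal B \<longleftrightarrow> (AE x in lebesgue_on S. \<bar>f x\<bar> \<le> B)"
proof
  assume le: "Lp_norm \<infinity> S f \<le> ennreal B"
  have "AE x in lebesgue_on S. ennreal \<bar>f x\<bar> \<le> esssup (lebesgue_on S) (\<lambda>x. ennreal \<bar>f x\<bar>)"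
    by (rule esssup_AE)
  then show "AE x in lebesgue_on S. \<bar>f x\<bar> \<le> B"
    by (rule eventually_mono) (use le assms(2) in \<open>auto simp: Lp_norm_def dest: order_trans\<close>)
next
  assume "AE x in lebesgue_on S. \<bar>f x\<bar> \<le> B"
  then have "AE x in lebesgue_on S. ennreal \<bar>f x\<bar> \<le> ennreal B"
    by (rule eventually_mono) (auto intro: ennreal_leI)
  then show "Lp_norm \<infinity> S f \<le> ennreal B"
    using assms by (auto simp: Lp_norm_def intro!: esssup_I)
qed

lemma enn2real_ge_one: "1 \<le> p \<Longrightarrow> p \<noteq> \<infinity> \<Longrightarrow> 1 \<le> enn2real p"
  by (cases p) auto

text \<open>Moves the root to the other side, so that for finite p a norm bound becomes a bound on a
  single integral.\<close>

lemma Lp_norm_finite_le_iff: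
  assumes "1 \<le> p" "p \<noteq> \<infinity>" "0 \<le> B"
  shows "Lp_norm p S f \<le> ennreal B \<longleftrightarrow>
    (\<integral>\<^sup>+x. ennreal (\<bar>f x\<bar> powr enn2real p) \<partial>lebesgue_on S) \<le> ennreal (B powr enn2real p)"
proof -
  let ?q = "enn2real p"
  let ?I = "\<integral>\<^sup>+x. ennreal (\<bar>f x\<bar> powr ?q) \<partial>lebesgue_on S"
  have q: "?q \<ge> 1" using assms enn2real_ge_one by blast
  show ?thesis
  proof (cases "?I = \<infinity>")
    case True
    then show ?thesis using assms by (auto simp: Lp_norm_def top_unique)
  next
    case False
    then obtain i where i: "?I = ennreal i" "i \<ge> 0"
      by (metis ennreal_cases infinity_ennreal_def)
    have "i powr (1 / ?q) \<le> B \<longleftrightarrow> i \<le> B powr ?q"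
    proof
      assume "i powr (1 / ?q) \<le> B"
      then have "(i powr (1 / ?q)) powr ?q \<le> B powr ?q" using q by (intro powr_mono2) auto
      then show "i \<le> B powr ?q" using q i by (simp add: powr_powr)
    next
      assume "i \<le> B powr ?q"
      then have "i powr (1 / ?q) \<le> (B powr ?q) powr (1 / ?q)" using q i by (intro powr_mono2) auto
      then show "i powr (1 / ?q) \<le> B" using q assms by (simp add: powr_powr)
    qed
    then show ?thesis using i assms by (simp add: Lp_norm_def)
  qed
qed

text \<open>\<open>esssup\<close> is top on functions that are not measurable, so for p =
  \<infinity> the smaller function has to be measurable.\<close>

lemma Lp_norm_mono_AE:
  assumes "1 \<le> p" "f \<in> borel_measurable (lebesgue_on S)"
    "AE x in lebesgue_on S. \<bar>f x\<bar> \<le> \<bar>g x\<bar>"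
  shows "Lp_norm p S f \<le> Lp_norm p S g"
proof (cases "p = \<infinity>")
  case True
  have "AE x in lebesgue_on S. ennreal \<bar>f x\<bar> \<le> ennreal \<bar>g x\<bar>"
    using assms(3) by (rule eventually_mono) (auto intro: ennreal_leI)
  then show ?thesis using True assms(2) by (auto simp: Lp_norm_def intro!: esssup_AE_mono)
next
  case False
  let ?I = "\<lambda>f. \<integral>\<^sup>+x. ennreal (\<bar>f x\<bar> powr enn2real p) \<partial>lebesgue_on S"
  have q: "enn2real p \<ge> 1" using assms enn2real_ge_one False by blast
  have le: "?I f \<le> ?I g"
    by (rule nn_integral_mono_AE)
      (use assms(3) q in \<open>auto elim!: eventually_mono intro!: ennreal_leI powr_mono2\<close>)
  show ?thesis
  proof (cases "?I g = \<infinity>")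
    case True
    then show ?thesis using False by (simp add: Lp_norm_def)
  next
    case nt: False
    then obtain i j where "?I g = ennreal i" "?I f = ennreal j" "0 \<le> j" "0 \<le> i"
      using le by (cases "?I g"; cases "?I f") (auto simp: top_unique)
    then show ?thesis using le q False
      by (auto simp: Lp_norm_def intro!: ennreal_leI powr_mono2)
  qed
qed

lemma Lp_norm_mono:
  assumes "1 \<le> p" "f \<in> borel_measurable (lebesgue_on S)" "\<And>x. x \<in> S \<Longrightarrow> \<bar>f x\<bar> \<le> \<bar>g x\<bar>"
  shows "Lp_norm p S f \<le> Lp_norm p S g"
  using assms by (intro Lp_norm_mono_AE) (auto simp: space_restrict_space)

lemma Lp_norm_cong_AE:
  assumes "1 \<le> p" "f \<in> borel_measurable (lebesgue_on S)" "g \<in> borel_measurable (lebesgue_on S)"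
    "AE x in lebesgue_on S. f x = g x"
  shows "Lp_norm p S f = Lp_norm p S g"
  by (rule antisym; rule Lp_norm_mono_AE) (use assms in \<open>auto elim!: eventually_mono\<close>)

lemma Lp_norm_cmult_le:
  assumes "1 \<le> p" "f \<in> borel_measurable (lebesgue_on S)" "Lp_norm p S f \<le> ennreal B" "0 \<le> B"
  shows "Lp_norm p S (\<lambda>x. c * f x) \<le> ennreal (\<bar>c\<bar> * B)"
proof (cases "p = \<infinity>")
  case True
  then have "AE x in lebesgue_on S. \<bar>f x\<bar> \<le> B"
    using Lp_norm_infinity_le_iff assms by blast
  then have "AE x in lebesgue_on S. \<bar>c * f x\<bar> \<le> \<bar>c\<bar> * B"
    by (rule eventually_mono) (simp add: abs_mult mult_left_mono)
  then show ?thesis using True assms by (subst True, subst Lp_norm_infinity_le_iff) auto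
next
  case False
  have "(\<integral>\<^sup>+x. ennreal (\<bar>c * f x\<bar> powr enn2real p) \<partial>lebesgue_on S)
      = (\<integral>\<^sup>+x. ennreal (\<bar>c\<bar> powr enn2real p) * ennreal (\<bar>f x\<bar> powr enn2real p) \<partial>lebesgue_on S)"
    by (simp add: abs_mult powr_mult ennreal_mult)
  also have "\<dots> = ennreal (\<bar>c\<bar> powr enn2real p) * (\<integral>\<^sup>+x. ennreal (\<bar>f x\<bar> powr enn2real p) \<partial>lebesgue_on S)"
    using assms by (intro nn_integral_cmult) measurable
  also have "\<dots> \<le> ennreal (\<bar>c\<bar> powr enn2real p) * ennreal (B powr enn2real p)"
    using Lp_norm_finite_le_iff assms False by (intro mult_left_mono) auto
  finally show ?thesis
    using assms False by (subst Lp_norm_finite_le_iff) (auto simp: powr_mult ennreal_mult)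
qed

text \<open>Minkowski's inequality before integration: (u + v) / (a + b) is the convex combination
  of u / a and v / b with weights a / (a + b) and b / (a + b), and the power q is convex. With
  bounds of two norms for a and b, integration gives the triangle inequality without conjugate
  exponents.\<close>

lemma powr_add_le_convex:
  fixes q a b u v :: real
  assumes "1 \<le> q" "0 < a" "0 < b" "0 \<le> u" "0 \<le> v"
  shows "(u + v) powr q \<le>
    (a + b) powr q * (a / (a + b) * ((u / a) powr q) + b / (a + b) * ((v / b) powr q))"
proof -
  have cv: "((1 - t) * x + t * y) powr q \<le> (1 - t) * x powr q + t * y powr q"
    if txy: "0 < t" "t < 1" "0 \<le> x" "0 \<le> y" for t x y
  proof -
    \<comment> \<open>When x or y is 0, convexity reduces to this.\<close>
    have le: "s powr q \<le> s" if "0 < s" "s < 1" for s :: real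
      using powr_mono'[of 1 q s] that assms by simp
    consider "x = 0" | "y = 0" | "0 < x" "0 < y" using txy by linarith
    then show ?thesis
    proof cases
      case 1
      have "t powr q * y powr q \<le> t * y powr q" using le txy by (intro mult_right_mono) auto
      then show ?thesis using 1 txy assms by (simp add: powr_mult)
    next
      case 2
      have "(1 - t) powr q * x powr q \<le> (1 - t) * x powr q" using le txy by (intro mult_right_mono) auto
      then show ?thesis using 2 txy assms by (simp add: powr_mult)
    next
      case 3
      then show ?thesis using convex_onD[OF powr_convex[OF assms(1)], of t x y] txy by simp
    qed
  qed
  have e: "1 - b / (a + b) = a / (a + b)" using assms by (simp add: field_simps)
  have "(a + b) * ((1 - b / (a + b)) * (u / a) + b / (a + b) * (v / b))
      = ((a + b) / (a + b)) * (a / a * u + b / b * v)"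
    by (simp add: e add_divide_distrib distrib_left)
  also have "\<dots> = u + v" using assms by simp
  finally have "(u + v) powr q = ((a + b) * ((1 - b / (a + b)) * (u / a) + b / (a + b) * (v / b))) powr q"
    by simp
  also have "\<dots> = (a + b) powr q * ((1 - b / (a + b)) * (u / a) + b / (a + b) * (v / b)) powr q"
    using assms by (subst powr_mult) (auto simp: e)
  also have "\<dots> \<le> (a + b) powr q * ((1 - b / (a + b)) * (u / a) powr q + b / (a + b) * (v / b) powr q)"
    using assms by (intro mult_left_mono cv) auto
  finally show ?thesis by (simp add: e)
qed

lemma Lp_norm_triangle:
  assumes p: "1 \<le> p" and m: "f \<in> borel_measurable (lebesgue_on S)" "g \<in> borel_measurable (lebesgue_on S)"
    and f: "Lp_norm p S f \<le> ennreal a" "0 \<le> a" and g: "Lp_norm p S g \<le> ennreal b" "0 \<le> b"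
  shows "Lp_norm p S (\<lambda>x. f x + g x) \<le> ennreal (a + b)"
proof (cases "p = \<infinity>")
  case True
  then have "AE x in lebesgue_on S. \<bar>f x\<bar> \<le> a" "AE x in lebesgue_on S. \<bar>g x\<bar> \<le> b"
    using Lp_norm_infinity_le_iff assms by blast+
  then have "AE x in lebesgue_on S. \<bar>f x + g x\<bar> \<le> a + b"
    by eventually_elim linarith
  then show ?thesis using True assms by (subst True, subst Lp_norm_infinity_le_iff) auto
next
  case False
  let ?q = "enn2real p"
  have q: "?q \<ge> 1" using p enn2real_ge_one False by blast
  \<comment> \<open>The convexity estimate divides by the two bounds, so they are positive at first;
    the \<epsilon> at the end admits zero bounds.\<close>
  have *: "Lp_norm p S (\<lambda>x. f x + g x) \<le> ennreal (a + b)"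
    if f: "Lp_norm p S f \<le> ennreal a" "0 < a" and g: "Lp_norm p S g \<le> ennreal b" "0 < b" for a b
  proof -
    let ?I = "\<lambda>f. \<integral>\<^sup>+x. ennreal (\<bar>f x\<bar> powr enn2real p) \<partial>lebesgue_on S"
    define A where "A = (a + b) powr ?q * (a / (a + b)) * (1 / a) powr ?q"
    define B where "B = (a + b) powr ?q * (b / (a + b)) * (1 / b) powr ?q"
    have AB: "A \<ge> 0" "B \<ge> 0" using f g by (auto simp: A_def B_def)
    have fI: "?I f \<le> ennreal (a powr ?q)" "?I g \<le> ennreal (b powr ?q)"
      using Lp_norm_finite_le_iff p False f g by (metis less_imp_le)+
    have "?I (\<lambda>x. f x + g x) \<le>
      (\<integral>\<^sup>+x. ennreal A * ennreal (\<bar>f x\<bar> powr ?q) + ennreal B * ennreal (\<bar>g x\<bar> powr ?q) \<partial>lebesgue_on S)"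
    proof (rule nn_integral_mono)
      fix x
      have "\<bar>f x + g x\<bar> powr ?q \<le> (\<bar>f x\<bar> + \<bar>g x\<bar>) powr ?q"
        using q by (intro powr_mono2) auto
      also have "\<dots> \<le> (a + b) powr ?q * (a / (a + b) * ((\<bar>f x\<bar> / a) powr ?q) + b / (a + b) * ((\<bar>g x\<bar> / b) powr ?q))"
        by (rule powr_add_le_convex) (use q f g in auto)
      also have "\<dots> = A * \<bar>f x\<bar> powr ?q + B * \<bar>g x\<bar> powr ?q"
        using f g by (simp add: A_def B_def powr_divide powr_mult algebra_simps)
      finally show "ennreal (\<bar>f x + g x\<bar> powr ?q)
          \<le> ennreal A * ennreal (\<bar>f x\<bar> powr ?q) + ennreal B * ennreal (\<bar>g x\<bar> powr ?q)"
        using AB by (simp flip: ennreal_mult ennreal_plus add: ennreal_leI)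
    qed
    also have "\<dots> = ennreal A * ?I f + ennreal B * ?I g"
      using m by (subst nn_integral_add) (auto simp: nn_integral_cmult)
    also have "\<dots> \<le> ennreal A * ennreal (a powr ?q) + ennreal B * ennreal (b powr ?q)"
      by (intro add_mono mult_left_mono fI) auto
    also have "\<dots> = ennreal (A * a powr ?q + B * b powr ?q)"
      using AB by (simp add: ennreal_mult)
    also have "A * a powr ?q + B * b powr ?q = (a + b) powr ?q"
    proof -
      have "A * a powr ?q + B * b powr ?q = (a + b) powr ?q * (a / (a + b) + b / (a + b))"
        using f g by (simp add: A_def B_def powr_divide distrib_left)
      also have "a / (a + b) + b / (a + b) = 1" using f g by (simp flip: add_divide_distrib)
      finally show ?thesis by simp
    qed
    finally show ?thesis using p False f g by (subst Lp_norm_finite_le_iff) auto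
  qed
  show ?thesis
  proof (rule ennreal_le_epsilon)
    fix e :: real assume e: "0 < e"
    have "Lp_norm p S (\<lambda>x. f x + g x) \<le> ennreal ((a + e / 2) + (b + e / 2))"
    proof (rule *)
      show "Lp_norm p S f \<le> ennreal (a + e / 2)"
        using f(1) by (rule order_trans) (use e in \<open>auto intro: ennreal_leI\<close>)
      show "Lp_norm p S g \<le> ennreal (b + e / 2)"
        using g(1) by (rule order_trans) (use e in \<open>auto intro: ennreal_leI\<close>)
    qed (use e f g in auto)
    then show "Lp_norm p S (\<lambda>x. f x + g x) \<le> ennreal (a + b) + ennreal e"
      using e f g by (simp flip: ennreal_plus add: algebra_simps)
  qed
qed

lemma Lp_norm_zero: "1 \<le> p \<Longrightarrow> Lp_norm p S (\<lambda>x. 0) = 0"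
  using Lp_norm_infinity_le_iff[of "\<lambda>x. 0" S 0] Lp_norm_finite_le_iff[of p 0 S "\<lambda>x. 0"]
  by (cases "p = \<infinity>") auto

lemma Lp_norm_sum_le:
  assumes p: "1 \<le> p" and "finite I"
    and "\<And>i. i \<in> I \<Longrightarrow> f i \<in> borel_measurable (lebesgue_on S)"
    and "\<And>i. i \<in> I \<Longrightarrow> Lp_norm p S (f i) \<le> ennreal (b i)" and "\<And>i. i \<in> I \<Longrightarrow> 0 \<le> b i"
  shows "Lp_norm p S (\<lambda>x. \<Sum>i\<in>I. f i x) \<le> ennreal (\<Sum>i\<in>I. b i)"
  using assms(2-)
proof (induction I)
  case empty
  then show ?case using p by (simp add: Lp_norm_zero)
next
  case (insert i I)
  then show ?case using p by (simp, intro Lp_norm_triangle) (auto intro!: sum_nonneg)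
qed

lemma Lp_norm_abs: "Lp_norm p S (\<lambda>x. \<bar>f x\<bar>) = Lp_norm p S f"
  by (simp add: Lp_norm_def)

text \<open>Serves the three places where a function is dominated pointwise by a weighted sum: the
  translates in Bernstein's inequality, the Taylor terms of a difference, and the nodes of a
  difference.\<close>

lemma Lp_norm_dominated_sum:
  assumes p: "1 \<le> p" and I: "finite I"
    and g: "g \<in> borel_measurable (lebesgue_on S)"
    and m: "\<And>i. i \<in> I \<Longrightarrow> f i \<in> borel_measurable (lebesgue_on S)"
    and n: "\<And>i. i \<in> I \<Longrightarrow> Lp_norm p S (f i) \<le> ennreal (b i)" "\<And>i. i \<in> I \<Longrightarrow> 0 \<le> b i"
    and c: "\<And>i. i \<in> I \<Longrightarrow> 0 \<le> c i"
    and le: "\<And>x. x \<in> S \<Longrightarrow> \<bar>g x\<bar> \<le> (\<Sum>i\<in>I. c i * \<bar>f i x\<bar>)"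
  shows "Lp_norm p S g \<le> ennreal (\<Sum>i\<in>I. c i * b i)"
proof -
  have "Lp_norm p S g \<le> Lp_norm p S (\<lambda>x. \<Sum>i\<in>I. c i * \<bar>f i x\<bar>)"
    by (rule Lp_norm_mono[OF p g]) (use le in force)
  also have "\<dots> \<le> ennreal (\<Sum>i\<in>I. c i * b i)"
  proof (rule Lp_norm_sum_le[OF p I])
    fix i assume i: "i \<in> I"
    show "(\<lambda>x. c i * \<bar>f i x\<bar>) \<in> borel_measurable (lebesgue_on S)"
      using m i by auto
    show "Lp_norm p S (\<lambda>x. c i * \<bar>f i x\<bar>) \<le> ennreal (c i * b i)"
      using Lp_norm_cmult_le[OF p _ _ n(2)[OF i], of "\<lambda>x. \<bar>f i x\<bar>" S "c i"] m[OF i] n(1)[OF i] c[OF i]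
      by (simp add: Lp_norm_abs)
    show "0 \<le> c i * b i" using n c i by auto
  qed
  finally show ?thesis .
qed

text \<open>The argument of the Riesz-Fischer theorem: the partial sums of the absolute values have
  uniformly bounded norms, so by monotone convergence their limit has finite norm and is finite
  almost everywhere. The same majorant bounds the norm of the sum.\<close>

lemma Lp_norm_series:
  assumes p: "1 \<le> p" and m: "\<And>i. f i \<in> borel_measurable (lebesgue_on S)"
    and n: "\<And>i::nat. Lp_norm p S (f i) \<le> ennreal (b i)" "\<And>i. 0 \<le> b i" and sb: "summable b"
  shows "AE x in lebesgue_on S. summable (\<lambda>i. \<bar>f i x\<bar>)"
    and "Lp_norm p S (\<lambda>x. \<Sum>i. f i x) \<le> ennreal (\<Sum>i. b i)"
proof -
  let ?B = "\<Sum>i. b i"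
  have B: "?B \<ge> 0" using n sb by (simp add: suminf_nonneg)
  have meas: "(\<lambda>x. \<Sum>i. f i x) \<in> borel_measurable (lebesgue_on S)"
    using m by (rule borel_measurable_suminf)
  define s where "s n x = (\<Sum>i<n. \<bar>f i x\<bar>)" for n x
  have s0: "s n x \<ge> 0" for n x by (simp add: s_def sum_nonneg)
  have sm: "s n \<in> borel_measurable (lebesgue_on S)" for n
    unfolding s_def using m by auto
  have sn: "Lp_norm p S (s n) \<le> ennreal ?B" for n
  proof -
    have "Lp_norm p S (s n) \<le> ennreal (\<Sum>i<n. b i)"
      unfolding s_def by (rule Lp_norm_sum_le[OF p]) (use m n in \<open>auto simp: Lp_norm_abs\<close>)
    also have "\<dots> \<le> ennreal ?B" using n sb by (intro ennreal_leI sum_le_suminf) auto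
    finally show ?thesis .
  qed
  have summ: "summable (\<lambda>i. \<bar>f i x\<bar>)" if "\<And>n. s n x \<le> C" for x C
    using that by (intro bounded_imp_summable[of _ C]) (auto simp: s_def simp flip: lessThan_Suc_atMost simp del: sum.lessThan_Suc)
  have absle: "\<bar>\<Sum>i. f i x\<bar> \<le> C" if C: "\<And>n. s n x \<le> C" for x C
  proof -
    have "norm (\<Sum>i. f i x) \<le> (\<Sum>i. norm (f i x))"
      using summ[OF C] by (intro summable_norm) simp
    also have "\<dots> \<le> C" using summ[OF C] C by (intro suminf_le_const) (auto simp: s_def)
    finally show ?thesis by simp
  qed
  have "(AE x in lebesgue_on S. summable (\<lambda>i. \<bar>f i x\<bar>)) \<and> Lp_norm p S (\<lambda>x. \<Sum>i. f i x) \<le> ennreal ?B"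
  proof (cases "p = \<infinity>")
    case True
    have "AE x in lebesgue_on S. s n x \<le> ?B" for n
      using sn[of n] Lp_norm_infinity_le_iff[OF sm B, of n] True s0 by simp
    then have ae: "AE x in lebesgue_on S. \<forall>n. s n x \<le> ?B"
      by (simp add: AE_all_countable)
    then have "AE x in lebesgue_on S. summable (\<lambda>i. \<bar>f i x\<bar>)"
      by (rule eventually_mono) (use summ in blast)
    moreover have "AE x in lebesgue_on S. \<bar>\<Sum>i. f i x\<bar> \<le> ?B"
      using ae by (rule eventually_mono) (use absle in blast)
    ultimately show ?thesis using Lp_norm_infinity_le_iff[OF meas B] True by simp
  next
    case False
    let ?q = "enn2real p"
    have q: "?q \<ge> 1" using p enn2real_ge_one False by blast
    let ?S = "\<lambda>x. SUP n. ennreal (s n x powr ?q)"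
    have inc: "incseq (\<lambda>n x. ennreal (s n x powr ?q))"
      unfolding incseq_def le_fun_def using q s0
      by (auto intro!: ennreal_leI powr_mono2 simp: s_def intro: sum_mono2)
    have "(\<integral>\<^sup>+x. ?S x \<partial>lebesgue_on S) = (SUP n. \<integral>\<^sup>+x. ennreal (s n x powr ?q) \<partial>lebesgue_on S)"
      by (rule nn_integral_monotone_convergence_SUP[OF inc]) (use sm in measurable)
    also have "\<dots> \<le> ennreal (?B powr ?q)"
      by (rule SUP_least) (use sn Lp_norm_finite_le_iff[OF p False B] s0 in auto)
    finally have le: "(\<integral>\<^sup>+x. ?S x \<partial>lebesgue_on S) \<le> ennreal (?B powr ?q)" .
    have "AE x in lebesgue_on S. ?S x \<noteq> \<infinity>"
      by (rule nn_integral_PInf_AE) (use le sm in \<open>auto simp: top_unique\<close>)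
    then have fin: "AE x in lebesgue_on S. ?S x < \<infinity>"
      by (rule eventually_mono) (simp only: infinity_ennreal_def less_top)
    have bd: "\<exists>C. (\<forall>n. s n x \<le> C) \<and> ennreal (C powr ?q) = ?S x" if "?S x < \<infinity>" for x
    proof -
      obtain c where c: "?S x = ennreal c" "c \<ge> 0" using \<open>?S x < \<infinity>\<close> by (cases "?S x") auto
      have "s n x powr ?q \<le> c" for n
        using SUP_upper[of n UNIV "\<lambda>n. ennreal (s n x powr ?q)"] c by simp
      then have "(s n x powr ?q) powr (1 / ?q) \<le> c powr (1 / ?q)" for n
        using q by (intro powr_mono2) auto
      then have "s n x \<le> c powr (1 / ?q)" for n using q s0 by (simp add: powr_powr)
      moreover have "ennreal ((c powr (1 / ?q)) powr ?q) = ?S x" using c q by (simp add: powr_powr)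
      ultimately show ?thesis by blast
    qed
    have "AE x in lebesgue_on S. summable (\<lambda>i. \<bar>f i x\<bar>)"
      using fin by (rule eventually_mono) (use bd summ in blast)
    moreover have "Lp_norm p S (\<lambda>x. \<Sum>i. f i x) \<le> ennreal ?B"
    proof (subst Lp_norm_finite_le_iff[OF p False B])
      have "(\<integral>\<^sup>+x. ennreal (\<bar>\<Sum>i. f i x\<bar> powr ?q) \<partial>lebesgue_on S) \<le> (\<integral>\<^sup>+x. ?S x \<partial>lebesgue_on S)"
      proof (rule nn_integral_mono)
        fix x
        show "ennreal (\<bar>\<Sum>i. f i x\<bar> powr ?q) \<le> ?S x"
        proof (cases "?S x < \<infinity>")
          case True
          then obtain C where C: "\<forall>n. s n x \<le> C" "ennreal (C powr ?q) = ?S x" using bd by blast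
          then have "ennreal (\<bar>\<Sum>i. f i x\<bar> powr ?q) \<le> ennreal (C powr ?q)"
            using absle[of x C] q by (intro ennreal_leI powr_mono2) auto
          then show ?thesis using C by simp
        next
          \<comment> \<open>At such points the value of the series is not controlled, but the
            majorant is infinite.\<close>
          case False
          then have "?S x = \<infinity>" by (metis infinity_ennreal_def top.not_eq_extremum)
          then show ?thesis by (simp only: infinity_ennreal_def top_greatest)
        qed
      qed
      then show "(\<integral>\<^sup>+x. ennreal (\<bar>\<Sum>i. f i x\<bar> powr ?q) \<partial>lebesgue_on S) \<le> ennreal (?B powr ?q)"
        using le by (rule order_trans)
    qed
    ultimately show ?thesis by blast
  qed
  then show "AE x in lebesgue_on S. summable (\<lambda>i. \<bar>f i x\<bar>)"
    "Lp_norm p S (\<lambda>x. \<Sum>i. f i x) \<le> ennreal ?B" by auto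
qed

text \<open>The crude constant comes from $|u| \le 1 + |u|^q$.\<close>

lemma Lp_norm_one_le:
  assumes p: "1 \<le> p" and m: "f \<in> borel_measurable (lebesgue_on {-1..1})"
    and B: "Lp_norm p {-1..1} f \<le> ennreal B" "0 \<le> B"
  shows "(\<integral>\<^sup>+x. ennreal \<bar>f x\<bar> \<partial>lebesgue_on {-1..1}) \<le> ennreal (3 * B)"
proof -
  let ?M = "lebesgue_on {-1..1::real}"
  have *: "(\<integral>\<^sup>+x. ennreal \<bar>f x\<bar> \<partial>?M) \<le> ennreal (3 * B)"
    if B: "Lp_norm p {-1..1} f \<le> ennreal B" "0 < B" for B
  proof (cases "p = \<infinity>")
    case True
    then have "AE x in ?M. \<bar>f x\<bar> \<le> B" using Lp_norm_infinity_le_iff[OF m] B by simp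
    then have "(\<integral>\<^sup>+x. ennreal \<bar>f x\<bar> \<partial>?M) \<le> (\<integral>\<^sup>+x. ennreal B \<partial>?M)"
      by (intro nn_integral_mono_AE) (auto elim!: eventually_mono intro: ennreal_leI)
    also have "\<dots> = ennreal (B * 2)" using B
      by (simp add: emeasure_restrict_space space_restrict_space ennreal_mult)
    also have "\<dots> \<le> ennreal (3 * B)" using B by (intro ennreal_leI) auto
    finally show ?thesis .
  next
    case False
    let ?q = "enn2real p"
    have q: "?q \<ge> 1" using p enn2real_ge_one False by blast
    have "(\<integral>\<^sup>+x. ennreal \<bar>f x\<bar> \<partial>?M) \<le> (\<integral>\<^sup>+x. ennreal B + ennreal (B / B powr ?q) * ennreal (\<bar>f x\<bar> powr ?q) \<partial>?M)"
    proof (rule nn_integral_mono)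
      fix x
      have w: "w \<le> 1 + w powr ?q" if "0 \<le> w" for w :: real
      proof (cases "w \<le> 1")
        case True
        then show ?thesis by (smt (verit) powr_ge_zero)
      next
        case False
        then have "w powr 1 \<le> w powr ?q" using q by (intro powr_mono) auto
        then show ?thesis using False by simp
      qed
      have "\<bar>f x\<bar> / B \<le> 1 + (\<bar>f x\<bar> / B) powr ?q"
        using B by (intro w) simp
      then have "\<bar>f x\<bar> \<le> B + B / B powr ?q * \<bar>f x\<bar> powr ?q"
        using B by (simp add: powr_divide field_simps)
      then show "ennreal \<bar>f x\<bar> \<le> ennreal B + ennreal (B / B powr ?q) * ennreal (\<bar>f x\<bar> powr ?q)"
        using B by (simp flip: ennreal_mult ennreal_plus add: ennreal_leI)
    qed
    also have "\<dots> = (\<integral>\<^sup>+x. ennreal B \<partial>?M) + ennreal (B / B powr ?q) * (\<integral>\<^sup>+x. ennreal (\<bar>f x\<bar> powr ?q) \<partial>?M)"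
      using m by (subst nn_integral_add) (auto simp: nn_integral_cmult)
    \<comment> \<open>The 3 is the length 2 of the interval plus 1 from the power term.\<close>
    also have "\<dots> \<le> ennreal (2 * B) + ennreal (B / B powr ?q) * ennreal (B powr ?q)"
    proof (intro add_mono mult_left_mono)
      show "(\<integral>\<^sup>+x. ennreal B \<partial>?M) \<le> ennreal (2 * B)"
        using B by (simp add: emeasure_restrict_space space_restrict_space ennreal_mult mult.commute)
      show "(\<integral>\<^sup>+x. ennreal (\<bar>f x\<bar> powr ?q) \<partial>?M) \<le> ennreal (B powr ?q)"
        using Lp_norm_finite_le_iff[OF p False] B by simp
    qed simp
    also have "\<dots> = ennreal (3 * B)"
      using B by (simp flip: ennreal_mult ennreal_plus)
    finally show ?thesis .
  qed
  show ?thesis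
  proof (rule ennreal_le_epsilon)
    fix e :: real assume e: "0 < e"
    have "(\<integral>\<^sup>+x. ennreal \<bar>f x\<bar> \<partial>?M) \<le> ennreal (3 * (B + e / 3))"
      by (rule *) (use e B in \<open>auto intro: order_trans ennreal_leI\<close>)
    then show "(\<integral>\<^sup>+x. ennreal \<bar>f x\<bar> \<partial>?M) \<le> ennreal (3 * B) + ennreal e"
      using e B by (simp flip: ennreal_plus add: algebra_simps)
  qed
qed

lemma continuous_on_imp_measurable_lebesgue_on:
  fixes f :: "real \<Rightarrow> real"
  assumes "continuous_on S f" "S \<in> sets lebesgue"
  shows "f \<in> borel_measurable (lebesgue_on S)"
  using assms by (rule continuous_imp_measurable_on_sets_lebesgue)

section \<open>Averages over the sphere\<close>

lemma nn_integral_lebesgue_on_has_integral: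
  fixes f :: "real \<Rightarrow> real"
  assumes S: "S \<in> sets lebesgue" and nonneg: "\<And>x. x \<in> S \<Longrightarrow> 0 \<le> f x" and I: "(f has_integral I) S"
  shows "(\<integral>\<^sup>+x. ennreal (f x) \<partial>lebesgue_on S) = ennreal I"
proof -
  let ?h = "\<lambda>x. if x \<in> S then f x else 0"
  have "(?h has_integral I) UNIV" using I by (simp add: has_integral_restrict_UNIV)
  then have "(\<integral>\<^sup>+x. ennreal (?h x) \<partial>lebesgue) = ennreal I"
    using nonneg by (subst (asm) has_integral_iff_nn_integral_lebesgue) auto
  moreover have "(\<integral>\<^sup>+x. ennreal (f x) \<partial>lebesgue_on S) = (\<integral>\<^sup>+x. ennreal (?h x) \<partial>lebesgue)"
    using S by (subst nn_integral_restrict_space) (auto intro!: nn_integral_cong split: split_indicator)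
  ultimately show ?thesis by simp
qed

text \<open>\<open>cos t ^ b\<close> contains only frequencies up to b, so it is orthogonal to
  higher ones. The induction uses the product formula for cos t cos (s t), which calls for the
  previous power at the frequencies s + 1 and s - 1.\<close>

lemma cos_power_cos_has_integral:
  "b \<le> s \<Longrightarrow> ((\<lambda>t. cos t ^ b * cos (real s * t)) has_integral (if b < s then 0 else 2 * pi / 2 ^ s)) {0..2 * pi}"
proof (induction b arbitrary: s)
  case 0
  show ?case
  proof (cases "s = 0")
    case True
    have "((\<lambda>t::real. 1::real) has_integral (1 * (2 * pi - 0))) {0..2 * pi}"
      using has_integral_const_real[of "1::real" 0 "2 * pi"] by simp
    then show ?thesis using True by simp
  next
    case False
    have "((\<lambda>t. cos (real s * t)) has_integral (sin (real s * (2 * pi)) / s - sin (real s * 0) / s)) {0..2 * pi}"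
      by (rule fundamental_theorem_of_calculus)
        (use False in \<open>auto intro!: derivative_eq_intros simp flip: has_real_derivative_iff_has_vector_derivative\<close>)
    moreover have "sin (real s * (2 * pi)) = 0"
      using sin_npi[of "2 * s"] by (simp add: mult_ac)
    ultimately show ?thesis using False by simp
  qed
next
  case (Suc b)
  then obtain s' where s: "s = Suc s'" by (cases s) auto
  have "((\<lambda>t. (cos t ^ b * cos (real (Suc (Suc s')) * t) + cos t ^ b * cos (real s' * t)) / 2) has_integral
    ((if b < Suc (Suc s') then 0 else 2 * pi / 2 ^ (Suc (Suc s'))) + (if b < s' then 0 else 2 * pi / 2 ^ s')) / 2) {0..2 * pi}"
    by (intro has_integral_divide has_integral_add Suc.IH) (use Suc.prems s in auto)
  moreover have "(cos t ^ b * cos (real (Suc (Suc s')) * t) + cos t ^ b * cos (real s' * t)) / 2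
      = cos t ^ Suc b * cos (real s * t)" for t
  proof -
    have e: "real (Suc (Suc s')) * t = real s * t + t" "real s' * t = real s * t - t"
      using s by (auto simp: algebra_simps)
    show ?thesis unfolding e cos_add cos_diff by (simp add: algebra_simps)
  qed
  ultimately have "((\<lambda>t. cos t ^ Suc b * cos (real s * t)) has_integral
    ((if b < Suc (Suc s') then 0 else 2 * pi / 2 ^ (Suc (Suc s'))) + (if b < s' then 0 else 2 * pi / 2 ^ s')) / 2) {0..2 * pi}"
    by (simp only:)
  moreover have "((if b < Suc (Suc s') then 0 else 2 * pi / 2 ^ (Suc (Suc s'))) + (if b < s' then 0 else 2 * pi / 2 ^ s')) / 2
    = (if Suc b < s then 0 else 2 * pi / 2 ^ s)"
    using Suc.prems s by auto
  ultimately show ?case by (simp only:)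
qed

lemma DERIV_power_Suc_within:
  fixes f :: "real \<Rightarrow> real"
  assumes "(f has_real_derivative D) (at x within S)"
  shows "((\<lambda>x. f x ^ Suc n) has_real_derivative real (Suc n) * f x ^ n * D) (at x within S)"
  using DERIV_power[OF assms, of "Suc n"] by (simp add: mult_ac)

section \<open>Moments on the sphere\<close>

definition cos_moment :: "nat \<Rightarrow> real" where
  "cos_moment b = integral {0..2 * pi} (\<lambda>t. cos t ^ b)"

text \<open>In the height x and the longitude t, the surface measure of the unit sphere is dx dt
  (Archimedes). With the horizontal coordinate y = \<open>varphi x * cos t\<close>, the product
  \<open>phi_moment a b * cos_moment b\<close> is the integral of x^a y^b over the sphere.\<close>

definition phi_moment :: "nat \<Rightarrow> nat \<Rightarrow> real" where
  "phi_moment a b = integral {-1..1} (\<lambda>x. x ^ a * varphi x ^ b)"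

lemma continuous_on_varphi [continuous_intros]: "continuous_on S varphi"
  unfolding varphi_def[abs_def] by (intro continuous_intros)

lemma varphi_nonneg: "\<bar>x\<bar> \<le> 1 \<Longrightarrow> 0 \<le> varphi x"
  by (simp add: varphi_def abs_square_le_1)

lemma varphi_pos: "\<bar>x\<bar> < 1 \<Longrightarrow> 0 < varphi x"
  by (simp add: varphi_def abs_square_less_1)

lemma varphi_square: "\<bar>x\<bar> \<le> 1 \<Longrightarrow> varphi x ^ 2 = 1 - x ^ 2"
  by (simp add: varphi_def abs_square_le_1)

lemma varphi_has_derivative:
  assumes "\<bar>x\<bar> < 1"
  shows "(varphi has_real_derivative - x / varphi x) (at x)"
proof -
  have "1 - x\<^sup>2 > 0" using assms by (simp add: abs_square_less_1)
  then show ?thesis unfolding varphi_def[abs_def]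
    by (auto intro!: derivative_eq_intros simp: field_simps)
qed

lemma cos_moment_has_integral: "((\<lambda>t. cos t ^ b) has_integral cos_moment b) {0..2 * pi}"
  unfolding cos_moment_def
  by (intro integrable_integral integrable_continuous_real continuous_intros)

lemma phi_moment_has_integral: "((\<lambda>x. x ^ a * varphi x ^ b) has_integral phi_moment a b) {-1..1}"
  unfolding phi_moment_def
  by (intro integrable_integral integrable_continuous_real continuous_intros)

lemma cos_moment_0: "cos_moment 0 = 2 * pi"
  using cos_power_cos_has_integral[of 0 0] cos_moment_has_integral[of 0]
  by (simp add: has_integral_unique)

lemma cos_moment_1: "cos_moment (Suc 0) = 0"
proof -
  have "((\<lambda>t. cos t) has_integral (sin (2 * pi) - sin 0)) {0..2 * pi}"
    by (rule fundamental_theorem_of_calculus)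
      (auto intro!: derivative_eq_intros simp flip: has_real_derivative_iff_has_vector_derivative)
  then show ?thesis using cos_moment_has_integral[of "Suc 0"] by (simp add: has_integral_unique)
qed

text \<open>The derivative of \<open>cos t ^ Suc b * sin t\<close> is integrated over a
  period.\<close>

lemma cos_moment_Suc_Suc: "(real b + 2) * cos_moment (Suc (Suc b)) = (real b + 1) * cos_moment b"
proof -
  have "((\<lambda>t. (real b + 2) * cos t ^ Suc (Suc b) - (real b + 1) * cos t ^ b) has_integral
      (cos (2 * pi) ^ Suc b * sin (2 * pi) - cos 0 ^ Suc b * sin 0)) {0..2 * pi}"
  proof (rule fundamental_theorem_of_calculus, simp)
    fix t :: real
    have s2: "sin t * sin t = 1 - cos t * cos t"
      using sin_cos_squared_add[of t] by (simp add: power2_eq_square algebra_simps)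
    have "((\<lambda>t. cos t ^ Suc b * sin t) has_real_derivative
      real (Suc b) * cos t ^ b * (- sin t) * sin t + cos t ^ Suc b * cos t) (at t within {0..2 * pi})"
      by (rule DERIV_cong[OF DERIV_mult[OF DERIV_power_Suc_within]])
        (auto intro!: derivative_eq_intros)
    also have "real (Suc b) * cos t ^ b * (- sin t) * sin t + cos t ^ Suc b * cos t
      = - real (Suc b) * cos t ^ b * (sin t * sin t) + cos t ^ Suc b * cos t" by (simp add: algebra_simps)
    also have "\<dots> = (real b + 2) * cos t ^ Suc (Suc b) - (real b + 1) * cos t ^ b"
      unfolding s2 by (simp add: algebra_simps)
    finally show "((\<lambda>t. cos t ^ Suc b * sin t) has_vector_derivative
      (real b + 2) * cos t ^ Suc (Suc b) - (real b + 1) * cos t ^ b) (at t within {0..2 * pi})"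
      by (simp add: has_real_derivative_iff_has_vector_derivative)
  qed
  moreover have "((\<lambda>t. (real b + 2) * cos t ^ Suc (Suc b) - (real b + 1) * cos t ^ b) has_integral
      (real b + 2) * cos_moment (Suc (Suc b)) - (real b + 1) * cos_moment b) {0..2 * pi}"
    by (intro has_integral_diff has_integral_mult_right cos_moment_has_integral)
  ultimately show ?thesis by (auto dest: has_integral_unique)
qed

lemma phi_moment_1: "phi_moment (Suc 0) b = 0"
proof -
  have "((\<lambda>x. - (real b + 2) * (x ^ Suc 0 * varphi x ^ b)) has_integral
      (varphi 1 ^ Suc (Suc b) - varphi (-1) ^ Suc (Suc b))) {-1..1}"
  proof (rule fundamental_theorem_of_calculus_interior)
    fix x :: real assume x: "x \<in> {-1<..<1}"
    then have p: "varphi x > 0" by (intro varphi_pos) auto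
    have "((\<lambda>x. varphi x ^ Suc (Suc b)) has_real_derivative
      real (Suc (Suc b)) * varphi x ^ Suc b * (- x / varphi x)) (at x)"
      using x by (intro DERIV_power_Suc_within varphi_has_derivative) auto
    also have "real (Suc (Suc b)) * varphi x ^ Suc b * (- x / varphi x) = - (real b + 2) * (x ^ Suc 0 * varphi x ^ b)"
      using p by (simp add: algebra_simps)
    finally show "((\<lambda>x. varphi x ^ Suc (Suc b)) has_vector_derivative
       - (real b + 2) * (x ^ Suc 0 * varphi x ^ b)) (at x)"
      by (simp add: has_real_derivative_iff_has_vector_derivative)
  qed (auto intro!: continuous_intros)
  then have "((\<lambda>x. - (real b + 2) * (x ^ Suc 0 * varphi x ^ b)) has_integral 0) {-1..1}"
    by (simp add: varphi_def)
  moreover have "((\<lambda>x. - (real b + 2) * (x ^ Suc 0 * varphi x ^ b)) has_integral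
      - (real b + 2) * phi_moment (Suc 0) b) {-1..1}"
    by (intro has_integral_mult_right phi_moment_has_integral)
  ultimately have "- (real b + 2) * phi_moment (Suc 0) b = 0" by (rule has_integral_unique[rotated])
  moreover have "real b + 2 \<noteq> 0" by linarith
  ultimately show ?thesis by simp
qed

text \<open>The derivative of \<open>x ^ Suc a * varphi x ^ Suc (Suc b)\<close>, a product that
  vanishes at both ends, is integrated. Since \<open>varphi\<close> is not differentiable at 1 and
  -1, only interior derivatives are used.\<close>

lemma phi_moment_Suc_Suc:
  "(real a + 1) * phi_moment a (Suc (Suc b)) = (real b + 2) * phi_moment (Suc (Suc a)) b"
proof -
  have "((\<lambda>x. (real a + 1) * (x ^ a * varphi x ^ Suc (Suc b)) - (real b + 2) * (x ^ Suc (Suc a) * varphi x ^ b)) has_integral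
      (1 ^ Suc a * varphi 1 ^ Suc (Suc b) - (-1) ^ Suc a * varphi (-1) ^ Suc (Suc b))) {-1..1}"
  proof (rule fundamental_theorem_of_calculus_interior)
    fix x :: real assume x: "x \<in> {-1<..<1}"
    then have p: "varphi x > 0" by (intro varphi_pos) auto
    have "((\<lambda>x. x ^ Suc a * varphi x ^ Suc (Suc b)) has_real_derivative
      (real (Suc a) * x ^ a) * varphi x ^ Suc (Suc b) +
      x ^ Suc a * (real (Suc (Suc b)) * varphi x ^ Suc b * (- x / varphi x))) (at x)"
      by (rule DERIV_cong[OF DERIV_mult[OF DERIV_power_Suc_within[OF DERIV_ident]
            DERIV_power_Suc_within[OF varphi_has_derivative]]]) (use x in auto)
    also have "(real (Suc a) * x ^ a) * varphi x ^ Suc (Suc b) +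
      x ^ Suc a * (real (Suc (Suc b)) * varphi x ^ Suc b * (- x / varphi x))
      = (real a + 1) * (x ^ a * varphi x ^ Suc (Suc b)) - (real b + 2) * (x ^ Suc (Suc a) * varphi x ^ b)"
      using p by (simp add: algebra_simps)
    finally show "((\<lambda>x. x ^ Suc a * varphi x ^ Suc (Suc b)) has_vector_derivative
       (real a + 1) * (x ^ a * varphi x ^ Suc (Suc b)) - (real b + 2) * (x ^ Suc (Suc a) * varphi x ^ b)) (at x)"
      by (simp add: has_real_derivative_iff_has_vector_derivative)
  qed (auto intro!: continuous_intros)
  then have "((\<lambda>x. (real a + 1) * (x ^ a * varphi x ^ Suc (Suc b)) - (real b + 2) * (x ^ Suc (Suc a) * varphi x ^ b)) has_integral 0) {-1..1}"
    by (simp add: varphi_def)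
  moreover have "((\<lambda>x. (real a + 1) * (x ^ a * varphi x ^ Suc (Suc b)) - (real b + 2) * (x ^ Suc (Suc a) * varphi x ^ b)) has_integral
     (real a + 1) * phi_moment a (Suc (Suc b)) - (real b + 2) * phi_moment (Suc (Suc a)) b) {-1..1}"
    by (intro has_integral_diff has_integral_mult_right phi_moment_has_integral)
  ultimately show ?thesis by (auto dest: has_integral_unique)
qed

text \<open>This identity expresses that the rotation field annihilates the integral over the sphere.\<close>

lemma moment_rotation:
  assumes "b \<le> m"
  shows "real (m - b) * (real (m choose b) * phi_moment (m - b) b * cos_moment b)
    = (real b + 2) * (real (m choose (b + 2)) * phi_moment (m - b - 2) (b + 2) * cos_moment (b + 2))"
proof -
  \<comment> \<open>For m = b the factor m - b is 0, for m = b + 1 the moment of an odd power of x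
    is 0, and in both cases the binomial coefficient on the right is 0.\<close>
  consider "m = b" | "m = Suc b" | a where "m = b + 2 + a"
    using assms by (metis Suc_leI add_2_eq_Suc' le_Suc_ex le_eq_less_or_eq)
  then show ?thesis
  proof cases
    case 3
    have ab: "real n * (real ((k + n) choose k)) = (real k + 1) * real ((k + n) choose Suc k)" for n k
    proof -
      have "n * ((k + n) choose k) = Suc k * ((k + n) choose Suc k)"
        using binomial_absorb_comp[of "k + n" k] binomial_absorption[of k "k + n"] by simp
      then show ?thesis by (metis of_nat_mult of_nat_Suc add.commute)
    qed
    define c0 where "c0 = real (m choose b)"
    define c1 where "c1 = real (m choose Suc b)"
    define c2 where "c2 = real (m choose (b + 2))"
    define u where "u = phi_moment a (b + 2)"
    define v where "v = phi_moment (a + 2) b"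
    define w where "w = cos_moment (b + 2)"
    define z where "z = cos_moment b"
    have 1: "(real a + 2) * c0 = (real b + 1) * c1"
      using ab[of "a + 2" b] 3 by (simp add: c0_def c1_def add_ac)
    have 2: "(real a + 1) * c1 = (real b + 2) * c2"
      using ab[of "a + 1" "Suc b"] 3 by (simp add: c2_def c1_def add_ac)
    have u: "(real a + 1) * u = (real b + 2) * v"
      using phi_moment_Suc_Suc[of a b] by (simp add: u_def v_def)
    have w: "(real b + 2) * w = (real b + 1) * z"
      using cos_moment_Suc_Suc[of b] by (simp add: w_def z_def)
    \<comment> \<open>The extra factor a + 1 lets the two binomial recurrences and the two moment
      recurrences be chained; it is cancelled afterwards.\<close>
    have "(real a + 1) * ((real a + 2) * (c0 * v * z)) = (real a + 1) * ((real b + 2) * (c2 * u * w))"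
    proof -
      have "(real a + 1) * ((real a + 2) * (c0 * v * z)) = (real a + 1) * ((real b + 1) * c1) * v * z"
        unfolding 1[symmetric] by (simp only: mult_ac)
      also have "\<dots> = ((real a + 1) * c1) * v * ((real b + 1) * z)" by (simp only: mult_ac)
      also have "\<dots> = c2 * ((real b + 2) * v) * ((real b + 2) * w)"
        unfolding 2 w[symmetric] by (simp only: mult_ac)
      also have "\<dots> = (real a + 1) * ((real b + 2) * (c2 * u * w))"
        unfolding u[symmetric] by (simp only: mult_ac)
      finally show ?thesis .
    qed
    then have "(real a + 2) * (c0 * v * z) = (real b + 2) * (c2 * u * w)"
      by (simp only: mult_cancel_left) linarith
    moreover have "m - b = a + 2" "m - b - 2 = a" using 3 by auto
    ultimately show ?thesis by (simp add: c0_def c2_def u_def v_def w_def z_def add.commute)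
  next
    case 1
    then show ?thesis by simp
  next
    case 2
    then show ?thesis by (simp add: phi_moment_1 binomial_eq_0)
  qed
qed

text \<open>The argument of H is the height, after a rotation by \<alpha> about a horizontal axis,
  of the point with height x and longitude t. The average over the longitude is not normalised: its
  total weight is 2 pi.\<close>

definition sphere_avg :: "(real \<Rightarrow> real) \<Rightarrow> real \<Rightarrow> real \<Rightarrow> real" where
  "sphere_avg H \<alpha> x = integral {0..2 * pi} (\<lambda>t. H (x * cos \<alpha> + varphi x * sin \<alpha> * cos t))"

lemma sphere_point_bound:
  assumes "\<bar>x\<bar> \<le> 1"
  shows "x * cos \<alpha> + varphi x * sin \<alpha> * cos t \<in> {-1..1}"
proof -
  let ?y = "x * cos \<alpha> + varphi x * sin \<alpha> * cos t"
  \<comment> \<open>The added square is that of a second coordinate of the rotated point; the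
    identity below is the invariance of length in the plane of rotation.\<close>
  have "?y\<^sup>2 \<le> ?y\<^sup>2 + (varphi x * cos \<alpha> * cos t - x * sin \<alpha>)\<^sup>2" by simp
  also have "\<dots> = x\<^sup>2 * ((cos \<alpha>)\<^sup>2 + (sin \<alpha>)\<^sup>2) + (varphi x)\<^sup>2 * (cos t)\<^sup>2 * ((cos \<alpha>)\<^sup>2 + (sin \<alpha>)\<^sup>2)"
    unfolding power2_eq_square by (simp only: algebra_simps)
  also have "\<dots> = x\<^sup>2 + (varphi x)\<^sup>2 * (cos t)\<^sup>2" by simp
  also have "\<dots> \<le> x\<^sup>2 + (varphi x)\<^sup>2 * 1"
    by (intro add_mono mult_left_mono) (auto simp: abs_square_le_1)
  also have "\<dots> = 1" using assms by (simp add: varphi_square)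
  finally have "\<bar>?y\<bar> \<le> 1" by (simp add: abs_square_le_1)
  then show ?thesis by auto
qed

lemma sphere_point_power_has_integral:
  "((\<lambda>t. (x * cos \<alpha> + varphi x * sin \<alpha> * cos t) ^ m) has_integral
    (\<Sum>b\<le>m. real (m choose b) * cos \<alpha> ^ (m - b) * sin \<alpha> ^ b * cos_moment b * (x ^ (m - b) * varphi x ^ b))) {0..2 * pi}"
proof -
  have "((\<lambda>t. \<Sum>b\<le>m. (real (m choose b) * cos \<alpha> ^ (m - b) * sin \<alpha> ^ b * (x ^ (m - b) * varphi x ^ b)) * cos t ^ b) has_integral
    (\<Sum>b\<le>m. (real (m choose b) * cos \<alpha> ^ (m - b) * sin \<alpha> ^ b * (x ^ (m - b) * varphi x ^ b)) * cos_moment b)) {0..2 * pi}"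
    by (intro has_integral_sum has_integral_mult_right cos_moment_has_integral) auto
  moreover have "(\<Sum>b\<le>m. (real (m choose b) * cos \<alpha> ^ (m - b) * sin \<alpha> ^ b * (x ^ (m - b) * varphi x ^ b)) * cos t ^ b)
    = (x * cos \<alpha> + varphi x * sin \<alpha> * cos t) ^ m" for t
    by (subst add.commute, subst binomial_ring) (simp add: power_mult_distrib mult_ac)
  ultimately show ?thesis by (simp add: mult_ac)
qed

text \<open>The integral is a polynomial in cos \<alpha> and sin \<alpha>. Its derivative in
  \<alpha> vanishes by \<open>moment_rotation\<close>, so its value can be read off at \<alpha> =
  0.\<close>

lemma sphere_avg_power_has_integral:
  "((sphere_avg (\<lambda>y. y ^ m) \<alpha>) has_integral 2 * pi * integral {-1..1} (\<lambda>y. y ^ m)) {-1..1}"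
proof -
  define w where "w b = real (m choose b) * phi_moment (m - b) b * cos_moment b" for b
  define I where "I \<alpha> = (\<Sum>b\<le>m. w b * (cos \<alpha> ^ (m - b) * sin \<alpha> ^ b))" for \<alpha> :: real
  have rot: "real (m - b) * w b = (real b + 2) * w (b + 2)" if "b \<le> m" for b
    using moment_rotation[OF that] by (simp add: w_def)
  have w1: "w (Suc 0) = 0" by (simp add: w_def cos_moment_1)
  have w0: "w b = 0" if "m < b" for b using that by (simp add: w_def binomial_eq_0)
  have der: "(I has_real_derivative 0) (at \<alpha>)" for \<alpha>
  proof -
    let ?c = "cos \<alpha>" and ?s = "sin \<alpha>"
    define g where "g b = w b * (?c ^ (m - b) * (real b * ?s ^ (b - 1) * ?c))" for b
    have "(I has_real_derivative (\<Sum>b\<le>m. w b * (?c ^ (m - b) * (real b * ?s ^ (b - 1) * ?c)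
        + real (m - b) * ?c ^ (m - b - 1) * (- ?s) * ?s ^ b))) (at \<alpha>)"
      unfolding I_def by (auto intro!: derivative_eq_intros simp: mult_ac)
    also have "(\<Sum>b\<le>m. w b * (?c ^ (m - b) * (real b * ?s ^ (b - 1) * ?c)
        + real (m - b) * ?c ^ (m - b - 1) * (- ?s) * ?s ^ b)) =
      (\<Sum>b\<le>m. g b) - (\<Sum>b\<le>m. real (m - b) * w b * (?c ^ (m - b - 1) * ?s ^ Suc b))"
      unfolding g_def sum_subtractf[symmetric] by (intro sum.cong) (auto simp: algebra_simps)
    \<comment> \<open>The weights vanish beyond m, so the sum may be extended by two terms. The
      first two terms are 0, one by the factor b and one by \<open>w1\<close>. After this shift by
      two, the sums cancel term by term through \<open>rot\<close>.\<close>
    also have "(\<Sum>b\<le>m. g b) = (\<Sum>b\<le>Suc (Suc m). g b)"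
      by (simp add: g_def w0)
    also have "\<dots> = (\<Sum>b\<le>m. g (Suc (Suc b)))"
      by (subst sum.atMost_Suc_shift, subst sum.atMost_Suc_shift) (simp add: g_def w1)
    also have "\<dots> = (\<Sum>b\<le>m. real (m - b) * w b * (?c ^ (m - b - 1) * ?s ^ Suc b))"
    proof (rule sum.cong, simp)
      fix b assume "b \<in> {..m}"
      then have b: "b \<le> m" by simp
      show "g (Suc (Suc b)) = real (m - b) * w b * (?c ^ (m - b - 1) * ?s ^ Suc b)"
      proof (cases "b + 2 \<le> m")
        case True
        then have "m - b - 1 = Suc (m - Suc (Suc b))" by simp
        then show ?thesis unfolding rot[OF b] by (simp add: g_def mult_ac)
      next
        case False
        then show ?thesis unfolding rot[OF b] by (simp add: g_def w0)
      qed
    qed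
    finally show ?thesis by simp
  qed
  have "I \<alpha> = I 0" using DERIV_isconst_all der by blast
  also have "I 0 = (\<Sum>b\<le>m. if b = 0 then w 0 else 0)"
    unfolding I_def by (intro sum.cong) auto
  also have "\<dots> = 2 * pi * integral {-1..1} (\<lambda>y. y ^ m)"
    by (simp add: w_def cos_moment_0 phi_moment_def)
  finally have I: "I \<alpha> = 2 * pi * integral {-1..1} (\<lambda>y. y ^ m)" .
  have "((\<lambda>x. \<Sum>b\<le>m. real (m choose b) * cos \<alpha> ^ (m - b) * sin \<alpha> ^ b * cos_moment b * (x ^ (m - b) * varphi x ^ b)) has_integral
    (\<Sum>b\<le>m. real (m choose b) * cos \<alpha> ^ (m - b) * sin \<alpha> ^ b * cos_moment b * phi_moment (m - b) b)) {-1..1}"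
    by (intro has_integral_sum has_integral_mult_right phi_moment_has_integral) auto
  also have "(\<Sum>b\<le>m. real (m choose b) * cos \<alpha> ^ (m - b) * sin \<alpha> ^ b * cos_moment b * phi_moment (m - b) b) = I \<alpha>"
    by (simp add: I_def w_def mult_ac)
  finally show ?thesis unfolding I sphere_avg_def
    by (simp add: integral_unique[OF sphere_point_power_has_integral])
qed

section \<open>Continuity and rotation invariance of the averages\<close>

lemma continuous_on_sphere_integrand:
  fixes H w :: "real \<Rightarrow> real"
  assumes "continuous_on {-1..1} H" "continuous_on {0..2 * pi} w"
  shows "continuous_on ({-1..1} \<times> cbox 0 (2 * pi))
    (\<lambda>(x, t). H (x * cos \<alpha> + varphi x * sin \<alpha> * cos t) * w t)"
proof -
  have cv: "continuous_on S (\<lambda>z. varphi (fst z))" for S :: "(real \<times> real) set"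
    by (rule continuous_on_compose2[OF continuous_on_varphi[of UNIV]]) (auto intro!: continuous_intros)
  have "continuous_on ({-1..1} \<times> cbox 0 (2 * pi)) (\<lambda>z. H (fst z * cos \<alpha> + varphi (fst z) * sin \<alpha> * cos (snd z)))"
    by (rule continuous_on_compose2[OF assms(1)])
      (use sphere_point_bound in \<open>auto intro!: continuous_intros cv simp: abs_le_iff\<close>)
  moreover have "continuous_on ({-1..1::real} \<times> cbox 0 (2 * pi)) (\<lambda>z. w (snd z))"
    by (rule continuous_on_compose2[OF assms(2)]) (auto intro!: continuous_intros)
  ultimately show ?thesis unfolding case_prod_beta by (rule continuous_on_mult)
qed

lemma continuous_on_sphere_point:
  assumes "continuous_on {-1..1} H" "\<bar>x\<bar> \<le> 1"
  shows "continuous_on S (\<lambda>t. H (x * cos \<alpha> + varphi x * sin \<alpha> * cos t))"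
  by (rule continuous_on_compose2[OF assms(1)])
    (use sphere_point_bound[OF assms(2)] in \<open>auto intro!: continuous_intros simp: subset_iff\<close>)

lemma continuous_on_sphere_avg:
  assumes "continuous_on {-1..1} H"
  shows "continuous_on {-1..1} (sphere_avg H \<alpha>)"
  using integral_continuous_on_param[OF continuous_on_sphere_integrand[OF assms, of "\<lambda>_. 1"]]
  by (simp add: sphere_avg_def[abs_def])

text \<open>Rotation invariance of the uniform measure on the two-sphere, for functions of the height
  (whose distribution on \<open>[-1, 1]\<close> is uniform).\<close>

lemma integral_sphere_avg:
  assumes H: "continuous_on {-1..1} H"
  shows "integral {-1..1} (sphere_avg H \<alpha>) = 2 * pi * integral {-1..1} H"
proof -
  \<comment> \<open>Linearity passes from powers to polynomials. Both sides are continuous under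
    uniform convergence, so Weierstrass approximation does the rest.\<close>
  have poly: "integral {-1..1} (sphere_avg P \<alpha>) = 2 * pi * integral {-1..1} P"
    if P: "real_polynomial_function P" for P
  proof -
    obtain a n where P: "P = (\<lambda>y. \<Sum>i\<le>n. a i * y ^ i)"
      using P real_polynomial_function_iff_sum by blast
    have "sphere_avg P \<alpha> x = (\<Sum>i\<le>n. a i * sphere_avg (\<lambda>y. y ^ i) \<alpha> x)" for x
      unfolding P sphere_avg_def
      by (subst integral_sum) (auto intro!: integrable_continuous_real continuous_intros)
    then have "sphere_avg P \<alpha> = (\<lambda>x. \<Sum>i\<le>n. a i * sphere_avg (\<lambda>y. y ^ i) \<alpha> x)" by blast
    then have "integral {-1..1} (sphere_avg P \<alpha>) = (\<Sum>i\<le>n. a i * integral {-1..1} (sphere_avg (\<lambda>y. y ^ i) \<alpha>))"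
      by (simp only:, subst integral_sum)
        (auto intro!: integrable_continuous_real continuous_intros continuous_on_sphere_avg)
    also have "\<dots> = 2 * pi * (\<Sum>i\<le>n. a i * integral {-1..1} (\<lambda>y. y ^ i))"
      by (simp add: integral_unique[OF sphere_avg_power_has_integral] sum_distrib_left mult_ac)
    also have "(\<Sum>i\<le>n. a i * integral {-1..1} (\<lambda>y. y ^ i)) = integral {-1..1} P"
      unfolding P by (subst integral_sum) (auto intro!: integrable_continuous_real continuous_intros)
    finally show ?thesis .
  qed
  have "\<bar>integral {-1..1} (sphere_avg H \<alpha>) - 2 * pi * integral {-1..1} H\<bar> \<le> e" if "e > 0" for e
  proof -
    \<comment> \<open>Replacing H by P changes either side by at most 4 pi d = e / 2.\<close>
    define d where "d = e / (8 * pi)"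
    have d: "d > 0" using that by (simp add: d_def)
    obtain P where P: "real_polynomial_function P" "\<And>x. x \<in> {-1..1} \<Longrightarrow> \<bar>H x - P x\<bar> < d"
      using Stone_Weierstrass_real_polynomial_function[OF _ H d] by auto
    have cP: "continuous_on {-1..1} P"
      using P(1) real_polynomial_function_iff_sum by (auto intro!: continuous_intros)
    have 1: "\<bar>integral {-1..1} H - integral {-1..1} P\<bar> \<le> d * 2"
    proof -
      have "norm (integral {-1..1} (\<lambda>x. H x - P x)) \<le> d * (1 - (-1))"
        by (rule integral_bound) (use P H cP in \<open>auto intro!: continuous_intros simp: less_imp_le\<close>)
      then show ?thesis using H cP by (subst (asm) integral_diff) (auto intro: integrable_continuous_real)
    qed
    have 2: "\<bar>sphere_avg H \<alpha> x - sphere_avg P \<alpha> x\<bar> \<le> d * (2 * pi)" if x: "x \<in> {-1..1}" for x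
    proof -
      have ax: "\<bar>x\<bar> \<le> 1" using x by auto
      have "norm (integral {0..2 * pi} (\<lambda>t. H (x * cos \<alpha> + varphi x * sin \<alpha> * cos t) - P (x * cos \<alpha> + varphi x * sin \<alpha> * cos t))) \<le> d * (2 * pi - 0)"
        by (rule integral_bound)
          (use P H cP sphere_point_bound[OF ax] in \<open>auto intro!: continuous_intros continuous_on_sphere_point ax less_imp_le\<close>)
      then show ?thesis unfolding sphere_avg_def using H cP ax
        by (subst (asm) integral_diff) (auto intro!: integrable_continuous_real continuous_on_sphere_point)
    qed
    have 3: "\<bar>integral {-1..1} (sphere_avg H \<alpha>) - integral {-1..1} (sphere_avg P \<alpha>)\<bar> \<le> d * (2 * pi) * 2"
    proof -
      have "norm (integral {-1..1} (\<lambda>x. sphere_avg H \<alpha> x - sphere_avg P \<alpha> x)) \<le> d * (2 * pi) * (1 - (-1))"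
        by (rule integral_bound) (use 2 H cP in \<open>auto intro!: continuous_intros continuous_on_sphere_avg\<close>)
      then show ?thesis using H cP
        by (subst (asm) integral_diff) (auto intro!: integrable_continuous_real continuous_on_sphere_avg)
    qed
    have "\<bar>2 * pi * integral {-1..1} P - 2 * pi * integral {-1..1} H\<bar>
      = 2 * pi * \<bar>integral {-1..1} H - integral {-1..1} P\<bar>"
      unfolding right_diff_distrib[symmetric] abs_mult by (simp add: abs_minus_commute)
    also have "\<dots> \<le> 2 * pi * (d * 2)"
      using 1 by (intro mult_left_mono) auto
    also have "2 * pi * (d * 2) = e / 2"
      using pi_gt_zero by (simp add: d_def)
    finally have "\<bar>2 * pi * integral {-1..1} P - 2 * pi * integral {-1..1} H\<bar> \<le> e / 2" .
    moreover have "d * (2 * pi) * 2 = e / 2" using pi_gt_zero by (simp add: d_def)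
    ultimately show ?thesis using 3 poly[OF P(1)] by linarith
  qed
  then show ?thesis by (metis abs_le_zero_iff dense_ge eq_iff_diff_eq_0)
qed

section \<open>Jensen's inequality and norms of harmonic averages\<close>

lemma powr_ge_tangent:
  fixes q u v :: real
  assumes "1 \<le> q" "0 \<le> u" "0 < v"
  shows "v powr q + q * v powr (q - 1) * (u - v) \<le> u powr q"
proof (cases "u = 0")
  case True
  have "v powr q = v powr (q - 1) * v" using assms by (simp add: powr_diff)
  then have "v powr q + q * v powr (q - 1) * (u - v) = (1 - q) * v powr q"
    using True by (simp add: algebra_simps)
  also have "\<dots> \<le> 0" using assms by (intro mult_nonpos_nonneg) auto
  finally show ?thesis using True by simp
next
  case False
  have "u powr q - v powr q \<ge> (q * v powr (q - 1)) * (u - v)"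
    by (rule convex_on_imp_above_tangent[where A = "{0<..}"])
      (use assms False in \<open>auto intro!: powr_convex derivative_eq_intros simp: interior_open\<close>)
  then show ?thesis by linarith
qed

text \<open>Jensen's inequality: the tangent inequality at the mean value of u is integrated, which
  removes the linear term. A zero mean is treated apart because the tangent is taken at a positive
  point.\<close>

lemma integral_powr_le:
  fixes u :: "real \<Rightarrow> real"
  assumes q: "1 \<le> q" and u: "continuous_on {0..L} u" "\<And>t. t \<in> {0..L} \<Longrightarrow> 0 \<le> u t" and L: "0 < L"
  shows "(integral {0..L} u) powr q \<le> L powr (q - 1) * integral {0..L} (\<lambda>t. u t powr q)"
proof -
  define m where "m = integral {0..L} u / L"
  have iu: "u integrable_on {0..L}" using u integrable_continuous_real by blast
  have cq: "continuous_on {0..L} (\<lambda>t. u t powr q)"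
    using u q by (intro continuous_on_powr') auto
  have m0: "m \<ge> 0" unfolding m_def using L u iu by (intro divide_nonneg_pos integral_nonneg) auto
  show ?thesis
  proof (cases "m = 0")
    case True
    then have "integral {0..L} u = 0" using L by (simp add: m_def)
    moreover have "0 \<le> integral {0..L} (\<lambda>t. u t powr q)"
      using cq by (intro integral_nonneg integrable_continuous_real) auto
    ultimately show ?thesis by simp
  next
    case False
    then have m: "m > 0" using m0 by simp
    have "integral {0..L} (\<lambda>t. (m powr q - q * m powr (q - 1) * m) + q * m powr (q - 1) * u t)
      \<le> integral {0..L} (\<lambda>t. u t powr q)"
    proof (rule integral_le)
      fix t assume "t \<in> {0..L}"
      then show "(m powr q - q * m powr (q - 1) * m) + q * m powr (q - 1) * u t \<le> u t powr q"
        using powr_ge_tangent[OF q u(2) m, of t] by (simp add: algebra_simps)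
    qed (use u cq in \<open>auto intro!: integrable_continuous_real continuous_intros\<close>)
    also have "integral {0..L} (\<lambda>t. (m powr q - q * m powr (q - 1) * m) + q * m powr (q - 1) * u t)
      = (m powr q - q * m powr (q - 1) * m) * L + q * m powr (q - 1) * integral {0..L} u"
      using L iu by (subst integral_add) (auto intro: integrable_on_mult_right)
    also have "integral {0..L} u = m * L" using L by (simp add: m_def)
    also have "(m powr q - q * m powr (q - 1) * m) * L + q * m powr (q - 1) * (m * L) = m powr q * L"
      by (simp add: algebra_simps)
    finally have "m powr q * L \<le> integral {0..L} (\<lambda>t. u t powr q)" .
    then have "L powr (q - 1) * (m powr q * L) \<le> L powr (q - 1) * integral {0..L} (\<lambda>t. u t powr q)"
      by (intro mult_left_mono) auto
    moreover have "L powr (q - 1) * (m powr q * L) = (integral {0..L} u) powr q"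
    proof -
      have "L powr (q - 1) * (m powr q * L) = m powr q * L powr q"
        using L by (simp add: powr_diff)
      also have "\<dots> = (m * L) powr q" using L m by (simp add: powr_mult)
      finally show ?thesis using L by (simp add: m_def)
    qed
    ultimately show ?thesis by simp
  qed
qed

definition harmonic_avg :: "(real \<Rightarrow> real) \<Rightarrow> nat \<Rightarrow> real \<Rightarrow> real \<Rightarrow> real" where
  "harmonic_avg H s \<alpha> x =
    integral {0..2 * pi} (\<lambda>t. H (x * cos \<alpha> + varphi x * sin \<alpha> * cos t) * cos (real s * t))"

lemma continuous_on_harmonic_avg:
  assumes "continuous_on {-1..1} H"
  shows "continuous_on {-1..1} (harmonic_avg H s \<alpha>)"
  using integral_continuous_on_param[OF continuous_on_sphere_integrand[OF assms, of "\<lambda>t. cos (real s * t)"]]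
  by (simp add: harmonic_avg_def[abs_def] continuous_intros)

lemma abs_harmonic_avg_le:
  assumes H: "continuous_on {-1..1} H" and x: "\<bar>x\<bar> \<le> 1"
  shows "\<bar>harmonic_avg H s \<alpha> x\<bar> \<le> sphere_avg (\<lambda>y. \<bar>H y\<bar>) \<alpha> x"
proof -
  have "norm (harmonic_avg H s \<alpha> x) \<le> sphere_avg (\<lambda>y. \<bar>H y\<bar>) \<alpha> x"
    unfolding harmonic_avg_def sphere_avg_def
  proof (rule integral_norm_bound_integral)
    fix t
    show "norm (H (x * cos \<alpha> + varphi x * sin \<alpha> * cos t) * cos (real s * t)) \<le> \<bar>H (x * cos \<alpha> + varphi x * sin \<alpha> * cos t)\<bar>"
      by (simp add: abs_mult mult_left_le)
  qed (use H x in \<open>auto intro!: integrable_continuous_real continuous_intros continuous_on_sphere_point\<close>)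
  then show ?thesis by simp
qed

text \<open>For p = \<infinity> the averages evaluate H at all heights along a curve, so the almost
  everywhere bound on H is first made a bound at every point.\<close>

lemma AE_le_imp_le_continuous:
  fixes H :: "real \<Rightarrow> real"
  assumes "continuous_on {-1..1} H" "AE x in lebesgue_on {-1..1}. \<bar>H x\<bar> \<le> B" "x \<in> {-1..1}"
  shows "\<bar>H x\<bar> \<le> B"
proof (rule ccontr)
  assume "\<not> \<bar>H x\<bar> \<le> B"
  then have e: "\<bar>H x\<bar> - B > 0" by simp
  have "continuous_on {-1..1} (\<lambda>x. \<bar>H x\<bar>)" using assms by (intro continuous_intros)
  then obtain d where d: "d > 0" "\<And>y. y \<in> {-1..1} \<Longrightarrow> dist y x < d \<Longrightarrow> dist \<bar>H y\<bar> \<bar>H x\<bar> < \<bar>H x\<bar> - B"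
    using assms(3) e unfolding continuous_on_iff by metis
  define l where "l = max (-1) (x - d / 2)"
  define u where "u = min 1 (x + d / 2)"
  have lu: "l < u" using d(1) assms(3) by (auto simp: l_def u_def)
  have gt: "\<not> \<bar>H y\<bar> \<le> B" if "y \<in> {l..u}" for y
  proof -
    have "dist y x < d" "y \<in> {-1..1}" using that d(1) by (auto simp: l_def u_def dist_real_def)
    then show ?thesis using d(2)[of y] by (auto simp: dist_real_def)
  qed
  have "AE x in lebesgue. x \<in> {-1..1} \<longrightarrow> \<bar>H x\<bar> \<le> B"
    using assms(2) by (subst (asm) AE_restrict_space_iff) auto
  then have "AE x in lebesgue. x \<notin> {l..u}"
    by (rule eventually_mono) (use gt in \<open>force simp: l_def u_def\<close>)
  then have "emeasure lebesgue {l..u} = 0"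
    by (subst (asm) AE_iff_measurable[of "{l..u}"]) auto
  then show False using lu by simp
qed

text \<open>For finite q, Jensen's inequality in the longitude costs (2 pi)^(q - 1) and rotation
  invariance another factor 2 pi; the q-th root of the product is the 2 pi of the statement.\<close>

lemma Lp_norm_harmonic_avg:
  assumes p: "1 \<le> p" and H: "continuous_on {-1..1} H"
    and B: "Lp_norm p {-1..1} H \<le> ennreal B" "0 \<le> B"
  shows "Lp_norm p {-1..1} (harmonic_avg H s \<alpha>) \<le> ennreal (2 * pi * B)"
proof (cases "p = \<infinity>")
  case True
  have mH: "H \<in> borel_measurable (lebesgue_on {-1..1})"
    using H by (intro continuous_on_imp_measurable_lebesgue_on) auto
  have mA: "harmonic_avg H s \<alpha> \<in> borel_measurable (lebesgue_on {-1..1})"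
    using continuous_on_harmonic_avg[OF H] by (intro continuous_on_imp_measurable_lebesgue_on) auto
  have HB: "\<bar>H y\<bar> \<le> B" if "y \<in> {-1..1}" for y
    using AE_le_imp_le_continuous[OF H _ that] Lp_norm_infinity_le_iff[OF mH B(2)] B(1) True by simp
  have "\<bar>harmonic_avg H s \<alpha> x\<bar> \<le> 2 * pi * B" if x: "x \<in> {-1..1}" for x
  proof -
    have ax: "\<bar>x\<bar> \<le> 1" using x by auto
    have "\<bar>harmonic_avg H s \<alpha> x\<bar> \<le> sphere_avg (\<lambda>y. \<bar>H y\<bar>) \<alpha> x"
      by (rule abs_harmonic_avg_le[OF H ax])
    also have "\<dots> \<le> integral {0..2 * pi} (\<lambda>t. B)"
      unfolding sphere_avg_def using HB sphere_point_bound[OF ax] H ax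
      by (intro integral_le integrable_continuous_real continuous_intros continuous_on_sphere_point) auto
    finally show ?thesis by simp
  qed
  then have "AE x in lebesgue_on {-1..1}. \<bar>harmonic_avg H s \<alpha> x\<bar> \<le> 2 * pi * B"
    by (intro AE_I2) (auto simp: space_restrict_space)
  then show ?thesis using True Lp_norm_infinity_le_iff[OF mA, of "2 * pi * B"] B(2) by simp
next
  case False
  let ?q = "enn2real p" and ?L = "2 * pi"
  have q: "?q \<ge> 1" using p enn2real_ge_one False by blast
  let ?H = "\<lambda>y. \<bar>H y\<bar> powr ?q"
  have cH: "continuous_on {-1..1} ?H" using H q by (intro continuous_on_powr' continuous_intros) auto
  have "(\<integral>\<^sup>+x. ennreal (\<bar>harmonic_avg H s \<alpha> x\<bar> powr ?q) \<partial>lebesgue_on {-1..1})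
    \<le> (\<integral>\<^sup>+x. ennreal (?L powr (?q - 1) * sphere_avg ?H \<alpha> x) \<partial>lebesgue_on {-1..1})"
  proof (rule nn_integral_mono)
    fix x assume "x \<in> space (lebesgue_on {-1..1::real})"
    then have x: "\<bar>x\<bar> \<le> 1" by (auto simp: space_restrict_space)
    have "\<bar>harmonic_avg H s \<alpha> x\<bar> powr ?q \<le> (sphere_avg (\<lambda>y. \<bar>H y\<bar>) \<alpha> x) powr ?q"
      using q by (intro powr_mono2 abs_harmonic_avg_le[OF H x]) auto
    also have "\<dots> \<le> ?L powr (?q - 1) * sphere_avg ?H \<alpha> x"
      unfolding sphere_avg_def using H x
      by (intro integral_powr_le[OF q]) (auto intro!: continuous_intros continuous_on_sphere_point)
    finally show "ennreal (\<bar>harmonic_avg H s \<alpha> x\<bar> powr ?q) \<le> ennreal (?L powr (?q - 1) * sphere_avg ?H \<alpha> x)"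
      by (rule ennreal_leI)
  qed
  also have "\<dots> = ennreal (?L powr (?q - 1) * (2 * pi * integral {-1..1} ?H))"
  proof (rule nn_integral_lebesgue_on_has_integral)
    show "((\<lambda>x. ?L powr (?q - 1) * sphere_avg ?H \<alpha> x) has_integral ?L powr (?q - 1) * (2 * pi * integral {-1..1} ?H)) {-1..1}"
      unfolding integral_sphere_avg[OF cH, of \<alpha>, symmetric]
      by (intro has_integral_mult_right integrable_integral integrable_continuous_real continuous_on_sphere_avg cH)
    show "0 \<le> ?L powr (?q - 1) * sphere_avg ?H \<alpha> x" if "x \<in> {-1..1}" for x
      unfolding sphere_avg_def using that cH
      by (intro mult_nonneg_nonneg integral_nonneg integrable_continuous_real continuous_on_sphere_point) auto
  qed auto
  also have "\<dots> \<le> ennreal ((2 * pi * B) powr ?q)"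
  proof (rule ennreal_leI)
    have "ennreal (integral {-1..1} ?H) = (\<integral>\<^sup>+x. ennreal (?H x) \<partial>lebesgue_on {-1..1})"
      using cH by (intro nn_integral_lebesgue_on_has_integral[symmetric] integrable_integral integrable_continuous_real) auto
    also have "\<dots> \<le> ennreal (B powr ?q)" using Lp_norm_finite_le_iff[OF p False B(2)] B(1) by simp
    finally have "integral {-1..1} ?H \<le> B powr ?q" by simp
    then have "?L powr (?q - 1) * (2 * pi * integral {-1..1} ?H) \<le> ?L powr (?q - 1) * (2 * pi * B powr ?q)"
      by (intro mult_left_mono) auto
    also have "\<dots> = (2 * pi * B) powr ?q"
      using B by (simp add: powr_mult powr_diff)
    finally show "?L powr (?q - 1) * (2 * pi * integral {-1..1} ?H) \<le> (2 * pi * B) powr ?q" .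
  qed
  finally show ?thesis using Lp_norm_finite_le_iff[OF p False, of "2 * pi * B"] B(2) by simp
qed

section \<open>The Bernstein inequality in $L_p$\<close>

text \<open>Laurent polynomials of degree at most d in \<open>cis \<alpha>\<close>. Pulling out the
  lowest power leaves an ordinary polynomial of degree at most 2 d, so that products and
  translations become operations on \<open>poly\<close>.\<close>

definition trig_polys :: "nat \<Rightarrow> (real \<Rightarrow> complex) set" where
  "trig_polys d = {T. \<exists>q. degree q \<le> 2 * d \<and> T = (\<lambda>\<alpha>. cis (- (real d * \<alpha>)) * poly q (cis \<alpha>))}"

lemma trig_polys_mult:
  assumes "T \<in> trig_polys d" "U \<in> trig_polys e"
  shows "(\<lambda>\<alpha>. T \<alpha> * U \<alpha>) \<in> trig_polys (d + e)"
proof -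
  obtain q r where q: "degree q \<le> 2 * d" "T = (\<lambda>\<alpha>. cis (- (real d * \<alpha>)) * poly q (cis \<alpha>))"
    and r: "degree r \<le> 2 * e" "U = (\<lambda>\<alpha>. cis (- (real e * \<alpha>)) * poly r (cis \<alpha>))"
    using assms unfolding trig_polys_def by blast
  have "degree (q * r) \<le> 2 * (d + e)" using degree_mult_le[of q r] q r by simp
  moreover have "(\<lambda>\<alpha>. T \<alpha> * U \<alpha>) = (\<lambda>\<alpha>. cis (- (real (d + e) * \<alpha>)) * poly (q * r) (cis \<alpha>))"
  proof
    fix \<alpha>
    have "cis (- (real (d + e) * \<alpha>)) = cis (- (real d * \<alpha>)) * cis (- (real e * \<alpha>))"
      by (simp add: cis_mult algebra_simps)
    then show "T \<alpha> * U \<alpha> = cis (- (real (d + e) * \<alpha>)) * poly (q * r) (cis \<alpha>)"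
      unfolding q(2) r(2) by simp
  qed
  ultimately show ?thesis unfolding trig_polys_def by blast
qed

lemma trig_polys_const: "(\<lambda>_. c) \<in> trig_polys 0"
  unfolding trig_polys_def by (auto intro!: exI[of _ "[:c:]"])

lemma trig_polys_add:
  assumes "T \<in> trig_polys d" "U \<in> trig_polys d"
  shows "(\<lambda>\<alpha>. T \<alpha> + U \<alpha>) \<in> trig_polys d"
proof -
  obtain q r where q: "degree q \<le> 2 * d" "T = (\<lambda>\<alpha>. cis (- (real d * \<alpha>)) * poly q (cis \<alpha>))"
    and r: "degree r \<le> 2 * d" "U = (\<lambda>\<alpha>. cis (- (real d * \<alpha>)) * poly r (cis \<alpha>))"
    using assms unfolding trig_polys_def by blast
  have "degree (q + r) \<le> 2 * d" using degree_add_le q r by blast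
  moreover have "(\<lambda>\<alpha>. T \<alpha> + U \<alpha>) = (\<lambda>\<alpha>. cis (- (real d * \<alpha>)) * poly (q + r) (cis \<alpha>))"
    unfolding q r by (simp add: distrib_left)
  ultimately show ?thesis unfolding trig_polys_def by blast
qed

lemma trig_polys_cmult: "T \<in> trig_polys d \<Longrightarrow> (\<lambda>\<alpha>. c * T \<alpha>) \<in> trig_polys d"
  using trig_polys_mult[OF trig_polys_const] by force

lemma trig_polys_Suc:
  assumes "T \<in> trig_polys d"
  shows "T \<in> trig_polys (Suc d)"
proof -
  obtain q where q: "degree q \<le> 2 * d" "T = (\<lambda>\<alpha>. cis (- (real d * \<alpha>)) * poly q (cis \<alpha>))"
    using assms unfolding trig_polys_def by blast
  have "degree (pCons 0 q) \<le> 2 * Suc d" using q degree_pCons_le[of 0 q] by simp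
  moreover have "T \<alpha> = cis (- (real (Suc d) * \<alpha>)) * poly (pCons 0 q) (cis \<alpha>)" for \<alpha>
  proof -
    have "cis (- (real d * \<alpha>)) = cis (- (real (Suc d) * \<alpha>)) * cis \<alpha>"
      by (simp add: cis_mult algebra_simps)
    then show ?thesis unfolding q by simp
  qed
  ultimately show ?thesis unfolding trig_polys_def by blast
qed

lemma trig_polys_mono: "d \<le> e \<Longrightarrow> T \<in> trig_polys d \<Longrightarrow> T \<in> trig_polys e"
  by (induction e rule: dec_induct) (auto intro: trig_polys_Suc)

lemma trig_polys_sum:
  "(\<And>i. i \<in> I \<Longrightarrow> T i \<in> trig_polys d) \<Longrightarrow> (\<lambda>\<alpha>. \<Sum>i\<in>I. T i \<alpha>) \<in> trig_polys d"
proof (induction I rule: infinite_finite_induct)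
  case (insert i I)
  then show ?case using trig_polys_add[of "T i" d "\<lambda>\<alpha>. \<Sum>i\<in>I. T i \<alpha>"] by simp
qed (auto intro: trig_polys_mono[OF _ trig_polys_const])

lemma trig_polys_cis: "(\<lambda>\<alpha>. cis \<alpha>) \<in> trig_polys 1" "(\<lambda>\<alpha>. cis (- \<alpha>)) \<in> trig_polys 1"
proof -
  have "(\<lambda>\<alpha>. cis \<alpha>) = (\<lambda>\<alpha>. cis (- (real 1 * \<alpha>)) * poly [:0, 0, 1:] (cis \<alpha>))"
    by (simp add: cis_mult fun_eq_iff)
  moreover have "degree [:0, 0, 1::complex:] \<le> 2 * 1" by simp
  ultimately show "(\<lambda>\<alpha>. cis \<alpha>) \<in> trig_polys 1" unfolding trig_polys_def by blast
  have "(\<lambda>\<alpha>. cis (- \<alpha>)) = (\<lambda>\<alpha>. cis (- (real 1 * \<alpha>)) * poly [:1:] (cis \<alpha>))"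
    by simp
  moreover have "degree [:1::complex:] \<le> 2 * 1" by simp
  ultimately show "(\<lambda>\<alpha>. cis (- \<alpha>)) \<in> trig_polys 1" unfolding trig_polys_def by blast
qed

lemma trig_polys_cos: "(\<lambda>\<alpha>. complex_of_real (cos \<alpha>)) \<in> trig_polys 1"
  using trig_polys_add[OF trig_polys_cmult[OF trig_polys_cis(1), of "1/2"] trig_polys_cmult[OF trig_polys_cis(2), of "1/2"]]
  by (rule back_subst[of "\<lambda>f. f \<in> trig_polys 1"]) (auto simp: complex_eq_iff)

lemma trig_polys_sin: "(\<lambda>\<alpha>. complex_of_real (sin \<alpha>)) \<in> trig_polys 1"
  using trig_polys_add[OF trig_polys_cmult[OF trig_polys_cis(1), of "-\<i>/2"] trig_polys_cmult[OF trig_polys_cis(2), of "\<i>/2"]]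
  by (rule back_subst[of "\<lambda>f. f \<in> trig_polys 1"]) (auto simp: complex_eq_iff)

lemma trig_polys_power: "T \<in> trig_polys 1 \<Longrightarrow> (\<lambda>\<alpha>. T \<alpha> ^ m) \<in> trig_polys m"
proof (induction m)
  case 0
  then show ?case using trig_polys_const by simp
next
  case (Suc m)
  then show ?case using trig_polys_mult[of T 1 "\<lambda>\<alpha>. T \<alpha> ^ m" m] by simp
qed

lemma trig_polys_shift:
  assumes "T \<in> trig_polys d"
  shows "(\<lambda>\<alpha>. T (\<alpha> - u)) \<in> trig_polys d"
proof -
  obtain q where q: "degree q \<le> 2 * d" "T = (\<lambda>\<alpha>. cis (- (real d * \<alpha>)) * poly q (cis \<alpha>))"
    using assms unfolding trig_polys_def by blast
  define r where "r = smult (cis (real d * u)) (pcompose q [:0, cis (- u):])"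
  have "degree r \<le> degree q * degree [:0, cis (- u):]"
    unfolding r_def by (intro order_trans[OF degree_smult_le] degree_pcompose_le)
  also have "\<dots> \<le> 2 * d" using q by simp
  finally have "degree r \<le> 2 * d" .
  moreover have "T (\<alpha> - u) = cis (- (real d * \<alpha>)) * poly r (cis \<alpha>)" for \<alpha>
    unfolding q r_def by (simp add: poly_pcompose cis_mult algebra_simps)
  ultimately show ?thesis unfolding trig_polys_def by blast
qed

section \<open>Differentiation as a combination of translations\<close>

lemma sum_cis_roots:
  fixes j :: int
  assumes "\<bar>j\<bar> < int M"
  shows "(\<Sum>k<M. cis (of_int j * (2 * pi * real k / real M))) = (if j = 0 then of_nat M else 0)"
proof (cases "j = 0")
  case False
  define z where "z = cis (2 * pi * of_int j / real M)"
  have M: "real M > 0" using assms by linarith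
  have zM: "z ^ M = 1"
  proof -
    have "z ^ M = cis (real M * (2 * pi * of_int j / real M))" unfolding z_def by (rule Complex.DeMoivre)
    also have "\<dots> = cis (2 * pi * of_int j)" using M by (simp del: cis_multiple_2pi)
    finally have "z ^ M = cis (2 * pi * of_int j)" .
    then show ?thesis by simp
  qed
  have "z \<noteq> 1"
  proof
    assume "z = 1"
    then have "cos (2 * pi * of_int j / real M) = 1" by (simp add: z_def complex_eq_iff)
    then obtain n :: int where "2 * pi * of_int j / real M = of_int n * 2 * pi"
      using cos_one_2pi_int by blast
    then have "of_int j = of_int n * real M" using M by (simp add: field_simps)
    then have "j = n * int M" by (metis of_int_eq_iff of_int_mult of_int_of_nat_eq)
    moreover have "n \<noteq> 0" using False \<open>j = n * int M\<close> by auto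
    ultimately have "int M \<le> \<bar>j\<bar>"
      using mult_right_mono[of 1 "\<bar>n\<bar>" "int M"] by (simp add: abs_mult)
    then show False using assms by simp
  qed
  have "(\<Sum>k<M. cis (of_int j * (2 * pi * real k / real M))) = (\<Sum>k<M. z ^ k)"
    by (intro sum.cong) (auto simp: z_def Complex.DeMoivre mult_ac)
  also have "\<dots> = 0" using \<open>z \<noteq> 1\<close> zM by (simp add: geometric_sum)
  finally show ?thesis using False by simp
qed simp

text \<open>A discrete version of the identity $n \sin (n u) F_n(u) = \sum_{j=1}^n j \sin (j u)$ up to
  higher frequencies, where $F_n$ is the (nonnegative) Fejer kernel.\<close>

lemma fejer_differentiation:
  fixes n :: nat
  assumes n: "1 \<le> n"
  obtains w u :: "nat \<Rightarrow> real" and M :: nat where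
    "(\<Sum>k<M. \<bar>w k\<bar>) \<le> 2 * real n"
    "\<And>j::int. \<bar>j\<bar> \<le> int n \<Longrightarrow> (\<Sum>k<M. of_real (w k) * cis (- (of_int j * u k))) = \<i> * of_int j"
proof -
  \<comment> \<open>The frequencies below are j + l - l' with |j| \<le> 2 n and |l - l'| < n, hence
    smaller than 3 n in absolute value: with 3 n nodes the discrete orthogonality is exact for
    them.\<close>
  define M where "M = 3 * n"
  define u where "u k = 2 * pi * real k / real M" for k
  define S where "S t = (\<Sum>l<n. cis (real l * t))" for t
  define F where "F t = (cmod (S t))\<^sup>2 / real n" for t
  \<comment> \<open>Multiplying the Fejer kernel by sin (n u) moves its triangle of coefficients to
    the frequencies n and -n. Between these the difference of the two triangles is linear, which is
    the multiplier of differentiation. The total weight 2 n loses a factor 2 against the sharp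
    constant n.\<close>
  define w where "w k = - (2 * real n / real M) * (sin (real n * u k) * F (u k))" for k
  have M0: "M > 0" using n by (simp add: M_def)
  have F0: "F t \<ge> 0" for t by (simp add: F_def)
  have Fc: "of_real (F t) = (\<Sum>l<n. \<Sum>l'<n. cis (of_int (int l - int l') * t)) / of_nat n" for t
  proof -
    have "of_real ((cmod (S t))\<^sup>2) = S t * cnj (S t)" by (rule complex_norm_square)
    also have "\<dots> = (\<Sum>l<n. \<Sum>l'<n. cis (real l * t) * cis (- (real l' * t)))"
      unfolding S_def cnj_sum sum_product by (simp add: cis_cnj)
    also have "\<dots> = (\<Sum>l<n. \<Sum>l'<n. cis (of_int (int l - int l') * t))"
      by (intro sum.cong refl) (simp add: cis_mult algebra_simps)
    finally show ?thesis unfolding F_def by simp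
  qed
  have orth: "(\<Sum>k<M. cis (of_int j * u k) * of_real (F (u k)))
    = of_nat M / of_nat n * (\<Sum>l<n. \<Sum>l'<n. if j + int l - int l' = 0 then 1 else 0)"
    if j: "- int (2 * n) \<le> j" "j \<le> int (2 * n)" for j :: int
  proof -
    have "(\<Sum>k<M. cis (of_int j * u k) * of_real (F (u k)))
      = (\<Sum>k<M. \<Sum>l<n. \<Sum>l'<n. cis (of_int (j + int l - int l') * u k)) / of_nat n"
      unfolding Fc sum_divide_distrib sum_distrib_left times_divide_eq_right
      by (intro sum.cong refl arg_cong2[of _ _ _ _ "(/)"]) (simp add: cis_mult algebra_simps)
    also have "(\<Sum>k<M. \<Sum>l<n. \<Sum>l'<n. cis (of_int (j + int l - int l') * u k))
      = (\<Sum>l<n. \<Sum>l'<n. \<Sum>k<M. cis (of_int (j + int l - int l') * u k))"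
      by (subst sum.swap) (intro sum.cong refl sum.swap)
    also have "\<dots> = (\<Sum>l<n. \<Sum>l'<n. if j + int l - int l' = 0 then of_nat M else 0)"
      unfolding u_def
      by (intro sum.cong refl sum_cis_roots) (use j in \<open>auto simp: M_def\<close>)
    also have "\<dots> = of_nat M * (\<Sum>l<n. \<Sum>l'<n. if j + int l - int l' = 0 then 1 else 0)"
      unfolding sum_distrib_left by (intro sum.cong refl) auto
    finally show ?thesis by simp
  qed
  have sumF: "(\<Sum>k<M. F (u k)) = real M"
  proof -
    have "(\<Sum>l<n. \<Sum>l'<n. if 0 + int l - int l' = 0 then 1 else 0 :: complex) = (\<Sum>l<n. \<Sum>l'<n. if l' = l then 1 else 0)"
      by (intro sum.cong refl) auto
    also have "\<dots> = of_nat n" by simp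
    finally have "(\<Sum>k<M. cis (of_int 0 * u k) * of_real (F (u k))) = of_nat M / of_nat n * of_nat n"
      using orth[of 0] by simp
    then have "complex_of_real (\<Sum>k<M. F (u k)) = of_real (real M)" using n by simp
    then show ?thesis by (simp only: of_real_eq_iff)
  qed
  have 1: "(\<Sum>k<M. \<bar>w k\<bar>) \<le> 2 * real n"
  proof -
    have "(\<Sum>k<M. \<bar>w k\<bar>) \<le> (\<Sum>k<M. (2 * real n / real M) * F (u k))"
    proof (rule sum_mono)
      fix k
      have "\<bar>w k\<bar> = (2 * real n / real M) * (\<bar>sin (real n * u k)\<bar> * F (u k))"
        using F0[of "u k"] by (simp add: w_def abs_mult)
      also have "\<dots> \<le> (2 * real n / real M) * (1 * F (u k))"
        using F0[of "u k"] by (intro mult_left_mono mult_right_mono) auto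
      finally show "\<bar>w k\<bar> \<le> (2 * real n / real M) * F (u k)" by simp
    qed
    also have "\<dots> = 2 * real n" using M0 by (simp add: sumF flip: sum_distrib_left sum_divide_distrib)
    finally show ?thesis .
  qed
  have pos: "(\<Sum>k<M. of_real (w k) * cis (- (real j * u k))) = \<i> * of_nat j" if j: "j \<le> n" for j
  proof -
    have wc: "of_real (w k) * cis (- (real j * u k)) = \<i> * (of_nat n / of_nat M) *
      (cis (of_int (int n - int j) * u k) * of_real (F (u k)) - cis (of_int (- int n - int j) * u k) * of_real (F (u k)))" for k
    proof -
      have "\<i> * (cis (real n * u k) - cis (- (real n * u k))) = - 2 * of_real (sin (real n * u k))"
        by (simp add: complex_eq_iff)
      moreover have c1: "cis (of_int (int n - int j) * u k) = cis (real n * u k) * cis (- (real j * u k))"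
        and c2: "cis (of_int (- int n - int j) * u k) = cis (- (real n * u k)) * cis (- (real j * u k))"
        unfolding cis_mult by (rule arg_cong[of _ _ cis], simp add: algebra_simps)+
      moreover have "of_real (w k) * cis (- (real j * u k)) =
        of_nat n / of_nat M * of_real (F (u k)) * cis (- (real j * u k)) * (- 2 * of_real (sin (real n * u k)))"
        by (simp add: w_def mult_ac)
      ultimately have "of_real (w k) * cis (- (real j * u k)) =
        of_nat n / of_nat M * of_real (F (u k)) * cis (- (real j * u k)) * (\<i> * (cis (real n * u k) - cis (- (real n * u k))))"
        by (simp only:)
      also have "\<dots> = \<i> * (of_nat n / of_nat M) *
        ((cis (real n * u k) * cis (- (real j * u k))) * of_real (F (u k)) - (cis (- (real n * u k)) * cis (- (real j * u k))) * of_real (F (u k)))"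
        by (simp only: algebra_simps)
      finally show ?thesis unfolding c1 c2 .
    qed
    \<comment> \<open>Exactly j pairs satisfy l' - l = n - j: this is the linear side of the shifted
      triangle.\<close>
    have A: "(\<Sum>l<n. \<Sum>l'<n. if (int n - int j) + int l - int l' = 0 then 1 else 0 :: complex) = of_nat j"
    proof -
      have "(\<Sum>l<n. \<Sum>l'<n. if (int n - int j) + int l - int l' = 0 then 1 else 0 :: complex)
        = (\<Sum>l<n. \<Sum>l'<n. if l' = l + (n - j) then 1 else 0)"
        using j by (intro sum.cong refl if_cong) auto
      also have "\<dots> = (\<Sum>l<n. if l < j then 1 else 0)"
        using j by (intro sum.cong refl) auto
      also have "\<dots> = (\<Sum>l<j. 1)"
        using j by (intro sum.mono_neutral_cong_right) auto
      finally show ?thesis by simp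
    qed
    \<comment> \<open>Here l' = l - n - j would be negative.\<close>
    have B: "(\<Sum>l<n. \<Sum>l'<n. if (- int n - int j) + int l - int l' = 0 then 1 else 0 :: complex) = 0"
      by (intro sum.neutral ballI) auto
    have "(\<Sum>k<M. cis (of_int (int n - int j) * u k) * of_real (F (u k))) = of_nat M / of_nat n * of_nat j"
      using orth[of "int n - int j"] j unfolding A by simp
    moreover have "(\<Sum>k<M. cis (of_int (- int n - int j) * u k) * of_real (F (u k))) = 0"
      using orth[of "- int n - int j"] j unfolding B by simp
    ultimately show ?thesis unfolding wc sum_distrib_left[symmetric] sum_subtractf
      using n M0 by (simp only:) simp
  qed
  have 2: "(\<Sum>k<M. of_real (w k) * cis (- (of_int j * u k))) = \<i> * of_int j" if j: "\<bar>j\<bar> \<le> int n" for j :: int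
  proof (cases "j \<ge> 0")
    case True
    then show ?thesis using pos[of "nat j"] j by simp
  next
    \<comment> \<open>The weights are real, so negative frequencies follow by conjugation.\<close>
    case False
    have "cnj (\<Sum>k<M. of_real (w k) * cis (- (real (nat (- j)) * u k))) = cnj (\<i> * of_nat (nat (- j)))"
      using pos[of "nat (- j)"] False j by simp
    then show ?thesis using False by (simp add: cis_cnj)
  qed
  show ?thesis using that[OF 1 2] .
qed

text \<open>Bernstein's inequality in operator form: on \<open>trig_polys d\<close> differentiation
  is one fixed finite combination of translations. The bound on its total weight thus carries over
  to any norm that is bounded uniformly over translations, in particular for function-valued
  trigonometric polynomials. \<open>Suc d\<close> appears because the kernel needs a positive
  order.\<close>

lemma trig_polys_differentiation:
  obtains w u :: "nat \<Rightarrow> real" and M :: nat where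
    "(\<Sum>k<M. \<bar>w k\<bar>) \<le> 2 * real (Suc d)"
    "\<And>T \<alpha>. T \<in> trig_polys d \<Longrightarrow>
      (T has_vector_derivative (\<Sum>k<M. of_real (w k) * T (\<alpha> - u k))) (at \<alpha>)"
proof -
  obtain w u :: "nat \<Rightarrow> real" and M :: nat where w: "(\<Sum>k<M. \<bar>w k\<bar>) \<le> 2 * real (Suc d)"
    and j: "\<And>j::int. \<bar>j\<bar> \<le> int (Suc d) \<Longrightarrow> (\<Sum>k<M. of_real (w k) * cis (- (of_int j * u k))) = \<i> * of_int j"
    by (rule fejer_differentiation[of "Suc d"]) (simp, rule that)
  have "(T has_vector_derivative (\<Sum>k<M. of_real (w k) * T (\<alpha> - u k))) (at \<alpha>)" if T: "T \<in> trig_polys d" for T \<alpha>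
  proof -
    obtain q where q: "degree q \<le> 2 * d" "T = (\<lambda>\<alpha>. cis (- (real d * \<alpha>)) * poly q (cis \<alpha>))"
      using T unfolding trig_polys_def by blast
    define e where "e i = int i - int d" for i
    have T: "T \<alpha> = (\<Sum>i\<le>2 * d. coeff q i * cis (of_int (e i) * \<alpha>))" for \<alpha>
    proof -
      have "poly q (cis \<alpha>) = (\<Sum>i\<le>2 * d. coeff q i * cis \<alpha> ^ i)"
        unfolding poly_altdef using q(1) by (intro sum.mono_neutral_left) (auto simp: coeff_eq_0)
      then show ?thesis unfolding q(2)
        by (simp add: sum_distrib_left Complex.DeMoivre e_def cis_mult mult.left_commute algebra_simps)
    qed
    have "(T has_vector_derivative (\<Sum>i\<le>2 * d. coeff q i * (\<i> * of_int (e i) * cis (of_int (e i) * \<alpha>)))) (at \<alpha>)"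
    proof -
      have "((\<lambda>\<alpha>. cis (of_int (e i) * \<alpha>)) has_vector_derivative (\<i> * of_int (e i) * cis (of_int (e i) * \<alpha>))) (at \<alpha>)" for i
      proof -
        have "((\<lambda>z. exp (\<i> * of_int (e i) * z)) has_field_derivative
          \<i> * of_int (e i) * exp (\<i> * of_int (e i) * of_real \<alpha>)) (at (of_real \<alpha>))"
          by (auto intro!: derivative_eq_intros)
        from has_vector_derivative_real_field[OF this] show ?thesis
          unfolding cis_conv_exp by (simp add: mult.assoc)
      qed
      then show ?thesis unfolding T[abs_def]
        by (intro has_vector_derivative_sum has_vector_derivative_mult_right)
    qed
    moreover have "(\<Sum>i\<le>2 * d. coeff q i * (\<i> * of_int (e i) * cis (of_int (e i) * \<alpha>)))
      = (\<Sum>k<M. of_real (w k) * T (\<alpha> - u k))"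
    proof -
      have "(\<Sum>k<M. of_real (w k) * T (\<alpha> - u k))
        = (\<Sum>k<M. \<Sum>i\<le>2 * d. coeff q i * ((of_real (w k) * cis (- (of_int (e i) * u k))) * cis (of_int (e i) * \<alpha>)))"
        unfolding T sum_distrib_left
      proof (intro sum.cong refl)
        fix k i
        have "cis (of_int (e i) * (\<alpha> - u k)) = cis (- (of_int (e i) * u k)) * cis (of_int (e i) * \<alpha>)"
          by (simp add: cis_mult algebra_simps)
        then show "of_real (w k) * (coeff q i * cis (of_int (e i) * (\<alpha> - u k))) =
          coeff q i * ((of_real (w k) * cis (- (of_int (e i) * u k))) * cis (of_int (e i) * \<alpha>))"
          by (simp add: mult_ac)
      qed
      also have "\<dots> = (\<Sum>i\<le>2 * d. coeff q i * ((\<Sum>k<M. of_real (w k) * cis (- (of_int (e i) * u k))) * cis (of_int (e i) * \<alpha>)))"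
        by (subst sum.swap) (simp add: sum_distrib_left sum_distrib_right)
      also have "\<dots> = (\<Sum>i\<le>2 * d. coeff q i * (\<i> * of_int (e i) * cis (of_int (e i) * \<alpha>)))"
        by (intro sum.cong refl, subst j) (auto simp: e_def)
      finally show ?thesis ..
    qed
    ultimately show ?thesis by simp
  qed
  then show ?thesis using that w by blast
qed

text \<open>Says that T is s times differentiable on the whole line, with s-th derivative v at 0. As
  a relation it needs no closed form for the intermediate derivatives.\<close>

primrec iterated_derivative :: "nat \<Rightarrow> (real \<Rightarrow> complex) \<Rightarrow> complex \<Rightarrow> bool" where
  "iterated_derivative 0 T v \<longleftrightarrow> T 0 = v"
| "iterated_derivative (Suc s) T v \<longleftrightarrow>
    (\<exists>T'. (\<forall>\<alpha>. (T has_vector_derivative T' \<alpha>) (at \<alpha>)) \<and> iterated_derivative s T' v)"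

lemma iterated_derivative_unique:
  "iterated_derivative s T v \<Longrightarrow> iterated_derivative s T v' \<Longrightarrow> v = v'"
proof (induction s arbitrary: T)
  case (Suc s)
  then obtain T' U' where "\<forall>\<alpha>. (T has_vector_derivative T' \<alpha>) (at \<alpha>)" "iterated_derivative s T' v"
    "\<forall>\<alpha>. (T has_vector_derivative U' \<alpha>) (at \<alpha>)" "iterated_derivative s U' v'" by auto
  moreover from this have "T' = U'" using vector_derivative_unique_at by blast
  ultimately show ?case using Suc.IH by blast
qed simp

lemma iterated_derivative_zero: "iterated_derivative s (\<lambda>_. 0) 0"
proof (induction s)
  case (Suc s)
  then show ?case by (auto intro!: exI[of _ "\<lambda>_. 0"])
qed simp

lemma iterated_derivative_lincomb:
  "iterated_derivative s T v \<Longrightarrow> iterated_derivative s U w \<Longrightarrow>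
    iterated_derivative s (\<lambda>\<alpha>. c * T \<alpha> + U \<alpha>) (c * v + w)"
proof (induction s arbitrary: T U)
  case (Suc s)
  then obtain T' U' where "\<forall>\<alpha>. (T has_vector_derivative T' \<alpha>) (at \<alpha>)" "iterated_derivative s T' v"
    "\<forall>\<alpha>. (U has_vector_derivative U' \<alpha>) (at \<alpha>)" "iterated_derivative s U' w" by auto
  then show ?case using Suc.IH
    by (auto intro!: exI[of _ "\<lambda>\<alpha>. c * T' \<alpha> + U' \<alpha>"] derivative_intros)
qed simp

lemma iterated_derivative_sum:
  assumes "finite I" "\<And>i. i \<in> I \<Longrightarrow> iterated_derivative s (T i) (v i)"
  shows "iterated_derivative s (\<lambda>\<alpha>. \<Sum>i\<in>I. c i * T i \<alpha>) (\<Sum>i\<in>I. c i * v i)"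
  using assms
proof (induction I)
  case (insert i I)
  then show ?case
    using iterated_derivative_lincomb[of s "T i" "v i" "\<lambda>\<alpha>. \<Sum>i\<in>I. c i * T i \<alpha>" _ "c i"] by simp
qed (simp add: iterated_derivative_zero)

text \<open>\<open>sin \<alpha> ^ b\<close> has a zero of order b at 0. One differentiation turns
  sin^b G into sin^(b-1) H with H 0 = b G 0, which builds up the factorial.\<close>

lemma iterated_derivative_sin_power:
  "G \<in> trig_polys d \<Longrightarrow> s \<le> b \<Longrightarrow>
    iterated_derivative s (\<lambda>\<alpha>. complex_of_real (sin \<alpha>) ^ b * G \<alpha>) (if b = s then fact s * G 0 else 0)"
proof (induction s arbitrary: b G d)
  case 0
  then show ?case by auto
next
  case (Suc s)
  then obtain b' where b: "b = Suc b'" by (cases b) auto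
  obtain w u :: "nat \<Rightarrow> real" and M where D:
    "\<And>T \<alpha>. T \<in> trig_polys d \<Longrightarrow> (T has_vector_derivative (\<Sum>k<M. of_real (w k) * T (\<alpha> - u k))) (at \<alpha>)"
    using trig_polys_differentiation by metis
  define G' where "G' \<alpha> = (\<Sum>k<M. of_real (w k) * G (\<alpha> - u k))" for \<alpha>
  have G': "G' \<in> trig_polys d"
    unfolding G'_def[abs_def] by (intro trig_polys_sum trig_polys_cmult trig_polys_shift Suc.prems)
  define H where "H \<alpha> = of_nat b * (complex_of_real (cos \<alpha>) * G \<alpha>) + complex_of_real (sin \<alpha>) * G' \<alpha>" for \<alpha>
  have H: "H \<in> trig_polys (1 + d)"
    unfolding H_def[abs_def]
    by (intro trig_polys_add trig_polys_cmult trig_polys_mult trig_polys_cos trig_polys_sin Suc.prems G')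
  have "iterated_derivative s (\<lambda>\<alpha>. complex_of_real (sin \<alpha>) ^ b' * H \<alpha>) (if b' = s then fact s * H 0 else 0)"
    by (rule Suc.IH[OF H]) (use Suc.prems b in simp)
  moreover have "(if b' = s then fact s * H 0 else 0) = (if b = Suc s then fact (Suc s) * G 0 else 0)"
    using b by (auto simp: H_def)
  moreover have "((\<lambda>\<alpha>. complex_of_real (sin \<alpha>) ^ b * G \<alpha>) has_vector_derivative
    complex_of_real (sin \<alpha>) ^ b' * H \<alpha>) (at \<alpha>)" for \<alpha>
  proof -
    have 1: "((\<lambda>\<alpha>. complex_of_real (sin \<alpha> ^ b)) has_vector_derivative
      complex_of_real (real b * sin \<alpha> ^ b' * cos \<alpha>)) (at \<alpha>)"
      unfolding b
      by (intro has_vector_derivative_of_real has_real_derivative_iff_has_vector_derivative[THEN iffD1] DERIV_power_Suc_within)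
        (auto intro!: derivative_eq_intros)
    have 2: "(G has_vector_derivative G' \<alpha>) (at \<alpha>)" unfolding G'_def using D Suc.prems by blast
    show ?thesis
      using has_vector_derivative_mult[OF 1 2] unfolding H_def b by (simp add: algebra_simps)
  qed
  ultimately show ?case unfolding iterated_derivative.simps
    by (intro exI[of _ "\<lambda>\<alpha>. complex_of_real (sin \<alpha>) ^ b' * H \<alpha>"]) simp
qed

section \<open>Expansions of polynomials and of their harmonic averages\<close>

lemma higher_pderiv_monom_choose:
  fixes c :: "'a :: idom"
  shows "(pderiv ^^ s) (monom c m) = monom (of_nat (fact s * (m choose s)) * c) (m - s)"
proof (induction s)
  case (Suc s)
  have "(m - s) * (fact s * (m choose s)) = fact (Suc s) * (m choose Suc s)"
  proof -
    have "(m - s) * (m choose s) = Suc s * (m choose Suc s)"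
      using binomial_absorb_comp[of m s] binomial_absorption[of s m] by simp
    then have "fact s * ((m - s) * (m choose s)) = fact s * (Suc s * (m choose Suc s))" by (simp only:)
    then show ?thesis by (simp only: fact_Suc of_nat_id mult_ac)
  qed
  then have "of_nat (m - s) * (of_nat (fact s * (m choose s)) * c) = (of_nat (fact (Suc s) * (m choose Suc s)) * c :: 'a)"
    by (metis mult.assoc of_nat_mult)
  then show ?case by (simp only: funpow.simps o_apply Suc pderiv_monom diff_Suc_eq_diff_pred) simp
qed simp

lemma poly_higher_pderiv:
  fixes P :: "real poly"
  shows "poly ((pderiv ^^ s) P) x = (\<Sum>m\<le>degree P. coeff P m * (fact s * real (m choose s) * x ^ (m - s)))"
proof -
  have "poly ((pderiv ^^ s) P) x = poly ((pderiv ^^ s) (\<Sum>m\<le>degree P. monom (coeff P m) m)) x"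
    by (simp add: poly_as_sum_of_monoms)
  also have "\<dots> = (\<Sum>m\<le>degree P. coeff P m * (fact s * real (m choose s) * x ^ (m - s)))"
    by (simp add: higher_pderiv_sum poly_sum higher_pderiv_monom_choose poly_monom mult_ac)
  finally show ?thesis .
qed

lemma harmonic_avg_poly:
  "harmonic_avg (poly P) s \<alpha> x = (\<Sum>m\<le>degree P. coeff P m * (\<Sum>b\<le>m. (real (m choose b) * x ^ (m - b) * varphi x ^ b
      * integral {0..2 * pi} (\<lambda>t. cos t ^ b * cos (real s * t))) * (sin \<alpha> ^ b * cos \<alpha> ^ (m - b))))"
proof -
  have "poly P (x * cos \<alpha> + varphi x * sin \<alpha> * cos t) * cos (real s * t) =
    (\<Sum>m\<le>degree P. coeff P m * (\<Sum>b\<le>m. (real (m choose b) * x ^ (m - b) * varphi x ^ b) * (sin \<alpha> ^ b * cos \<alpha> ^ (m - b))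
      * (cos t ^ b * cos (real s * t))))" for t
    unfolding poly_altdef sum_distrib_right
    by (intro sum.cong refl, subst add.commute, subst binomial_ring)
      (simp add: sum_distrib_left sum_distrib_right power_mult_distrib mult_ac)
  then have "harmonic_avg (poly P) s \<alpha> x = integral {0..2 * pi} (\<lambda>t.
    \<Sum>m\<le>degree P. coeff P m * (\<Sum>b\<le>m. (real (m choose b) * x ^ (m - b) * varphi x ^ b) * (sin \<alpha> ^ b * cos \<alpha> ^ (m - b))
      * (cos t ^ b * cos (real s * t))))"
    by (simp add: harmonic_avg_def)
  also have "\<dots> = (\<Sum>m\<le>degree P. coeff P m * (\<Sum>b\<le>m. (real (m choose b) * x ^ (m - b) * varphi x ^ b) * (sin \<alpha> ^ b * cos \<alpha> ^ (m - b))
      * integral {0..2 * pi} (\<lambda>t. cos t ^ b * cos (real s * t))))"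
    by (rule integral_unique) (intro has_integral_sum has_integral_mult_right integrable_integral
        integrable_continuous_real continuous_intros finite_atMost)
  finally show ?thesis by (simp add: mult_ac)
qed

text \<open>On the sphere, \<open>harmonic_avg (poly P) s \<alpha> x\<close> is the projection onto the $s$-th harmonic in
  the longitude of $P$ rotated by \<open>\<alpha>\<close>. Its $s$-th derivative in \<open>\<alpha>\<close> at 0 isolates
  $\varphi^s P^{(s)}$.\<close>

theorem Lp_bernstein:
  fixes P :: "real poly"
  assumes p: "1 \<le> p" and deg: "degree P < n" and B: "Lp_norm p {-1..1} (poly P) \<le> ennreal B" "0 \<le> B"
  shows "Lp_norm p {-1..1} (\<lambda>x. varphi x ^ s * poly ((pderiv ^^ s) P) x) \<le> ennreal ((4 * real n) ^ s * B)"
proof -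
  define d where "d = n - 1"
  have d: "degree P \<le> d" "Suc d = n" using deg by (auto simp: d_def)
  obtain w u :: "nat \<Rightarrow> real" and M where w: "(\<Sum>k<M. \<bar>w k\<bar>) \<le> 2 * real (Suc d)" and D:
    "\<And>T \<alpha>. T \<in> trig_polys d \<Longrightarrow> (T has_vector_derivative (\<Sum>k<M. of_real (w k) * T (\<alpha> - u k))) (at \<alpha>)"
    using trig_polys_differentiation by metis
  \<comment> \<open>Agrees with differentiation on \<open>trig_polys d\<close>. Its weights and
    nodes do not depend on x, so its iterates keep continuity in x and L_p bounds.\<close>
  define L :: "(real \<Rightarrow> complex) \<Rightarrow> real \<Rightarrow> complex" where "L T \<alpha> = (\<Sum>k<M. of_real (w k) * T (\<alpha> - u k))" for T \<alpha>
  have L_tp: "L T \<in> trig_polys d" if "T \<in> trig_polys d" for T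
    unfolding L_def[abs_def] by (intro trig_polys_sum trig_polys_cmult trig_polys_shift that)
  define T where "T x \<alpha> = complex_of_real (harmonic_avg (poly P) s \<alpha> x)" for x \<alpha>
  define \<kappa> where "\<kappa> b = integral {0..2 * pi} (\<lambda>t. cos t ^ b * cos (real s * t))" for b
  have T_eq: "T x \<alpha> = (\<Sum>m\<le>degree P. of_real (coeff P m) * (\<Sum>b\<le>m. of_real (real (m choose b) * x ^ (m - b) * varphi x ^ b * \<kappa> b)
      * (complex_of_real (sin \<alpha>) ^ b * complex_of_real (cos \<alpha>) ^ (m - b))))" for x \<alpha>
    unfolding T_def harmonic_avg_poly \<kappa>_def by simp
  have T_tp: "T x \<in> trig_polys d" for x
    unfolding T_eq[abs_def]
  proof (intro trig_polys_sum trig_polys_cmult)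
    fix m b assume "m \<in> {..degree P}" "b \<in> {..m}"
    then have "b + (m - b) \<le> d" using d by auto
    then show "(\<lambda>\<alpha>. complex_of_real (sin \<alpha>) ^ b * complex_of_real (cos \<alpha>) ^ (m - b)) \<in> trig_polys d"
      by (rule trig_polys_mono) (intro trig_polys_mult trig_polys_power trig_polys_sin trig_polys_cos)
  qed
  have L_tp': "(L ^^ i) (T x) \<in> trig_polys d" for i x
    by (induction i) (auto intro: L_tp T_tp)
  have cont: "continuous_on {-1..1} (\<lambda>x. (L ^^ i) (T x) \<alpha>)" for i \<alpha>
  proof (induction i arbitrary: \<alpha>)
    case 0
    show ?case unfolding T_def[abs_def] funpow_0
      by (intro continuous_intros continuous_on_harmonic_avg)
  next
    case (Suc i)
    then show ?case unfolding funpow.simps o_apply L_def by (intro continuous_intros)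
  qed
  have meas: "(\<lambda>x. cmod ((L ^^ i) (T x) \<alpha>)) \<in> borel_measurable (lebesgue_on {-1..1})" for i \<alpha>
    by (intro continuous_on_imp_measurable_lebesgue_on continuous_intros cont) auto
  have norm: "Lp_norm p {-1..1} (\<lambda>x. cmod ((L ^^ i) (T x) \<alpha>)) \<le> ennreal ((2 * real n) ^ i * (2 * pi * B))" for i \<alpha>
  proof (induction i arbitrary: \<alpha>)
    case 0
    show ?case using Lp_norm_harmonic_avg[OF p _ B, of s \<alpha>]
      by (simp add: T_def Lp_norm_abs continuous_intros)
  next
    case (Suc i)
    have "Lp_norm p {-1..1} (\<lambda>x. cmod ((L ^^ Suc i) (T x) \<alpha>)) \<le> ennreal (\<Sum>k<M. \<bar>w k\<bar> * ((2 * real n) ^ i * (2 * pi * B)))"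
    proof (rule Lp_norm_dominated_sum[OF p _ meas _ Suc.IH])
      fix x
      show "\<bar>cmod ((L ^^ Suc i) (T x) \<alpha>)\<bar> \<le> (\<Sum>k<M. \<bar>w k\<bar> * \<bar>cmod ((L ^^ i) (T x) (\<alpha> - u k))\<bar>)"
        by (simp add: L_def, rule order_trans[OF norm_sum]) (simp add: norm_mult)
    qed (use B meas in auto)
    also have "\<dots> \<le> ennreal ((2 * real n) ^ Suc i * (2 * pi * B))"
    proof (rule ennreal_leI)
      have "(\<Sum>k<M. \<bar>w k\<bar> * ((2 * real n) ^ i * (2 * pi * B))) = (\<Sum>k<M. \<bar>w k\<bar>) * ((2 * real n) ^ i * (2 * pi * B))"
        by (simp add: sum_distrib_right)
      also have "\<dots> \<le> (2 * real n) * ((2 * real n) ^ i * (2 * pi * B))"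
        using w d B by (intro mult_right_mono) auto
      finally show "(\<Sum>k<M. \<bar>w k\<bar> * ((2 * real n) ^ i * (2 * pi * B))) \<le> (2 * real n) ^ Suc i * (2 * pi * B)"
        by (simp add: mult_ac)
    qed
    finally show ?case .
  qed
  define C where "C = 2 * pi / 2 ^ s"
  have \<kappa>: "\<kappa> b = (if b = s then C else 0)" if "b \<le> s" for b
    unfolding \<kappa>_def C_def using integral_unique[OF cos_power_cos_has_integral[OF that]] that by auto
  have val: "(L ^^ s) (T x) 0 = of_real (C * (varphi x ^ s * poly ((pderiv ^^ s) P) x))" for x
  proof -
    have "iterated_derivative j U ((L ^^ j) U 0)" if "U \<in> trig_polys d" for j U
      using that
    proof (induction j arbitrary: U)
      case (Suc j)
      have "\<forall>\<alpha>. (U has_vector_derivative L U \<alpha>) (at \<alpha>)" using D[OF Suc.prems] by (simp add: L_def)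
      moreover have "iterated_derivative j (L U) ((L ^^ Suc j) U 0)"
        using Suc.IH[OF L_tp[OF Suc.prems]] by (simp only: funpow_Suc_right o_apply)
      ultimately show ?case by auto
    qed simp
    then have 1: "iterated_derivative s (T x) ((L ^^ s) (T x) 0)" using T_tp by blast
    let ?v = "\<lambda>b. if b = s then fact s else 0 :: complex"
    have "iterated_derivative s (\<lambda>\<alpha>. of_real (real (m choose b) * x ^ (m - b) * varphi x ^ b * \<kappa> b)
        * (complex_of_real (sin \<alpha>) ^ b * complex_of_real (cos \<alpha>) ^ (m - b)) + 0)
        (of_real (real (m choose b) * x ^ (m - b) * varphi x ^ b * \<kappa> b) * ?v b + 0)" for m b
    \<comment> \<open>Terms with b > s contribute 0 because of the zero of sin^b, terms with b < s
      because \<open>\<kappa> b\<close> is 0. Only b = s survives.\<close>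
    proof (cases "s \<le> b")
      case True
      show ?thesis
        using iterated_derivative_sin_power[OF trig_polys_power[OF trig_polys_cos] True, of "m - b"]
        by (intro iterated_derivative_lincomb iterated_derivative_zero) (auto cong: if_cong)
    next
      case False
      then show ?thesis using \<kappa>[of b] iterated_derivative_zero by simp
    qed
    then have "iterated_derivative s (\<lambda>\<alpha>. of_real (coeff P m) * (\<Sum>b\<le>m. 1 * (of_real (real (m choose b) * x ^ (m - b) * varphi x ^ b * \<kappa> b)
        * (complex_of_real (sin \<alpha>) ^ b * complex_of_real (cos \<alpha>) ^ (m - b)))) + 0)
        (of_real (coeff P m) * (\<Sum>b\<le>m. 1 * (of_real (real (m choose b) * x ^ (m - b) * varphi x ^ b * \<kappa> b) * ?v b)) + 0)" for m
      by (intro iterated_derivative_lincomb iterated_derivative_zero iterated_derivative_sum finite_atMost) simp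
    then have "iterated_derivative s (T x) (\<Sum>m\<le>degree P. 1 * (of_real (coeff P m) * (\<Sum>b\<le>m. 1 * (of_real (real (m choose b) * x ^ (m - b) * varphi x ^ b * \<kappa> b) * ?v b))))"
      unfolding T_eq[abs_def]
      using iterated_derivative_sum[of "{..degree P}" s "\<lambda>m \<alpha>. of_real (coeff P m) * (\<Sum>b\<le>m. of_real (real (m choose b) * x ^ (m - b) * varphi x ^ b * \<kappa> b)
        * (complex_of_real (sin \<alpha>) ^ b * complex_of_real (cos \<alpha>) ^ (m - b)))" _ "\<lambda>_. 1"]
      by simp
    then have "(L ^^ s) (T x) 0 = (\<Sum>m\<le>degree P. of_real (coeff P m) * (\<Sum>b\<le>m. of_real (real (m choose b) * x ^ (m - b) * varphi x ^ b * \<kappa> b) * ?v b))"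
      using iterated_derivative_unique[OF 1] by simp
    also have "\<dots> = (\<Sum>m\<le>degree P. of_real (coeff P m * (fact s * real (m choose s) * x ^ (m - s)) * (varphi x ^ s * C)))"
    proof (intro sum.cong refl)
      fix m
      have "(\<Sum>b\<le>m. of_real (real (m choose b) * x ^ (m - b) * varphi x ^ b * \<kappa> b) * ?v b)
        = (\<Sum>b\<le>m. if b = s then of_real (real (m choose s) * x ^ (m - s) * varphi x ^ s * C) * fact s else 0)"
        by (intro sum.cong refl) (auto simp: \<kappa>)
      also have "\<dots> = of_real (real (m choose s) * x ^ (m - s) * varphi x ^ s * C) * fact s"
        by (auto simp: binomial_eq_0)
      finally show "of_real (coeff P m) * (\<Sum>b\<le>m. of_real (real (m choose b) * x ^ (m - b) * varphi x ^ b * \<kappa> b) * ?v b)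
        = of_real (coeff P m * (fact s * real (m choose s) * x ^ (m - s)) * (varphi x ^ s * C))"
        by (simp add: mult_ac)
    qed
    also have "\<dots> = of_real (C * (varphi x ^ s * poly ((pderiv ^^ s) P) x))"
      unfolding poly_higher_pderiv by (simp add: sum_distrib_left sum_distrib_right mult_ac)
    finally show ?thesis .
  qed
  have C: "C > 0" by (simp add: C_def)
  have "Lp_norm p {-1..1} (\<lambda>x. C * (varphi x ^ s * poly ((pderiv ^^ s) P) x)) \<le> ennreal ((2 * real n) ^ s * (2 * pi * B))"
    using norm[of s 0] unfolding val norm_of_real Lp_norm_abs .
  then have "Lp_norm p {-1..1} (\<lambda>x. (1 / C) * (C * (varphi x ^ s * poly ((pderiv ^^ s) P) x)))
    \<le> ennreal (\<bar>1 / C\<bar> * ((2 * real n) ^ s * (2 * pi * B)))"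
    using B by (intro Lp_norm_cmult_le[OF p] continuous_on_imp_measurable_lebesgue_on continuous_intros) auto
  \<comment> \<open>Dividing by C brings 2^s / (2 pi): the 2 pi cancels the mass of the averages,
    and 2^s turns (2 n)^s into (4 n)^s.\<close>
  moreover have "\<bar>1 / C\<bar> * ((2 * real n) ^ s * (2 * pi * B)) = (4 * real n) ^ s * B"
  proof -
    have "(4 * real n) ^ s = (2 * (2 * real n)) ^ s" by simp
    also have "\<dots> = 2 ^ s * (2 * real n) ^ s" by (rule power_mult_distrib)
    finally have "(4 * real n) ^ s = 2 ^ s * (2 * real n) ^ s" .
    moreover have "\<bar>1 / C\<bar> = 2 ^ s / (2 * pi)" by (simp add: C_def)
    moreover have "2 ^ s / (2 * pi) * ((2 * real n) ^ s * (2 * pi * B)) = 2 ^ s * (2 * real n) ^ s * B"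
      using pi_gt_zero by (simp only: times_divide_eq_left times_divide_eq_right) (simp add: mult_ac)
    ultimately show ?thesis by (simp only:)
  qed
  moreover have "(\<lambda>x. (1 / C) * (C * (varphi x ^ s * poly ((pderiv ^^ s) P) x))) =
    (\<lambda>x. varphi x ^ s * poly ((pderiv ^^ s) P) x)"
    using C by (intro ext) simp
  ultimately show ?thesis by (simp only:)
qed

section \<open>Weighted differences\<close>

lemma nn_integral_lebesgue_on_mono:
  fixes f :: "real \<Rightarrow> ennreal"
  assumes "S \<subseteq> T" "S \<in> sets lebesgue" "T \<in> sets lebesgue"
  shows "(\<integral>\<^sup>+x. f x \<partial>lebesgue_on S) \<le> (\<integral>\<^sup>+x. f x \<partial>lebesgue_on T)"
  using assms by (auto simp: nn_integral_restrict_space intro!: nn_integral_mono split: split_indicator)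

lemma Lp_norm_subset_le:
  assumes p: "1 \<le> p" and ST: "S \<subseteq> T" "S \<in> sets lebesgue" "T \<in> sets lebesgue"
    and m: "f \<in> borel_measurable (lebesgue_on T)" and B: "Lp_norm p T f \<le> ennreal B" "0 \<le> B"
  shows "Lp_norm p S f \<le> ennreal B"
proof -
  have mS: "f \<in> borel_measurable (lebesgue_on S)"
    using m ST(1) by (rule measurable_restrict_mono)
  show ?thesis
  proof (cases "p = \<infinity>")
    case True
    have "AE x in lebesgue_on T. \<bar>f x\<bar> \<le> B" using Lp_norm_infinity_le_iff[OF m] B True by simp
    then have "AE x in lebesgue_on S. \<bar>f x\<bar> \<le> B"
      using ST by (auto simp: AE_restrict_space_iff elim: eventually_mono)
    then show ?thesis using Lp_norm_infinity_le_iff[OF mS] B True by simp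
  next
    case False
    have "(\<integral>\<^sup>+x. ennreal (\<bar>f x\<bar> powr enn2real p) \<partial>lebesgue_on S) \<le> (\<integral>\<^sup>+x. ennreal (\<bar>f x\<bar> powr enn2real p) \<partial>lebesgue_on T)"
      by (rule nn_integral_lebesgue_on_mono[OF ST])
    also have "\<dots> \<le> ennreal (B powr enn2real p)" using Lp_norm_finite_le_iff[OF p False] B by simp
    finally show ?thesis using Lp_norm_finite_le_iff[OF p False] B by simp
  qed
qed

section \<open>Finite differences of polynomials\<close>

lemma alternating_binomial_sum_Suc:
  fixes g :: "nat \<Rightarrow> real"
  shows "(\<Sum>i\<le>Suc k. real (Suc k choose i) * (-1) ^ (Suc k - i) * g i) =
    (\<Sum>i\<le>k. real (k choose i) * (-1) ^ (k - i) * (g (Suc i) - g i))"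
proof -
  define h where "h i = real (k choose i) * (-1) ^ (Suc k - i) * g i" for i
  have "(\<Sum>i\<le>Suc k. real (Suc k choose i) * (-1) ^ (Suc k - i) * g i)
    = (-1) ^ Suc k * g 0 + (\<Sum>i\<le>k. real (Suc k choose Suc i) * (-1) ^ (k - i) * g (Suc i))"
    by (subst sum.atMost_Suc_shift) simp
  also have "\<dots> = h 0 + (\<Sum>i\<le>k. h (Suc i)) + (\<Sum>i\<le>k. real (k choose i) * (-1) ^ (k - i) * g (Suc i))"
    by (simp add: h_def algebra_simps sum.distrib)
  also have "h 0 + (\<Sum>i\<le>k. h (Suc i)) = (\<Sum>i\<le>Suc k. h i)"
    by (subst sum.atMost_Suc_shift) simp
  also have "\<dots> = (\<Sum>i\<le>k. h i)" by (simp add: h_def)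
  also have "\<dots> = - (\<Sum>i\<le>k. real (k choose i) * (-1) ^ (k - i) * g i)"
    unfolding sum_negf[symmetric] h_def by (intro sum.cong refl) (auto simp: Suc_diff_le)
  finally show ?thesis by (simp add: right_diff_distrib sum_subtractf)
qed

text \<open>Proved for all shifts a at once. In the new case j = k the sum for k, as a function of
  a, has as derivative a multiple of the sum with exponent k - 1, which is 0; so it is constant and
  its first difference vanishes.\<close>

lemma alternating_binomial_sum_power:
  "j < k \<Longrightarrow> (\<Sum>i\<le>k. real (k choose i) * (-1) ^ (k - i) * (real i + a) ^ j) = 0"
proof (induction k arbitrary: j a)
  case (Suc k)
  define S where "S j a = (\<Sum>i\<le>k. real (k choose i) * (-1) ^ (k - i) * (real i + a) ^ j)" for j a
  have eq: "(\<Sum>i\<le>Suc k. real (Suc k choose i) * (-1) ^ (Suc k - i) * (real i + a) ^ j) = S j (a + 1) - S j a"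
    unfolding alternating_binomial_sum_Suc S_def
    by (simp add: algebra_simps sum_subtractf)
  have "S j (a + 1) = S j a"
  proof (cases "j < k")
    case True
    then show ?thesis using Suc.IH by (simp add: S_def)
  next
    case False
    then have j: "j = k" using Suc.prems by simp
    have "(S j has_real_derivative 0) (at b)" for b
    proof -
      have "(S j has_real_derivative (\<Sum>i\<le>k. real (k choose i) * (-1) ^ (k - i) * (real j * (real i + b) ^ (j - 1)))) (at b)"
        unfolding S_def[abs_def] by (auto intro!: derivative_eq_intros simp: mult_ac)
      also have "(\<Sum>i\<le>k. real (k choose i) * (-1) ^ (k - i) * (real j * (real i + b) ^ (j - 1))) = real j * S (j - 1) b"
        by (simp add: S_def sum_distrib_left mult_ac)
      also have "\<dots> = 0"
        using Suc.IH[of "j - 1" b] j by (cases "j = 0") (auto simp: S_def)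
      finally show ?thesis .
    qed
    then show ?thesis using DERIV_isconst_all by blast
  qed
  then show ?case unfolding eq by simp
qed simp

lemma poly_taylor_expansion:
  fixes P :: "real poly"
  shows "poly P (x + e) = (\<Sum>j\<le>degree P. poly ((pderiv ^^ j) P) x * e ^ j / fact j)"
proof -
  have "poly P (x + e) = (\<Sum>m\<le>degree P. \<Sum>j\<le>degree P. coeff P m * (real (m choose j) * x ^ (m - j) * e ^ j))"
    unfolding poly_altdef
  proof (intro sum.cong refl)
    fix m assume "m \<in> {..degree P}"
    then have "(\<Sum>j\<le>m. real (m choose j) * e ^ j * x ^ (m - j)) = (\<Sum>j\<le>degree P. real (m choose j) * e ^ j * x ^ (m - j))"
      by (intro sum.mono_neutral_left) auto
    then show "coeff P m * (x + e) ^ m = (\<Sum>j\<le>degree P. coeff P m * (real (m choose j) * x ^ (m - j) * e ^ j))"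
      by (subst add.commute, subst binomial_ring) (simp add: sum_distrib_left mult_ac)
  qed
  also have "\<dots> = (\<Sum>j\<le>degree P. poly ((pderiv ^^ j) P) x * e ^ j / fact j)"
    unfolding poly_higher_pderiv sum_distrib_right sum_divide_distrib
    by (subst sum.swap) (intro sum.cong refl, simp)
  finally show ?thesis .
qed

section \<open>The domain of the differences and their nodes\<close>

lemma D_set_eq:
  assumes "0 < \<delta>"
  shows "D_set \<delta> = {- ((4 - \<delta>\<^sup>2) / (4 + \<delta>\<^sup>2))..(4 - \<delta>\<^sup>2) / (4 + \<delta>\<^sup>2)}"
proof -
  have pos: "4 + \<delta>\<^sup>2 > 0" by (simp add: add_pos_nonneg)
  have lt1: "(4 - \<delta>\<^sup>2) / (4 + \<delta>\<^sup>2) < 1" using assms pos by (simp add: field_simps)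
  have iff: "\<delta> * varphi x / 2 \<le> 1 - \<bar>x\<bar> \<longleftrightarrow> \<bar>x\<bar> \<le> (4 - \<delta>\<^sup>2) / (4 + \<delta>\<^sup>2)" if x: "\<bar>x\<bar> < 1" for x
  proof -
    \<comment> \<open>Both sides are nonnegative and may be squared; then a factor 1 - |x|
      cancels.\<close>
    have "\<delta> * varphi x / 2 \<le> 1 - \<bar>x\<bar> \<longleftrightarrow> (\<delta> * varphi x / 2)\<^sup>2 \<le> (1 - \<bar>x\<bar>)\<^sup>2"
      using x assms varphi_nonneg[of x] abs_le_square_iff[of "\<delta> * varphi x / 2" "1 - \<bar>x\<bar>"] by simp
    also have "(\<delta> * varphi x / 2)\<^sup>2 = \<delta>\<^sup>2 / 4 * (varphi x)\<^sup>2"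
      by (simp add: power_divide power_mult_distrib)
    also have "\<dots> = \<delta>\<^sup>2 / 4 * (1 - x\<^sup>2)" using x by (simp add: varphi_square)
    also have "\<dots> = (1 - \<bar>x\<bar>) * (\<delta>\<^sup>2 * (1 + \<bar>x\<bar>) / 4)"
      by (simp add: power2_eq_square algebra_simps)
    also have "\<dots> \<le> (1 - \<bar>x\<bar>)\<^sup>2 \<longleftrightarrow> \<delta>\<^sup>2 * (1 + \<bar>x\<bar>) / 4 \<le> 1 - \<bar>x\<bar>"
      using x unfolding power2_eq_square by (intro mult_le_cancel_left_pos) simp
    also have "\<dots> \<longleftrightarrow> \<bar>x\<bar> \<le> (4 - \<delta>\<^sup>2) / (4 + \<delta>\<^sup>2)"
      using pos by (simp add: field_simps)
    finally show ?thesis .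
  qed
  show ?thesis
  proof (intro set_eqI)
    fix x
    show "x \<in> D_set \<delta> \<longleftrightarrow> x \<in> {- ((4 - \<delta>\<^sup>2) / (4 + \<delta>\<^sup>2))..(4 - \<delta>\<^sup>2) / (4 + \<delta>\<^sup>2)}"
    proof (cases "\<bar>x\<bar> < 1")
      case True
      then have "x \<in> D_set \<delta> \<longleftrightarrow> \<delta> * varphi x / 2 \<le> 1 - \<bar>x\<bar>" by (auto simp: D_set_def)
      also have "\<dots> \<longleftrightarrow> \<bar>x\<bar> \<le> (4 - \<delta>\<^sup>2) / (4 + \<delta>\<^sup>2)" by (rule iff[OF True])
      finally show ?thesis by (auto simp: abs_le_iff)
    next
      case False
      then have "x \<notin> D_set \<delta>" by (auto simp: D_set_def)
      moreover have "\<not> \<bar>x\<bar> \<le> (4 - \<delta>\<^sup>2) / (4 + \<delta>\<^sup>2)" using False lt1 by linarith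
      ultimately show ?thesis by (auto simp: abs_le_iff)
    qed
  qed
qed

lemma D_set_D:
  assumes "x \<in> D_set \<delta>"
  shows "\<bar>x\<bar> < 1" "\<delta> * varphi x / 2 \<le> 1 - \<bar>x\<bar>"
  using assms by (auto simp: D_set_def)

lemma D_set_sets: "0 < \<delta> \<Longrightarrow> D_set \<delta> \<in> sets lebesgue"
  by (simp add: D_set_eq)

text \<open>What is needed of a node x + c \<open>varphi x\<close>. The weight is compared with
  \<open>varphi\<close> at the node factor by factor. The third bound keeps the derivative 1 - c x /
  \<open>varphi x\<close> of the substitution at or above 1/2.\<close>

lemma D_set_shift:
  assumes "x \<in> D_set \<delta>" "\<bar>c\<bar> \<le> \<delta> / 2"
  shows "\<bar>x + c * varphi x\<bar> \<le> 1" "\<bar>W_weight \<delta> x\<bar> \<le> varphi (x + c * varphi x)" "\<bar>c\<bar> * \<bar>x\<bar> \<le> varphi x / 2"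
proof -
  note x = D_set_D[OF assms(1)]
  have ph: "varphi x > 0" using x by (intro varphi_pos)
  have "\<bar>c * varphi x\<bar> \<le> \<delta> / 2 * varphi x"
    using assms(2) ph by (simp add: abs_mult mult_right_mono)
  then have c: "\<bar>c * varphi x\<bar> \<le> \<delta> * varphi x / 2" by simp
  then show le: "\<bar>x + c * varphi x\<bar> \<le> 1" using x by linarith
  have "(1 - x - \<delta> * varphi x / 2) * (1 + x - \<delta> * varphi x / 2) \<le> (1 - (x + c * varphi x)) * (1 + (x + c * varphi x))"
    using c x by (intro mult_mono) (auto simp: abs_le_iff)
  also have "\<dots> = 1 - (x + c * varphi x)\<^sup>2" by (simp add: power2_eq_square algebra_simps)
  finally have "W_weight \<delta> x \<le> varphi (x + c * varphi x)" unfolding W_weight_def varphi_def[of "x + c * varphi x"] by (rule real_sqrt_le_mono)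
  moreover have "W_weight \<delta> x \<ge> 0" unfolding W_weight_def
    using x by (intro real_sqrt_ge_zero mult_nonneg_nonneg) (auto simp: abs_le_iff)
  ultimately show "\<bar>W_weight \<delta> x\<bar> \<le> varphi (x + c * varphi x)" by simp
  \<comment> \<open>The defining inequality of \<open>D_set\<close>, multiplied by 2 |x| and
    combined with 2 |x| \<le> 1 + |x|, gives the square of \<open>varphi x\<close> on the
    right.\<close>
  have "\<delta> * \<bar>x\<bar> * varphi x \<le> 2 * \<bar>x\<bar> * (1 - \<bar>x\<bar>)"
    using mult_left_mono[OF x(2), of "2 * \<bar>x\<bar>"] by (simp add: mult_ac)
  also have "\<dots> \<le> (1 + \<bar>x\<bar>) * (1 - \<bar>x\<bar>)" using x by (intro mult_right_mono) auto
  also have "\<dots> = varphi x * varphi x"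
    using varphi_square[of x] x by (simp add: power2_eq_square algebra_simps)
  finally have "\<delta> * \<bar>x\<bar> \<le> varphi x" using ph by simp
  moreover have "\<bar>c\<bar> * \<bar>x\<bar> \<le> \<delta> / 2 * \<bar>x\<bar>" using assms(2) by (intro mult_right_mono) auto
  ultimately show "\<bar>c\<bar> * \<bar>x\<bar> \<le> varphi x / 2" by linarith
qed

text \<open>The two outermost nodes lie in [-1, 1], so the zero branch of
  \<open>symm_difference\<close> does not occur.\<close>

lemma symm_difference_D_set:
  assumes x: "x \<in> D_set (real k * h)" and "0 < h"
  shows "symm_difference k (h * varphi x) F x =
    (\<Sum>i\<le>k. real (k choose i) * (-1) ^ (k - i) * F (x + ((real i - real k / 2) * h) * varphi x))"
proof -
  have "real k * h * varphi x / 2 \<le> 1 - \<bar>x\<bar>" by (rule D_set_D[OF x])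
  moreover have "0 \<le> real k * (h * varphi x)"
    using D_set_D(1)[OF x] \<open>0 < h\<close> by (intro mult_nonneg_nonneg varphi_nonneg) auto
  ultimately have "x - real k * (h * varphi x) / 2 \<in> {-1..1}" "x + real k * (h * varphi x) / 2 \<in> {-1..1}"
    by (auto simp: mult.assoc)
  then show ?thesis by (simp add: symm_difference_def mult.assoc)
qed

lemma continuous_on_W_weight: "continuous_on S (W_weight \<delta>)"
  unfolding W_weight_def[abs_def] by (auto intro!: continuous_intros)

lemma shift_coeff_bound: "i \<le> k \<Longrightarrow> 0 < h \<Longrightarrow> \<bar>(real i - real k / 2) * h\<bar> \<le> real k * h / 2"
proof -
  assume "i \<le> k" "0 < h"
  then have "\<bar>real i - real k / 2\<bar> \<le> real k / 2" by (auto simp: abs_if field_simps)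
  from mult_right_mono[OF this, of h] \<open>0 < h\<close> show ?thesis by (simp add: abs_mult)
qed

lemma measurable_W_symm_difference:
  assumes k: "1 \<le> k" and h: "0 < h"
    and F: "\<And>i. i \<le> k \<Longrightarrow> (\<lambda>x. F (x + ((real i - real k / 2) * h) * varphi x)) \<in> borel_measurable (lebesgue_on (D_set (real k * h)))"
  shows "(\<lambda>x. W_weight (real k * h) x ^ r * symm_difference k (h * varphi x) F x)
    \<in> borel_measurable (lebesgue_on (D_set (real k * h)))"
proof -
  have S: "D_set (real k * h) \<in> sets lebesgue" using k h by (intro D_set_sets) simp
  have "(\<lambda>x. W_weight (real k * h) x ^ r * (\<Sum>i\<le>k. real (k choose i) * (-1) ^ (k - i) * F (x + ((real i - real k / 2) * h) * varphi x)))
    \<in> borel_measurable (lebesgue_on (D_set (real k * h)))"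
    using continuous_on_imp_measurable_lebesgue_on[OF continuous_on_W_weight S] F
    by (intro borel_measurable_times borel_measurable_power borel_measurable_sum borel_measurable_const) auto
  then show ?thesis
    by (rule measurable_cong[THEN iffD1, rotated])
      (auto simp: space_restrict_space symm_difference_D_set[OF _ h])
qed

lemma Lp_norm_W_difference_poly:
  fixes Q :: "real poly"
  assumes p: "1 \<le> p" and k: "1 \<le> k" and deg: "degree Q < n"
    and B: "Lp_norm p {-1..1} (poly Q) \<le> ennreal B" "0 \<le> B"
    and h: "0 < h" "h * real n \<le> 2"
  shows "Lp_norm p (D_set (real k * h)) (\<lambda>x. W_weight (real k * h) x ^ r *
      symm_difference k (h * varphi x) (poly ((pderiv ^^ r) Q)) x)
    \<le> ennreal (2 ^ k * 4 ^ r * exp (8 * real k) * (h * real n) ^ k * real n ^ r * B)"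
proof -
  let ?S = "D_set (real k * h)"
  have S: "?S \<in> sets lebesgue" using k h by (intro D_set_sets) simp
  have S1: "?S \<subseteq> {-1..1}" by (auto simp: D_set_def)
  define c where "c j = 2 ^ k * (real k * h) ^ j / fact j" for j
  have c0: "c j \<ge> 0" for j using h by (simp add: c_def)
  \<comment> \<open>Moments of the difference weights. They vanish for j < k, so the Taylor sum
    starts at order k and produces the factor (h n)^k.\<close>
  define a where "a j = (\<Sum>i\<le>k. real (k choose i) * (-1) ^ (k - i) * (real i - real k / 2) ^ j)" for j
  have a0: "a j = 0" if "j < k" for j
    using alternating_binomial_sum_power[OF that, of "- real k / 2"] by (simp add: a_def)
  have a_le: "\<bar>a j\<bar> \<le> 2 ^ k * real k ^ j" for j
  proof -
    have "\<bar>a j\<bar> \<le> (\<Sum>i\<le>k. real (k choose i) * real k ^ j)"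
      unfolding a_def
    proof (rule order_trans[OF sum_abs], rule sum_mono)
      fix i assume "i \<in> {..k}"
      then have "\<bar>real i - real k / 2\<bar> ^ j \<le> real k ^ j" by (intro power_mono) auto
      then show "\<bar>real (k choose i) * (-1) ^ (k - i) * (real i - real k / 2) ^ j\<bar> \<le> real (k choose i) * real k ^ j"
        by (simp add: abs_mult power_abs mult_left_mono)
    qed
    also have "\<dots> = 2 ^ k * real k ^ j"
      by (simp flip: sum_distrib_right of_nat_sum add: choose_row_sum)
    finally show ?thesis .
  qed
  let ?G = "\<lambda>x. W_weight (real k * h) x ^ r * symm_difference k (h * varphi x) (poly ((pderiv ^^ r) Q)) x"
  have mG: "?G \<in> borel_measurable (lebesgue_on ?S)"
    by (intro measurable_W_symm_difference k h continuous_on_imp_measurable_lebesgue_on S continuous_intros)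
  \<comment> \<open>In the Taylor term of order j the step \<open>h * varphi x\<close> supplies
    \<open>varphi x ^ j\<close> and the weight at most \<open>varphi x ^ r\<close>: together the
    weight of Bernstein's inequality at order j + r.\<close>
  define f where "f j x = varphi x ^ (j + r) * poly ((pderiv ^^ (j + r)) Q) x" for j x
  have fB: "Lp_norm p ?S (f j) \<le> ennreal ((4 * real n) ^ (j + r) * B)" for j
    unfolding f_def[abs_def]
    by (rule Lp_norm_subset_le[OF p S1 S _ _ Lp_bernstein[OF p deg B]])
      (use B in \<open>auto intro!: continuous_on_imp_measurable_lebesgue_on continuous_intros\<close>)
  have "Lp_norm p ?S ?G \<le> ennreal (\<Sum>j\<in>{k..n}. c j * ((4 * real n) ^ (j + r) * B))"
  proof (rule Lp_norm_dominated_sum[OF p _ mG _ fB])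
    fix x assume x: "x \<in> ?S"
    have ph: "varphi x \<ge> 0" using D_set_D(1)[OF x] by (intro varphi_nonneg) simp
    let ?R = "(pderiv ^^ r) Q"
    have degR: "degree ?R \<le> n" using deg degree_higher_pderiv[of r Q] by simp
    define T where "T j = poly ((pderiv ^^ j) ?R) x * (h * varphi x) ^ j / fact j * a j" for j
    have "symm_difference k (h * varphi x) (poly ?R) x = (\<Sum>i\<le>k. \<Sum>j\<le>degree ?R.
        real (k choose i) * (-1) ^ (k - i) * (poly ((pderiv ^^ j) ?R) x * ((real i - real k / 2) * h * varphi x) ^ j / fact j))"
      unfolding symm_difference_D_set[OF x h(1)] poly_taylor_expansion sum_distrib_left ..
    also have "\<dots> = (\<Sum>j\<le>degree ?R. T j)"
      unfolding T_def a_def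
      by (subst sum.swap) (auto simp: sum_distrib_left power_mult_distrib mult_ac intro!: sum.cong)
    finally have sd: "symm_difference k (h * varphi x) (poly ?R) x = (\<Sum>j\<le>degree ?R. T j)" .
    have "\<bar>symm_difference k (h * varphi x) (poly ?R) x\<bar> \<le> (\<Sum>j\<le>degree ?R. \<bar>T j\<bar>)"
      unfolding sd by (rule sum_abs)
    also have "\<dots> \<le> (\<Sum>j\<le>n. \<bar>T j\<bar>)"
      by (rule sum_mono2) (use degR in auto)
    also have "\<dots> = (\<Sum>j\<in>{k..n}. \<bar>T j\<bar>)"
      by (rule sum.mono_neutral_right) (auto simp: T_def a0)
    also have "\<dots> \<le> (\<Sum>j\<in>{k..n}. c j * (varphi x ^ j * \<bar>poly ((pderiv ^^ (j + r)) Q) x\<bar>))"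
    proof (rule sum_mono)
      fix j
      have "\<bar>T j\<bar> = \<bar>a j\<bar> * (\<bar>poly ((pderiv ^^ j) ?R) x\<bar> * (h * varphi x) ^ j / fact j)"
        using ph h by (simp add: T_def abs_mult power_abs)
      also have "\<dots> \<le> (2 ^ k * real k ^ j) * (\<bar>poly ((pderiv ^^ j) ?R) x\<bar> * (h * varphi x) ^ j / fact j)"
        using ph h by (intro mult_right_mono a_le) auto
      finally show "\<bar>T j\<bar> \<le> c j * (varphi x ^ j * \<bar>poly ((pderiv ^^ (j + r)) Q) x\<bar>)"
        by (simp add: c_def power_mult_distrib mult_ac funpow_add)
    qed
    finally have 1: "\<bar>symm_difference k (h * varphi x) (poly ?R) x\<bar> \<le>
      (\<Sum>j\<in>{k..n}. c j * (varphi x ^ j * \<bar>poly ((pderiv ^^ (j + r)) Q) x\<bar>))" .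
    have "\<bar>W_weight (real k * h) x\<bar> \<le> varphi x"
      using D_set_shift(2)[OF x, of 0] h by simp
    then have 2: "\<bar>W_weight (real k * h) x\<bar> ^ r \<le> varphi x ^ r" by (rule power_mono) simp
    have "\<bar>?G x\<bar> \<le> varphi x ^ r * (\<Sum>j\<in>{k..n}. c j * (varphi x ^ j * \<bar>poly ((pderiv ^^ (j + r)) Q) x\<bar>))"
      unfolding abs_mult power_abs using ph by (intro mult_mono 1 2) auto
    also have "\<dots> = (\<Sum>j\<in>{k..n}. c j * \<bar>f j x\<bar>)"
      using ph by (simp add: f_def sum_distrib_left abs_mult power_add mult_ac)
    finally show "\<bar>?G x\<bar> \<le> (\<Sum>j\<in>{k..n}. c j * \<bar>f j x\<bar>)" .
  next
    fix j
    show "f j \<in> borel_measurable (lebesgue_on ?S)"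
      unfolding f_def[abs_def] by (intro continuous_on_imp_measurable_lebesgue_on S continuous_intros)
  qed (use B c0 in auto)
  also have "\<dots> \<le> ennreal (2 ^ k * 4 ^ r * exp (8 * real k) * (h * real n) ^ k * real n ^ r * B)"
  proof (rule ennreal_leI)
    have "(\<Sum>j\<in>{k..n}. c j * ((4 * real n) ^ (j + r) * B))
      \<le> (\<Sum>j\<in>{k..n}. (2 ^ k * (4 * real n) ^ r * (h * real n) ^ k * B) * ((8 * real k) ^ j / fact j))"
    proof (rule sum_mono)
      fix j assume j: "j \<in> {k..n}"
      \<comment> \<open>As z \<le> 1, the powers z^j with j \<ge> k are at most z^k. The remaining
        factors (8 k)^j / j! sum to at most exp (8 k), uniformly in n.\<close>
      define z where "z = h * real n / 2"
      have z: "0 \<le> z" "z \<le> 1" using h by (auto simp: z_def)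
      have "(real k * h) ^ j * (4 * real n) ^ j = (8 * real k) ^ j * z ^ j"
        unfolding power_mult_distrib[symmetric] z_def by (simp add: mult_ac)
      also have "\<dots> \<le> (8 * real k) ^ j * z ^ k"
        using j z by (intro mult_left_mono power_decreasing) auto
      also have "z ^ k \<le> (h * real n) ^ k" using z h by (intro power_mono) (auto simp: z_def)
      finally have "(real k * h) ^ j * (4 * real n) ^ j \<le> (8 * real k) ^ j * (h * real n) ^ k"
        by (simp add: mult_left_mono)
      then have "(2 ^ k / fact j * (4 * real n) ^ r * B) * ((real k * h) ^ j * (4 * real n) ^ j)
        \<le> (2 ^ k / fact j * (4 * real n) ^ r * B) * ((8 * real k) ^ j * (h * real n) ^ k)"
        using B by (intro mult_left_mono) auto
      then show "c j * ((4 * real n) ^ (j + r) * B) \<le> (2 ^ k * (4 * real n) ^ r * (h * real n) ^ k * B) * ((8 * real k) ^ j / fact j)"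
        by (simp add: c_def power_add mult_ac)
    qed
    also have "\<dots> = (2 ^ k * (4 * real n) ^ r * (h * real n) ^ k * B) * (\<Sum>j\<in>{k..n}. (8 * real k) ^ j / fact j)"
      by (rule sum_distrib_left[symmetric])
    also have "\<dots> \<le> (2 ^ k * (4 * real n) ^ r * (h * real n) ^ k * B) * exp (8 * real k)"
    proof (intro mult_left_mono)
      have "(\<Sum>j\<in>{k..n}. (8 * real k) ^ j / fact j) \<le> (\<Sum>j. (8 * real k) ^ j / fact j)"
        using summable_exp_generic[of "8 * real k"]
        by (intro sum_le_suminf) (auto simp: field_simps)
      also have "\<dots> = exp (8 * real k)" by (simp add: exp_def divide_inverse mult.commute)
      finally show "(\<Sum>j\<in>{k..n}. (8 * real k) ^ j / fact j) \<le> exp (8 * real k)" .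
    qed (use B h in auto)
    finally show "(\<Sum>j\<in>{k..n}. c j * ((4 * real n) ^ (j + r) * B))
      \<le> 2 ^ k * 4 ^ r * exp (8 * real k) * (h * real n) ^ k * real n ^ r * B"
      by (simp add: power_mult_distrib mult_ac)
  qed
  finally show ?thesis .
qed

lemma symm_difference_poly_eq_0:
  fixes Q :: "real poly"
  assumes "x \<in> D_set (real k * h)" "0 < h" "Q = 0 \<or> degree Q < k"
  shows "symm_difference k (h * varphi x) (poly Q) x = 0"
proof (cases "Q = 0")
  case True
  then show ?thesis by (simp add: symm_difference_def)
next
  case False
  have "symm_difference k (h * varphi x) (poly Q) x = (\<Sum>i\<le>k. \<Sum>j\<le>degree Q.
      real (k choose i) * (-1) ^ (k - i) * (poly ((pderiv ^^ j) Q) x * ((real i - real k / 2) * h * varphi x) ^ j / fact j))"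
    unfolding symm_difference_D_set[OF assms(1,2)] poly_taylor_expansion sum_distrib_left ..
  also have "\<dots> = (\<Sum>j\<le>degree Q. poly ((pderiv ^^ j) Q) x * (h * varphi x) ^ j / fact j *
      (\<Sum>i\<le>k. real (k choose i) * (-1) ^ (k - i) * (real i + (- real k / 2)) ^ j))"
    by (subst sum.swap) (auto simp: sum_distrib_left power_mult_distrib mult_ac intro!: sum.cong)
  also have "\<dots> = 0"
    by (intro sum.neutral ballI, subst alternating_binomial_sum_power) (use assms(3) False in auto)
  finally show ?thesis .
qed

section \<open>The substitutions y = x + c varphi(x)\<close>

context
  fixes \<delta> c :: real
  assumes \<delta>: "0 < \<delta>" and c: "\<bar>c\<bar> \<le> \<delta> / 2"
begin

abbreviation "shift x \<equiv> x + c * varphi x"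

lemma shift_derivative:
  assumes "x \<in> D_set \<delta>"
  shows "(shift has_field_derivative 1 - c * x / varphi x) (at x within D_set \<delta>)"
    and "1 / 2 \<le> \<bar>1 - c * x / varphi x\<bar>"
proof -
  have x: "\<bar>x\<bar> < 1" by (rule D_set_D[OF assms])
  show "(shift has_field_derivative 1 - c * x / varphi x) (at x within D_set \<delta>)"
    using DERIV_add[OF DERIV_ident DERIV_cmult[OF varphi_has_derivative[OF x], of c]]
    by (auto intro: has_field_derivative_at_within)
  have ph: "varphi x > 0" using x by (rule varphi_pos)
  have "\<bar>c * x / varphi x\<bar> = \<bar>c\<bar> * \<bar>x\<bar> / varphi x" using ph by (simp add: abs_mult)
  also have "\<dots> \<le> 1 / 2" using D_set_shift(3)[OF assms c] ph by (simp add: field_simps)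
  finally show "1 / 2 \<le> \<bar>1 - c * x / varphi x\<bar>" by linarith
qed

text \<open>For two points with the same image, y - x = c (\<open>varphi x\<close> -
  \<open>varphi y\<close>). Multiplied by \<open>varphi x + varphi y\<close>, both sides contain the
  factor y - x, and the cofactor is positive because |c| |x| is at most half of
  \<open>varphi x\<close>, and likewise for y.\<close>

lemma inj_on_shift: "inj_on shift (D_set \<delta>)"
proof (rule inj_onI)
  fix x y assume x: "x \<in> D_set \<delta>" and y: "y \<in> D_set \<delta>" and eq: "shift x = shift y"
  have px: "varphi x > 0" and py: "varphi y > 0" using D_set_D(1) x y varphi_pos by blast+
  have "(varphi x - varphi y) * (varphi x + varphi y) = (varphi x)\<^sup>2 - (varphi y)\<^sup>2"
    by (simp add: power2_eq_square algebra_simps)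
  also have "\<dots> = y\<^sup>2 - x\<^sup>2"
    using D_set_D(1)[OF x] D_set_D(1)[OF y] by (simp add: varphi_square)
  finally have d: "(varphi x - varphi y) * (varphi x + varphi y) = (y - x) * (y + x)"
    by (simp add: power2_eq_square algebra_simps)
  have "y - x = c * (varphi x - varphi y)" using eq by (simp add: algebra_simps)
  then have "(y - x) * (varphi x + varphi y) = c * ((y - x) * (y + x))"
    using d by (metis mult.assoc)
  then have z: "(y - x) * (varphi x + varphi y - c * (x + y)) = 0" by (simp add: algebra_simps)
  have "c * (x + y) \<le> \<bar>c\<bar> * \<bar>x\<bar> + \<bar>c\<bar> * \<bar>y\<bar>"
    by (metis abs_ge_self abs_mult abs_triangle_ineq distrib_left order_trans)
  also have "\<dots> \<le> varphi x / 2 + varphi y / 2"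
    using D_set_shift(3)[OF x c] D_set_shift(3)[OF y c] by linarith
  finally have "varphi x + varphi y - c * (x + y) > 0" using px py by linarith
  then show "x = y" using z by simp
qed

lemma shift_image:
  "shift ` D_set \<delta> \<subseteq> {-1..1}" "shift ` D_set \<delta> \<in> sets lebesgue"
proof -
  show "shift ` D_set \<delta> \<subseteq> {-1..1}"
  proof (rule image_subsetI)
    fix x assume "x \<in> D_set \<delta>"
    from D_set_shift(1)[OF this c] show "shift x \<in> {-1..1}"
      by (metis abs_le_D1 abs_le_D2 atLeastAtMost_iff minus_le_iff)
  qed
  have "compact (shift ` D_set \<delta>)"
    by (intro compact_continuous_image continuous_intros) (simp add: D_set_eq[OF \<delta>])
  then show "shift ` D_set \<delta> \<in> sets lebesgue" by (simp add: compact_imp_closed)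
qed

text \<open>Lebesgue measurability does not pass through composition with an arbitrary continuous
  map, so it is extracted from the change of variables theorem. That theorem concerns integrable
  functions, hence the bounded \<open>arctan (F x)\<close>; the Jacobian is divided out and
  \<open>tan\<close> recovers F.\<close>

lemma measurable_comp_shift:
  fixes F :: "real \<Rightarrow> real"
  assumes F: "F \<in> borel_measurable (lebesgue_on {-1..1})"
  shows "(\<lambda>x. F (shift x)) \<in> borel_measurable (lebesgue_on (D_set \<delta>))"
proof -
  let ?S = "D_set \<delta>" and ?d = "\<lambda>x. 1 - c * x / varphi x"
  have S: "?S \<in> sets lebesgue" using \<delta> by (rule D_set_sets)
  have mF: "F \<in> borel_measurable (lebesgue_on (shift ` ?S))"
    using F shift_image(1) by (rule measurable_restrict_mono)
  have "(\<lambda>x. arctan (F x)) absolutely_integrable_on shift ` ?S"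
  proof (rule measurable_bounded_by_integrable_imp_absolutely_integrable)
    show "(\<lambda>x. arctan (F x)) \<in> borel_measurable (lebesgue_on (shift ` ?S))"
      using mF by (rule borel_measurable_continuous_on[OF continuous_on_arctan[OF continuous_on_id]])
    show "(\<lambda>_. pi / 2) integrable_on shift ` ?S"
    proof (rule integrable_on_const)
      have "bounded (shift ` ?S)" using shift_image(1) bounded_subset bounded_closed_interval by blast
      then show "shift ` ?S \<in> lmeasurable" using shift_image(2) by (rule bounded_set_imp_lmeasurable)
    qed
    show "norm (arctan (F x)) \<le> pi / 2" for x
      using arctan_bounded[of "F x"] by (auto simp: abs_if)
  qed (rule shift_image)
  then have "(\<lambda>x. \<bar>?d x\<bar> * arctan (F (shift x))) absolutely_integrable_on ?S"
    using absolutely_integrable_change_of_variables_1'[OF S shift_derivative(1) inj_on_shift, of "\<lambda>x. arctan (F x)"]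
    by simp
  then have m: "(\<lambda>x. \<bar>?d x\<bar> * arctan (F (shift x))) \<in> borel_measurable (lebesgue_on ?S)"
    by (rule absolutely_integrable_measurable[THEN iffD1, THEN conjunct1, OF S, rotated])
  have "(\<lambda>x. \<bar>?d x\<bar>) \<in> borel_measurable (lebesgue_on ?S)"
  proof (intro continuous_on_imp_measurable_lebesgue_on S continuous_intros)
    show "\<forall>x\<in>?S. varphi x \<noteq> 0" using D_set_D(1) varphi_pos by force
  qed
  then have "(\<lambda>x. tan ((\<bar>?d x\<bar> * arctan (F (shift x))) / \<bar>?d x\<bar>)) \<in> borel_measurable (lebesgue_on ?S)"
    using m unfolding tan_def by measurable
  then show ?thesis
  proof (rule measurable_cong[THEN iffD1, rotated])
    fix x assume "x \<in> space (lebesgue_on ?S)"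
    then have "\<bar>?d x\<bar> \<noteq> 0" using shift_derivative(2)[of x] by (auto simp: space_restrict_space)
    then show "tan ((\<bar>?d x\<bar> * arctan (F (shift x))) / \<bar>?d x\<bar>) = F (shift x)" by (simp add: tan_arctan)
  qed
qed

text \<open>The factor 2 is the reciprocal of the lower bound 1/2 of the Jacobian.\<close>

lemma nn_integral_comp_shift:
  assumes H: "H \<in> borel_measurable (lebesgue_on {-1..1})" "\<And>x. 0 \<le> H x"
  shows "(\<integral>\<^sup>+x. ennreal (H (shift x)) \<partial>lebesgue_on (D_set \<delta>)) \<le> 2 * (\<integral>\<^sup>+x. ennreal (H x) \<partial>lebesgue_on {-1..1})"
proof (cases "(\<integral>\<^sup>+x. ennreal (H x) \<partial>lebesgue_on {-1..1}) = \<infinity>")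
  case True
  then show ?thesis by (simp add: ennreal_mult_top)
next
  case False
  let ?S = "D_set \<delta>" and ?d = "\<lambda>x. 1 - c * x / varphi x"
  have S: "?S \<in> sets lebesgue" using \<delta> by (rule D_set_sets)
  have "integrable (lebesgue_on {-1..1}) H"
    using H False by (intro integrableI_bounded) (auto simp: less_top)
  then have "H absolutely_integrable_on {-1..1}"
    by (subst (asm) integrable_restrict_space) (auto simp: set_integrable_def)
  then have HS: "H absolutely_integrable_on shift ` ?S"
    by (rule set_integrable_subset) (rule shift_image)+
  then have cv: "(\<lambda>x. \<bar>?d x\<bar> * H (shift x)) absolutely_integrable_on ?S"
    "integral ?S (\<lambda>x. \<bar>?d x\<bar> * H (shift x)) = integral (shift ` ?S) H"
    using has_absolute_integral_change_of_variables_1'[OF S shift_derivative(1) inj_on_shift, of H "integral (shift ` ?S) H"]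
    by auto
  have m: "(\<lambda>x. \<bar>?d x\<bar> * H (shift x)) \<in> borel_measurable (lebesgue_on ?S)"
    using cv(1) by (rule absolutely_integrable_measurable[THEN iffD1, THEN conjunct1, OF S, rotated])
  have "(\<integral>\<^sup>+x. ennreal (H (shift x)) \<partial>lebesgue_on ?S) \<le> (\<integral>\<^sup>+x. 2 * ennreal (\<bar>?d x\<bar> * H (shift x)) \<partial>lebesgue_on ?S)"
  proof (rule nn_integral_mono)
    fix x assume "x \<in> space (lebesgue_on ?S)"
    then have "1 / 2 \<le> \<bar>?d x\<bar>" using shift_derivative(2)[of x] by (auto simp: space_restrict_space)
    then have "1 / 2 * H (shift x) \<le> \<bar>?d x\<bar> * H (shift x)" using H by (intro mult_right_mono) auto
    then have "H (shift x) \<le> 2 * (\<bar>?d x\<bar> * H (shift x))" by linarith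
    then show "ennreal (H (shift x)) \<le> 2 * ennreal (\<bar>?d x\<bar> * H (shift x))"
      by (metis ennreal_leI ennreal_mult'' ennreal_numeral H(2) abs_ge_zero mult_nonneg_nonneg)
  qed
  also have "\<dots> = 2 * (\<integral>\<^sup>+x. ennreal (\<bar>?d x\<bar> * H (shift x)) \<partial>lebesgue_on ?S)"
    using m by (intro nn_integral_cmult) auto
  also have "(\<integral>\<^sup>+x. ennreal (\<bar>?d x\<bar> * H (shift x)) \<partial>lebesgue_on ?S) = ennreal (integral ?S (\<lambda>x. \<bar>?d x\<bar> * H (shift x)))"
    using cv(1) H S by (intro nn_integral_lebesgue_on_has_integral integrable_integral)
      (auto simp: absolutely_integrable_on_def)
  also have "\<dots> = ennreal (integral (shift ` ?S) H)" by (simp only: cv(2))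
  also have "\<dots> = (\<integral>\<^sup>+x. ennreal (H x) \<partial>lebesgue_on (shift ` ?S))"
    using HS H shift_image(2) by (intro nn_integral_lebesgue_on_has_integral[symmetric] integrable_integral)
      (auto simp: absolutely_integrable_on_def)
  also have "\<dots> \<le> (\<integral>\<^sup>+x. ennreal (H x) \<partial>lebesgue_on {-1..1})"
    by (rule nn_integral_lebesgue_on_mono[OF shift_image]) simp
  finally show ?thesis by (simp add: mult_left_mono)
qed

lemma Lp_norm_comp_shift:
  assumes p: "1 \<le> p" and F: "F \<in> borel_measurable (lebesgue_on {-1..1})"
    and B: "Lp_norm p {-1..1} F \<le> ennreal B" "0 \<le> B"
  shows "Lp_norm p (D_set \<delta>) (\<lambda>x. F (shift x)) \<le> ennreal (2 * B)"
proof (cases "p = \<infinity>")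
  case True
  \<comment> \<open>The exceptional null set must have a null preimage; this is the integral
    estimate above for the indicator of N.\<close>
  define N where "N = {x \<in> {-1..1}. \<not> \<bar>F x\<bar> \<le> B}"
  have ae: "AE x in lebesgue_on {-1..1}. \<bar>F x\<bar> \<le> B" using Lp_norm_infinity_le_iff[OF F] B True by simp
  have "{x \<in> space (lebesgue_on {-1..1}). \<not> \<bar>F x\<bar> \<le> B} \<in> sets (lebesgue_on {-1..1})"
    using F by measurable
  then have Nm: "N \<in> sets (lebesgue_on {-1..1})" by (simp add: N_def space_restrict_space)
  have ind: "(indicator N :: real \<Rightarrow> real) \<in> borel_measurable (lebesgue_on {-1..1})"
    using Nm by (rule borel_measurable_indicator)
  have "(\<integral>\<^sup>+x. ennreal (indicator N (shift x)) \<partial>lebesgue_on (D_set \<delta>)) \<le> 2 * (\<integral>\<^sup>+x. ennreal (indicator N x) \<partial>lebesgue_on {-1..1})"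
    by (rule nn_integral_comp_shift[OF ind]) simp
  also have "(\<integral>\<^sup>+x. ennreal (indicator N x) \<partial>lebesgue_on {-1..1}) = 0"
    using ind ae by (subst nn_integral_0_iff_AE) (auto elim!: eventually_mono simp: N_def)
  finally have "(\<integral>\<^sup>+x. ennreal (indicator N (shift x)) \<partial>lebesgue_on (D_set \<delta>)) = 0" by simp
  then have "AE x in lebesgue_on (D_set \<delta>). ennreal (indicator N (shift x)) = 0"
    using measurable_comp_shift[OF ind] by (subst (asm) nn_integral_0_iff_AE) auto
  then have "AE x in lebesgue_on (D_set \<delta>). \<bar>F (shift x)\<bar> \<le> 2 * B"
  proof (rule AE_mp, intro AE_I2 impI)
    fix x assume "x \<in> space (lebesgue_on (D_set \<delta>))" "ennreal (indicator N (shift x)) = 0"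
    then have "shift x \<in> {-1..1}" "shift x \<notin> N"
      using shift_image(1) by (auto simp: space_restrict_space split: split_indicator_asm)
    then show "\<bar>F (shift x)\<bar> \<le> 2 * B" using B by (auto simp: N_def)
  qed
  then show ?thesis
    using Lp_norm_infinity_le_iff[OF measurable_comp_shift[OF F], of "2 * B"] B True by simp
next
  case False
  let ?q = "enn2real p"
  have q: "?q \<ge> 1" using p enn2real_ge_one False by blast
  have "(\<integral>\<^sup>+x. ennreal (\<bar>F (shift x)\<bar> powr ?q) \<partial>lebesgue_on (D_set \<delta>)) \<le> 2 * (\<integral>\<^sup>+x. ennreal (\<bar>F x\<bar> powr ?q) \<partial>lebesgue_on {-1..1})"
    by (rule nn_integral_comp_shift) (use F in auto)
  also have "\<dots> \<le> 2 * ennreal (B powr ?q)"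
    using Lp_norm_finite_le_iff[OF p False B(2)] B(1) by (intro mult_left_mono) auto
  also have "\<dots> = ennreal (2 * B powr ?q)" by (simp add: ennreal_mult')
  also have "\<dots> \<le> ennreal ((2 * B) powr ?q)"
  proof (rule ennreal_leI)
    \<comment> \<open>The Jacobian factor enters with the exponent 1/q; it is enlarged to 2 to have
      one constant for all p.\<close>
    have "(2::real) powr 1 \<le> 2 powr ?q" using q by (intro powr_mono) auto
    then show "2 * B powr ?q \<le> (2 * B) powr ?q" using B by (simp add: powr_mult mult_right_mono)
  qed
  finally show ?thesis using Lp_norm_finite_le_iff[OF p False, of "2 * B"] B by simp
qed

end

lemma Lp_norm_W_difference:
  assumes p: "1 \<le> p" and k: "1 \<le> k" and h: "0 < h"
    and F: "F \<in> borel_measurable (lebesgue_on {-1..1})"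
    and B: "Lp_norm p {-1..1} (\<lambda>x. F x * varphi x ^ r) \<le> ennreal B" "0 \<le> B"
  shows "(\<lambda>x. W_weight (real k * h) x ^ r * symm_difference k (h * varphi x) F x)
      \<in> borel_measurable (lebesgue_on (D_set (real k * h)))"
    and "Lp_norm p (D_set (real k * h)) (\<lambda>x. W_weight (real k * h) x ^ r * symm_difference k (h * varphi x) F x)
      \<le> ennreal (2 ^ Suc k * B)"
proof -
  let ?S = "D_set (real k * h)"
  let ?c = "\<lambda>i. (real i - real k / 2) * h"
  have \<delta>: "0 < real k * h" using k h by simp
  have mF: "(\<lambda>x. F (x + ?c i * varphi x)) \<in> borel_measurable (lebesgue_on ?S)" if "i \<le> k" for i
    by (rule measurable_comp_shift[OF \<delta> shift_coeff_bound[OF that h] F])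
  show mG: "(\<lambda>x. W_weight (real k * h) x ^ r * symm_difference k (h * varphi x) F x) \<in> borel_measurable (lebesgue_on ?S)"
    by (rule measurable_W_symm_difference[OF k h mF])
  let ?f = "\<lambda>i x. F (x + ?c i * varphi x) * varphi (x + ?c i * varphi x) ^ r"
  have mFp: "(\<lambda>x. F x * varphi x ^ r) \<in> borel_measurable (lebesgue_on {-1..1})"
    using F continuous_on_imp_measurable_lebesgue_on[OF continuous_on_varphi, of "{-1..1}"] by auto
  have "Lp_norm p ?S (\<lambda>x. W_weight (real k * h) x ^ r * symm_difference k (h * varphi x) F x)
    \<le> ennreal (\<Sum>i\<le>k. real (k choose i) * (2 * B))"
  proof (rule Lp_norm_dominated_sum[OF p _ mG])
    fix i assume i: "i \<in> {..k}"
    then have ci: "\<bar>?c i\<bar> \<le> real k * h / 2" using h by (intro shift_coeff_bound) auto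
    show "?f i \<in> borel_measurable (lebesgue_on ?S)"
      by (rule measurable_comp_shift[OF \<delta> ci mFp])
    show "Lp_norm p ?S (?f i) \<le> ennreal (2 * B)"
      by (rule Lp_norm_comp_shift[OF \<delta> ci p mFp B])
  next
    fix x assume x: "x \<in> ?S"
    have "\<bar>W_weight (real k * h) x ^ r * symm_difference k (h * varphi x) F x\<bar>
      \<le> (\<Sum>i\<le>k. \<bar>W_weight (real k * h) x ^ r * (real (k choose i) * (-1) ^ (k - i) * F (x + ?c i * varphi x))\<bar>)"
      unfolding symm_difference_D_set[OF x h] sum_distrib_left by (rule sum_abs)
    also have "\<dots> \<le> (\<Sum>i\<le>k. real (k choose i) * \<bar>?f i x\<bar>)"
    proof (rule sum_mono)
      fix i assume "i \<in> {..k}"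
      then have ci: "\<bar>?c i\<bar> \<le> real k * h / 2" using h by (intro shift_coeff_bound) auto
      have "\<bar>W_weight (real k * h) x\<bar> ^ r \<le> \<bar>varphi (x + ?c i * varphi x)\<bar> ^ r"
        by (intro power_mono order_trans[OF D_set_shift(2)[OF x ci]]) auto
      then have "\<bar>W_weight (real k * h) x\<bar> ^ r * (real (k choose i) * \<bar>F (x + ?c i * varphi x)\<bar>)
        \<le> \<bar>varphi (x + ?c i * varphi x)\<bar> ^ r * (real (k choose i) * \<bar>F (x + ?c i * varphi x)\<bar>)"
        by (intro mult_right_mono) auto
      then show "\<bar>W_weight (real k * h) x ^ r * (real (k choose i) * (-1) ^ (k - i) * F (x + ?c i * varphi x))\<bar>
        \<le> real (k choose i) * \<bar>?f i x\<bar>"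
        by (simp add: abs_mult power_abs mult_ac)
    qed
    finally show "\<bar>W_weight (real k * h) x ^ r * symm_difference k (h * varphi x) F x\<bar>
      \<le> (\<Sum>i\<le>k. real (k choose i) * \<bar>?f i x\<bar>)" .
  qed (use B in auto)
  \<comment> \<open>2^k is the sum of the binomial coefficients; the other 2 comes from the
    substitution at each node.\<close>
  also have "(\<Sum>i\<le>k. real (k choose i) * (2 * B)) = 2 ^ Suc k * B"
    by (simp flip: sum_distrib_right of_nat_sum add: choose_row_sum)
  finally show "Lp_norm p ?S (\<lambda>x. W_weight (real k * h) x ^ r * symm_difference k (h * varphi x) F x)
      \<le> ennreal (2 ^ Suc k * B)" .
qed

section \<open>Differentiation of limits in $L_1$\<close>

lemma lebesgue_on_interval_sets:
  fixes a b x y :: real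
  assumes "{x<..<y} \<subseteq> {a..b}"
  shows "{x<..<y} \<in> sets (lebesgue_on {a..b})"
  using assms by (subst sets_restrict_space_iff) auto

lemma sum_nn_integral_disjoint_le:
  assumes F: "finite F" and f: "f \<in> borel_measurable M"
    and I: "\<And>i. i \<in> F \<Longrightarrow> I i \<in> sets M" "disjoint_family_on I F"
  shows "(\<Sum>i\<in>F. \<integral>\<^sup>+x. f x * indicator (I i) x \<partial>M) \<le> (\<integral>\<^sup>+x. f x \<partial>M)"
proof -
  have "(\<Sum>i\<in>F. \<integral>\<^sup>+x. f x * indicator (I i) x \<partial>M) = (\<integral>\<^sup>+x. (\<Sum>i\<in>F. f x * indicator (I i) x) \<partial>M)"
    using f I by (intro nn_integral_sum[symmetric]) auto
  also have "\<dots> = (\<integral>\<^sup>+x. f x * indicator (\<Union>i\<in>F. I i) x \<partial>M)"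
    using F I by (simp add: sum_distrib_left[symmetric] indicator_UN_disjoint)
  also have "\<dots> \<le> (\<integral>\<^sup>+x. f x \<partial>M)"
    by (intro nn_integral_mono) (auto split: split_indicator)
  finally show ?thesis .
qed

text \<open>Setting for the last differentiation: g should be an antiderivative of the L_1 limit G.
  Both conclusions come from increments of \<open>g - Q n\<close>, which are controlled by the L_1
  error of \<open>P n\<close>; g is never written as an integral of G.\<close>

context
  fixes a b :: real and G g :: "real \<Rightarrow> real" and P Q :: "nat \<Rightarrow> real \<Rightarrow> real"
  assumes Gm: "G \<in> borel_measurable (lebesgue_on {a..b})"
    and der: "\<And>n x. x \<in> {a..b} \<Longrightarrow> (Q n has_real_derivative P n x) (at x)"
    and cont: "\<And>n. continuous_on {a..b} (P n)"
    and L1: "(\<lambda>n. \<integral>\<^sup>+x. ennreal \<bar>G x - P n x\<bar> \<partial>lebesgue_on {a..b}) \<longlonglongrightarrow> 0"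
    and lim: "\<And>x. x \<in> {a..b} \<Longrightarrow> (\<lambda>n. Q n x) \<longlonglongrightarrow> g x"
begin

private lemma measurable_remainder [measurable]:
  "(\<lambda>x. ennreal \<bar>G x - P n x\<bar>) \<in> borel_measurable (lebesgue_on {a..b})"
  using Gm continuous_on_imp_measurable_lebesgue_on[OF cont, of n] by simp

text \<open>With \<open>Q m\<close> in place of g this follows from the fundamental theorem of
  calculus up to the L_1 error of \<open>P m\<close>, which disappears as m tends to infinity. The
  open interval on the right lets intervals with disjoint interiors be summed.\<close>

private lemma remainder_increment_le:
  assumes "a \<le> x" "x \<le> y" "y \<le> b"
  shows "ennreal \<bar>(g y - Q n y) - (g x - Q n x)\<bar>
    \<le> (\<integral>\<^sup>+u. ennreal \<bar>G u - P n u\<bar> * indicator {x<..<y} u \<partial>lebesgue_on {a..b})"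
    (is "_ \<le> ?R")
proof -
  let ?E = "\<lambda>m. \<integral>\<^sup>+u. ennreal \<bar>G u - P m u\<bar> \<partial>lebesgue_on {a..b}"
  have sub: "{x<..<y} \<subseteq> {a..b}" using assms by auto
  note S [measurable] = lebesgue_on_interval_sets[OF sub]
  have le: "ennreal \<bar>(Q m y - Q n y) - (Q m x - Q n x)\<bar> \<le> ?R + ?E m" for m
  proof -
    have ci: "continuous_on {x..y} (\<lambda>u. P m u - P n u)"
      by (intro continuous_intros continuous_on_subset[OF cont]) (use assms in auto)
    have "((\<lambda>u. P m u - P n u) has_integral ((Q m y - Q n y) - (Q m x - Q n x))) {x..y}"
      by (rule fundamental_theorem_of_calculus)
        (use assms in \<open>auto intro!: derivative_intros has_field_derivative_at_within[OF der]
           simp flip: has_real_derivative_iff_has_vector_derivative\<close>)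
    then have "\<bar>(Q m y - Q n y) - (Q m x - Q n x)\<bar> = norm (integral {x..y} (\<lambda>u. P m u - P n u))"
      by (simp add: integral_unique)
    also have "\<dots> \<le> integral {x..y} (\<lambda>u. \<bar>P m u - P n u\<bar>)"
      using ci continuous_on_rabs[OF ci]
      by (intro integral_norm_bound_integral integrable_continuous_real) auto
    finally have "ennreal \<bar>(Q m y - Q n y) - (Q m x - Q n x)\<bar> \<le> ennreal (integral {x..y} (\<lambda>u. \<bar>P m u - P n u\<bar>))"
      by (rule ennreal_leI)
    also have "\<dots> = (\<integral>\<^sup>+u. ennreal \<bar>P m u - P n u\<bar> \<partial>lebesgue_on {x<..<y})"
      using continuous_on_rabs[OF ci]
      by (intro nn_integral_lebesgue_on_has_integral[symmetric])
        (auto simp flip: has_integral_Icc_iff_Ioo intro!: integrable_integral integrable_continuous_real)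
    also have "\<dots> = (\<integral>\<^sup>+u. ennreal \<bar>P m u - P n u\<bar> * indicator {x<..<y} u \<partial>lebesgue_on {a..b})"
      using sub by (auto simp: nn_integral_restrict_space intro!: nn_integral_cong split: split_indicator)
    also have "\<dots> \<le> (\<integral>\<^sup>+u. ennreal \<bar>G u - P n u\<bar> * indicator {x<..<y} u + ennreal \<bar>G u - P m u\<bar> \<partial>lebesgue_on {a..b})"
      by (intro nn_integral_mono) (auto split: split_indicator simp flip: ennreal_plus intro!: ennreal_leI)
    also have "\<dots> = ?R + ?E m" by (rule nn_integral_add) measurable
    finally show ?thesis .
  qed
  have "(\<lambda>m. ennreal \<bar>(Q m y - Q n y) - (Q m x - Q n x)\<bar>) \<longlonglongrightarrow> ennreal \<bar>(g y - Q n y) - (g x - Q n x)\<bar>"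
    by (intro tendsto_intros lim) (use assms in auto)
  moreover have "(\<lambda>m. ?R + ?E m) \<longlonglongrightarrow> ?R + 0" by (intro tendsto_intros L1)
  ultimately have "ennreal \<bar>(g y - Q n y) - (g x - Q n x)\<bar> \<le> ?R + 0"
    by (rule LIMSEQ_le) (use le in auto)
  then show ?thesis by simp
qed

private lemma small_remainder:
  assumes "0 < e"
  obtains n where "(\<integral>\<^sup>+x. ennreal \<bar>G x - P n x\<bar> \<partial>lebesgue_on {a..b}) < ennreal e"
  using order_tendstoD(2)[OF L1, of "ennreal e"] assms eventually_happens by force

text \<open>g is split into \<open>Q n\<close>, whose derivative is bounded on the compact interval,
  and \<open>g - Q n\<close>, whose increments over disjoint intervals add up to at most the L_1
  error.\<close>

lemma absolutely_continuous_on_L1_limit: "absolutely_continuous_on {a..b} g"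
  unfolding absolutely_continuous_on_def
proof (intro allI impI)
  fix e :: real assume e: "0 < e"
  obtain n where n: "(\<integral>\<^sup>+x. ennreal \<bar>G x - P n x\<bar> \<partial>lebesgue_on {a..b}) < ennreal (e / 2)"
    using small_remainder[of "e / 2"] e by auto
  have "bounded (P n ` {a..b})"
    by (intro compact_imp_bounded compact_continuous_image cont compact_Icc)
  then obtain L where L: "0 < L" "\<And>x. x \<in> {a..b} \<Longrightarrow> \<bar>P n x\<bar> \<le> L"
    unfolding bounded_pos by auto
  show "\<exists>\<delta>>0. \<forall>d. d division_of \<Union>d \<and> \<Union>d \<subseteq> {a..b} \<and> (\<Sum>K\<in>d. Sup K - Inf K) < \<delta>
      \<longrightarrow> (\<Sum>K\<in>d. \<bar>g (Sup K) - g (Inf K)\<bar>) < e"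
  proof (intro exI[of _ "e / (2 * L)"] conjI allI impI)
    show "0 < e / (2 * L)" using e L by simp
    fix d :: "real set set"
    assume "d division_of \<Union>d \<and> \<Union>d \<subseteq> {a..b} \<and> (\<Sum>K\<in>d. Sup K - Inf K) < e / (2 * L)"
    then have d: "d division_of \<Union>d" and sub: "\<Union>d \<subseteq> {a..b}" and small: "(\<Sum>K\<in>d. Sup K - Inf K) < e / (2 * L)"
      by auto
    have K: "Inf K \<le> Sup K \<and> a \<le> Inf K \<and> Sup K \<le> b \<and> interior K = {Inf K<..<Sup K}" if Kd: "K \<in> d" for K
    proof -
      obtain u v where "K = cbox u v" using division_ofD(4)[OF d Kd] by auto
      moreover have "K \<noteq> {}" using division_ofD(3)[OF d Kd] .
      ultimately have uv: "K = {u..v}" "u \<le> v" by auto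
      moreover have "K \<subseteq> {a..b}" using sub Kd by auto
      ultimately show ?thesis by auto
    qed
    let ?\<nu> = "\<lambda>K. \<integral>\<^sup>+u. ennreal \<bar>G u - P n u\<bar> * indicator {Inf K<..<Sup K} u \<partial>lebesgue_on {a..b}"
    have le: "\<bar>g (Sup K) - g (Inf K)\<bar> \<le> L * (Sup K - Inf K) + \<bar>(g (Sup K) - Q n (Sup K)) - (g (Inf K) - Q n (Inf K))\<bar>" if "K \<in> d" for K
    proof -
      have "norm (Q n (Sup K) - Q n (Inf K)) \<le> L * norm (Sup K - Inf K)"
      proof (rule field_differentiable_bound[of "{Inf K..Sup K}"])
        show "(Q n has_field_derivative P n z) (at z within {Inf K..Sup K})" if "z \<in> {Inf K..Sup K}" for z
          using der[of z n] that K[OF \<open>K \<in> d\<close>] by (auto intro: has_field_derivative_at_within)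
        show "norm (P n z) \<le> L" if "z \<in> {Inf K..Sup K}" for z
          using L(2)[of z] that K[OF \<open>K \<in> d\<close>] by auto
      qed (use K[OF that] in auto)
      then show ?thesis using K[OF that] by simp
    qed
    have "ennreal (\<Sum>K\<in>d. \<bar>(g (Sup K) - Q n (Sup K)) - (g (Inf K) - Q n (Inf K))\<bar>)
      = (\<Sum>K\<in>d. ennreal \<bar>(g (Sup K) - Q n (Sup K)) - (g (Inf K) - Q n (Inf K))\<bar>)"
      by (rule sum_ennreal[symmetric]) simp
    also have "\<dots> \<le> (\<Sum>K\<in>d. ?\<nu> K)"
      using K by (intro sum_mono remainder_increment_le) auto
    also have "\<dots> \<le> (\<integral>\<^sup>+x. ennreal \<bar>G x - P n x\<bar> \<partial>lebesgue_on {a..b})"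
    proof (rule sum_nn_integral_disjoint_le)
      show "finite d" using d by blast
      show "disjoint_family_on (\<lambda>K. {Inf K<..<Sup K}) d"
        unfolding disjoint_family_on_def using division_ofD(5)[OF d] K by metis
      show "{Inf K<..<Sup K} \<in> sets (lebesgue_on {a..b})" if "K \<in> d" for K
        using K[OF that] by (intro lebesgue_on_interval_sets) auto
    qed measurable
    finally have "ennreal (\<Sum>K\<in>d. \<bar>(g (Sup K) - Q n (Sup K)) - (g (Inf K) - Q n (Inf K))\<bar>) < ennreal (e / 2)"
      using n by order
    then have 1: "(\<Sum>K\<in>d. \<bar>(g (Sup K) - Q n (Sup K)) - (g (Inf K) - Q n (Inf K))\<bar>) < e / 2"
      using e by (simp add: ennreal_less_iff sum_nonneg)
    have "(\<Sum>K\<in>d. \<bar>g (Sup K) - g (Inf K)\<bar>) \<le>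
      (\<Sum>K\<in>d. L * (Sup K - Inf K) + \<bar>(g (Sup K) - Q n (Sup K)) - (g (Inf K) - Q n (Inf K))\<bar>)"
      by (intro sum_mono le)
    also have "\<dots> = L * (\<Sum>K\<in>d. Sup K - Inf K) + (\<Sum>K\<in>d. \<bar>(g (Sup K) - Q n (Sup K)) - (g (Inf K) - Q n (Inf K))\<bar>)"
      by (simp add: sum.distrib sum_distrib_left)
    also have "\<dots> < L * (e / (2 * L)) + e / 2"
      using small L 1 by (intro add_strict_mono mult_strict_left_mono) auto
    also have "\<dots> = e" using L by simp
    finally show "(\<Sum>K\<in>d. \<bar>g (Sup K) - g (Inf K)\<bar>) < e" .
  qed
qed

text \<open>The usual proof of the Lebesgue differentiation theorem: split off a smooth part, and control
  the rest by the Vitali covering lemma.\<close>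

private lemma bad_points_negligible:
  assumes l: "0 < l"
  shows "negligible {x \<in> {a<..<b}. \<not> (\<exists>d>0. \<forall>y. \<bar>y - x\<bar> < d \<longrightarrow> \<bar>g y - g x - G x * (y - x)\<bar> \<le> l * \<bar>y - x\<bar>)}"
    (is "negligible ?B")
  unfolding negligible_outer_le
proof (intro allI impI)
  fix e :: real assume e: "0 < e"
  \<comment> \<open>The exceptional sets T1 and T2 below have measures at most 3 \<eta> / l and 30
    \<eta> / l, together 33 \<eta> / l = e / 2.\<close>
  define \<eta> where "\<eta> = e * l / 66"
  have \<eta>: "\<eta> > 0" using e l by (simp add: \<eta>_def)
  obtain n where n: "(\<integral>\<^sup>+x. ennreal \<bar>G x - P n x\<bar> \<partial>lebesgue_on {a..b}) < ennreal \<eta>"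
    using small_remainder[OF \<eta>] .
  define H where "H x = g x - Q n x" for x
  \<comment> \<open>The points where |G - \<open>P n\<close>| is at least l / 3; few by Markov's
    inequality.\<close>
  define T1 where "T1 = {x \<in> {a..b}. 1 \<le> ennreal (3 / l) * ennreal \<bar>G x - P n x\<bar>}"
  have "{x \<in> space (lebesgue_on {a..b}). 1 \<le> ennreal (3 / l) * ennreal \<bar>G x - P n x\<bar>} \<in> sets (lebesgue_on {a..b})"
    by measurable
  then have "T1 \<in> sets (lebesgue_on {a..b})" by (simp add: T1_def space_restrict_space)
  then have T1s: "T1 \<in> sets lebesgue" by (subst (asm) sets_restrict_space_iff) auto
  have "emeasure lebesgue T1 = emeasure (lebesgue_on {a..b}) T1"
    by (rule emeasure_restrict_space[symmetric]) (auto simp: T1_def)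
  also have "\<dots> \<le> ennreal (3 / l) * (\<integral>\<^sup>+x. ennreal \<bar>G x - P n x\<bar> * indicator {a..b} x \<partial>lebesgue_on {a..b})"
    unfolding T1_def
    by (rule nn_integral_Markov_inequality)
      (auto simp: sets_restrict_space_iff intro!: borel_measurable_times_ennreal borel_measurable_indicator measurable_remainder)
  also have "\<dots> \<le> ennreal (3 / l) * ennreal \<eta>"
  proof (rule mult_left_mono)
    have "(\<integral>\<^sup>+x. ennreal \<bar>G x - P n x\<bar> * indicator {a..b} x \<partial>lebesgue_on {a..b}) \<le> (\<integral>\<^sup>+x. ennreal \<bar>G x - P n x\<bar> \<partial>lebesgue_on {a..b})"
      by (intro nn_integral_mono) (auto split: split_indicator)
    then show "(\<integral>\<^sup>+x. ennreal \<bar>G x - P n x\<bar> * indicator {a..b} x \<partial>lebesgue_on {a..b}) \<le> ennreal \<eta>"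
      using n by order
  qed simp
  also have "\<dots> = ennreal (3 / l * \<eta>)" using l \<eta> by (intro ennreal_mult[symmetric]) auto
  finally have T1e: "emeasure lebesgue T1 \<le> ennreal (3 / l * \<eta>)" .
  then have T1m: "T1 \<in> lmeasurable" using T1s by (intro fmeasurableI) (auto intro: le_less_trans)
  then have T1: "measure lebesgue T1 \<le> 3 / l * \<eta>"
    using T1e l \<eta> by (simp add: emeasure_eq_measure2)

  \<comment> \<open>The allowance l |y - x| is shared in thirds. Outside T1 the terms from
    \<open>Q n\<close> and from G - \<open>P n\<close> take at most one third each near x, so a
    failure at x must come from an increment of the remainder H.\<close>
  have "\<exists>y\<in>{a<..<b}. y \<noteq> x \<and> l / 3 * \<bar>y - x\<bar> < \<bar>H y - H x\<bar>" if x: "x \<in> ?B" "x \<notin> T1" for x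
  proof -
    have xab: "a < x" "x < b" using x by auto
    have "\<not> 1 \<le> ennreal (3 / l) * ennreal \<bar>G x - P n x\<bar>" using x by (auto simp: T1_def)
    moreover have "ennreal (3 / l * \<bar>G x - P n x\<bar>) = ennreal (3 / l) * ennreal \<bar>G x - P n x\<bar>"
      using l by (intro ennreal_mult) auto
    ultimately have "ennreal (3 / l * \<bar>G x - P n x\<bar>) < 1" by (simp only: not_le)
    then have GP: "\<bar>G x - P n x\<bar> \<le> l / 3"
      using l by (simp add: ennreal_less_one_iff field_simps)
    have "(Q n has_derivative (\<lambda>h. P n x * h)) (at x)"
      using der[of x n] xab by (simp add: has_field_derivative_def)
    then obtain d where d: "d > 0" "\<And>y. norm (y - x) < d \<Longrightarrow> norm (Q n y - Q n x - P n x * (y - x)) \<le> l / 3 * norm (y - x)"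
      unfolding has_derivative_at_alt using l by (metis divide_pos_pos zero_less_numeral)
    define d' where "d' = min d (min (x - a) (b - x))"
    have "d' > 0" using d xab by (simp add: d'_def)
    then obtain y where y: "\<bar>y - x\<bar> < d'" "\<not> \<bar>g y - g x - G x * (y - x)\<bar> \<le> l * \<bar>y - x\<bar>"
      using x by blast
    have yab: "y \<in> {a<..<b}" using y by (auto simp: d'_def)
    have "y \<noteq> x" using y by auto
    have "\<bar>Q n y - Q n x - P n x * (y - x)\<bar> \<le> l / 3 * \<bar>y - x\<bar>"
      using d(2)[of y] y by (simp add: d'_def)
    moreover have "\<bar>(G x - P n x) * (y - x)\<bar> \<le> l / 3 * \<bar>y - x\<bar>"
      unfolding abs_mult using GP by (intro mult_right_mono) auto
    moreover have "g y - g x - G x * (y - x) = (H y - H x) + (Q n y - Q n x - P n x * (y - x)) - (G x - P n x) * (y - x)"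
      by (simp add: H_def algebra_simps)
    ultimately have "l / 3 * \<bar>y - x\<bar> < \<bar>H y - H x\<bar>" using y(2) by linarith
    then show ?thesis using yab \<open>y \<noteq> x\<close> by blast
  qed
  then obtain Y where Y: "\<And>x. x \<in> ?B - T1 \<Longrightarrow> Y x \<in> {a<..<b} \<and> Y x \<noteq> x \<and> l / 3 * \<bar>Y x - x\<bar> < \<bar>H (Y x) - H x\<bar>"
    by (metis (no_types, lifting) DiffE)
  define r where "r x = \<bar>Y x - x\<bar>" for x
  obtain C where C: "countable C" "C \<subseteq> ?B - T1" "pairwise (\<lambda>i j. disjnt (cball i (r i)) (cball j (r j))) C"
    "?B - T1 \<subseteq> (\<Union>i\<in>C. cball i (5 * r i))"
  proof (rule Vitali_covering_lemma_cballs[where S = "?B - T1" and K = "?B - T1" and a = "\<lambda>x. x" and r = r and B = "b - a"])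
    show "?B - T1 \<subseteq> (\<Union>i\<in>?B - T1. cball i (r i))"
      by (rule subsetI, rule UN_I, assumption) (simp add: r_def)
    show "0 < r i \<and> r i \<le> b - a" if "i \<in> ?B - T1" for i
      using Y[OF that] that by (auto simp: r_def)
  qed (rule that; assumption)
  \<comment> \<open>The interval between x and its bad partner lies in the ball of radius
    \<open>r x\<close>. The Vitali balls are disjoint, so these intervals are too, and their
    increments can be summed.\<close>
  define I where "I x = {min x (Y x)<..<max x (Y x)}" for x
  have fin: "measure lebesgue (\<Union>i\<in>F. cball i (5 * r i)) \<le> 30 / l * \<eta>" if F: "F \<subseteq> C" "finite F" for F
  proof -
    have FB: "x \<in> ?B - T1" if "x \<in> F" for x using F C(2) that by blast
    have "ennreal (\<Sum>x\<in>F. l / 3 * r x) = (\<Sum>x\<in>F. ennreal (l / 3 * r x))"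
      using l by (intro sum_ennreal[symmetric]) (auto simp: r_def)
    also have "\<dots> \<le> (\<Sum>x\<in>F. \<integral>\<^sup>+u. ennreal \<bar>G u - P n u\<bar> * indicator (I x) u \<partial>lebesgue_on {a..b})"
    proof (rule sum_mono)
      fix x assume "x \<in> F"
      note x = FB[OF this]
      have "ennreal (l / 3 * r x) \<le> ennreal \<bar>H (max x (Y x)) - H (min x (Y x))\<bar>"
        using Y[OF x] by (intro ennreal_leI) (auto simp: r_def max_def min_def abs_minus_commute)
      also have "\<dots> \<le> (\<integral>\<^sup>+u. ennreal \<bar>G u - P n u\<bar> * indicator (I x) u \<partial>lebesgue_on {a..b})"
        unfolding H_def I_def using Y[OF x] x by (intro remainder_increment_le) auto
      finally show "ennreal (l / 3 * r x) \<le> (\<integral>\<^sup>+u. ennreal \<bar>G u - P n u\<bar> * indicator (I x) u \<partial>lebesgue_on {a..b})" .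
    qed
    also have "\<dots> \<le> (\<integral>\<^sup>+x. ennreal \<bar>G x - P n x\<bar> \<partial>lebesgue_on {a..b})"
    proof (rule sum_nn_integral_disjoint_le[OF F(2)])
      have "I x \<subseteq> cball x (r x)" for x by (auto simp: I_def r_def dist_real_def)
      moreover have "cball x (r x) \<inter> cball y (r y) = {}" if "x \<in> F" "y \<in> F" "x \<noteq> y" for x y
        using C(3) F(1) that by (auto simp: pairwise_def disjnt_def)
      ultimately show "disjoint_family_on I F" unfolding disjoint_family_on_def by blast
      show "I x \<in> sets (lebesgue_on {a..b})" if "x \<in> F" for x
        unfolding I_def using Y[OF FB[OF that]] FB[OF that] by (intro lebesgue_on_interval_sets) auto
    qed measurable
    also have "\<dots> \<le> ennreal \<eta>" using n by order
    finally have s: "(\<Sum>x\<in>F. l / 3 * r x) \<le> \<eta>" using \<eta> by simp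
    have "measure lebesgue (\<Union>i\<in>F. cball i (5 * r i)) \<le> (\<Sum>i\<in>F. measure lebesgue (cball i (5 * r i)))"
      by (rule measure_UNION_le[OF F(2)]) auto
    \<comment> \<open>A ball of radius 5 r has length 10 r, which is 30 / l times l r / 3.\<close>
    also have "\<dots> = (\<Sum>i\<in>F. 30 / l * (l / 3 * r i))"
      using l by (intro sum.cong refl) (simp add: cball_eq_atLeastAtMost r_def)
    also have "\<dots> = 30 / l * (\<Sum>x\<in>F. l / 3 * r x)" by (rule sum_distrib_left[symmetric])
    also have "\<dots> \<le> 30 / l * \<eta>" using s l by (intro mult_left_mono) auto
    finally show ?thesis .
  qed
  define T2 where "T2 = (\<Union>i\<in>C. cball i (5 * r i))"
  have T2: "T2 \<in> lmeasurable" "measure lebesgue T2 \<le> 30 / l * \<eta>"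
    unfolding T2_def by (rule fmeasurable_UN_bound[OF C(1) _ fin] measure_UN_bound[OF C(1) _ fin]; simp)+
  show "\<exists>T. ?B \<subseteq> T \<and> T \<in> lmeasurable \<and> measure lebesgue T \<le> e"
  proof (intro exI[of _ "T1 \<union> T2"] conjI)
    show "?B \<subseteq> T1 \<union> T2" using C(4) by (auto simp: T2_def)
    show "T1 \<union> T2 \<in> lmeasurable" using T1m T2(1) by (rule fmeasurable.Un)
    have "measure lebesgue (T1 \<union> T2) \<le> measure lebesgue T1 + measure lebesgue T2"
      using T1m T2 by (intro measure_Un_le) auto
    also have "\<dots> \<le> 3 / l * \<eta> + 30 / l * \<eta>" using T1 T2 by linarith
    also have "\<dots> = e / 2" using l by (simp add: \<eta>_def)
    finally show "measure lebesgue (T1 \<union> T2) \<le> e" using e by simp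
  qed
qed

lemma L1_limit_derivative_AE:
  "negligible {x \<in> {a<..<b}. \<not> (g has_real_derivative G x) (at x)}"
proof -
  let ?B = "\<lambda>l. {x \<in> {a<..<b}. \<not> (\<exists>d>0. \<forall>y. \<bar>y - x\<bar> < d \<longrightarrow> \<bar>g y - g x - G x * (y - x)\<bar> \<le> l * \<bar>y - x\<bar>)}"
  have "negligible (\<Union>n. ?B (inverse (real (Suc n))))"
    by (intro negligible_Union_nat bad_points_negligible) simp
  moreover have "{x \<in> {a<..<b}. \<not> (g has_real_derivative G x) (at x)} \<subseteq> (\<Union>n. ?B (inverse (real (Suc n))))"
  proof (rule subsetI, rule ccontr)
    fix x assume x: "x \<in> {x \<in> {a<..<b}. \<not> (g has_real_derivative G x) (at x)}"
      and "x \<notin> (\<Union>n. ?B (inverse (real (Suc n))))"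
    then have d: "\<exists>d>0. \<forall>y. \<bar>y - x\<bar> < d \<longrightarrow> \<bar>g y - g x - G x * (y - x)\<bar> \<le> inverse (real (Suc n)) * \<bar>y - x\<bar>" for n
      by auto
    have "(g has_derivative (\<lambda>h. G x * h)) (at x)"
      unfolding has_derivative_at_alt
    proof (intro conjI allI impI)
      fix e :: real assume "0 < e"
      then obtain n where n: "inverse (real (Suc n)) < e" using reals_Archimedean by blast
      obtain d' where d': "d' > 0" "\<forall>y. \<bar>y - x\<bar> < d' \<longrightarrow> \<bar>g y - g x - G x * (y - x)\<bar> \<le> inverse (real (Suc n)) * \<bar>y - x\<bar>"
        using d by blast
      have "inverse (real (Suc n)) * \<bar>y - x\<bar> \<le> e * \<bar>y - x\<bar>" for y
        using n by (intro mult_right_mono) auto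
      then show "\<exists>d>0. \<forall>y. norm (y - x) < d \<longrightarrow> norm (g y - g x - G x * (y - x)) \<le> e * norm (y - x)"
        using d' by (auto intro!: exI[of _ d'] intro: order_trans)
    qed (rule bounded_linear_mult_right)
    then show False using x by (simp add: has_field_derivative_def)
  qed
  ultimately show ?thesis by (rule negligible_subset)
qed

end

section \<open>Limits of rapidly converging polynomials\<close>

lemma AE_lebesgue_on_unit_I:
  assumes "negligible N" "\<And>x. x \<in> {-1<..<1} \<Longrightarrow> x \<notin> N \<Longrightarrow> P x"
  shows "AE x in lebesgue_on {-1..1::real}. P x"
proof -
  have "negligible (N \<union> {-1, 1::real})" using assms(1) by (intro negligible_Un) auto
  then have "N \<union> {-1, 1} \<in> null_sets lebesgue" by (simp add: negligible_iff_null_sets)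
  then have "AE x in lebesgue. x \<notin> N \<union> {-1, 1}" by (rule AE_not_in)
  then have "AE x in lebesgue. x \<in> {-1..1} \<longrightarrow> P x"
    by (rule eventually_mono) (use assms(2) in force)
  then show ?thesis by (subst AE_restrict_space_iff) auto
qed

lemma AE_unit_interior: "AE x in lebesgue_on {-1..1::real}. x \<in> {-1<..<1}"
  by (rule AE_lebesgue_on_unit_I[OF negligible_empty])

lemma borel_measurable_lebesgue_on_AE:
  fixes f g :: "real \<Rightarrow> real"
  assumes f: "f \<in> borel_measurable (lebesgue_on S)" and S: "S \<in> sets lebesgue"
    and ae: "AE x in lebesgue_on S. f x = g x"
  shows "g \<in> borel_measurable (lebesgue_on S)"
proof -
  have "(\<lambda>x. if x \<in> S then f x else 0) \<in> borel_measurable lebesgue"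
    using f S by (simp add: borel_measurable_if)
  moreover have "AE x in lebesgue. x \<in> S \<longrightarrow> f x = g x"
    using ae S by (subst (asm) AE_restrict_space_iff) auto
  then have "AE x in lebesgue. (if x \<in> S then f x else 0) = (if x \<in> S then g x else 0)"
    by (rule eventually_mono) auto
  ultimately have "(\<lambda>x. if x \<in> S then g x else 0) \<in> borel_measurable lebesgue"
    by (rule borel_measurable_AE)
  then show ?thesis using S by (simp add: borel_measurable_if)
qed

text \<open>The 2 bounds the norm of the constant 1, which is 2^(1/p).\<close>

lemma Lp_norm_bounded:
  assumes p: "1 \<le> p" and f: "f \<in> borel_measurable (lebesgue_on {-1..1})"
    and B: "\<And>x. x \<in> {-1..1} \<Longrightarrow> \<bar>f x\<bar> \<le> B" "0 \<le> B"
  shows "Lp_norm p {-1..1} f \<le> ennreal (2 * B)"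
proof (cases "p = \<infinity>")
  case True
  have "AE x in lebesgue_on {-1..1}. \<bar>f x\<bar> \<le> 2 * B"
    using B by (intro AE_I2) (force simp: space_restrict_space)
  then show ?thesis using Lp_norm_infinity_le_iff[OF f, of "2 * B"] True B by simp
next
  case False
  let ?q = "enn2real p"
  have q: "?q \<ge> 1" using p enn2real_ge_one False by blast
  have "(\<integral>\<^sup>+x. ennreal (\<bar>f x\<bar> powr ?q) \<partial>lebesgue_on {-1..1}) \<le> (\<integral>\<^sup>+x. ennreal (B powr ?q) \<partial>lebesgue_on {-1..1::real})"
    using B q by (intro nn_integral_mono ennreal_leI powr_mono2) (auto simp: space_restrict_space)
  also have "\<dots> = ennreal (B powr ?q * 2)"
    by (simp add: emeasure_restrict_space space_restrict_space ennreal_mult)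
  also have "\<dots> \<le> ennreal ((2 * B) powr ?q)"
  proof (rule ennreal_leI)
    have "(2::real) powr 1 \<le> 2 powr ?q" using q by (intro powr_mono) auto
    then show "B powr ?q * 2 \<le> (2 * B) powr ?q"
      using B mult_right_mono[of 2 "2 powr ?q" "B powr ?q"] by (simp add: powr_mult mult.commute)
  qed
  finally show ?thesis using Lp_norm_finite_le_iff[OF p False, of "2 * B"] B by simp
qed

text \<open>A one-dimensional Sobolev inequality: |u x| is at most |u y| plus the integral of |u'|,
  and this is averaged over y. It turns L_1 bounds on derivatives into uniform bounds.\<close>

lemma abs_le_integral_add_derivative:
  fixes u u' :: "real \<Rightarrow> real"
  assumes ab: "a < b" and x: "x \<in> {a..b}"
    and der: "\<And>y. y \<in> {a..b} \<Longrightarrow> (u has_real_derivative u' y) (at y)"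
    and cu: "continuous_on {a..b} u" and cu': "continuous_on {a..b} u'"
  shows "\<bar>u x\<bar> \<le> integral {a..b} (\<lambda>y. \<bar>u y\<bar>) / (b - a) + integral {a..b} (\<lambda>y. \<bar>u' y\<bar>)"
proof -
  let ?D = "integral {a..b} (\<lambda>y. \<bar>u' y\<bar>)"
  have inc: "\<bar>u z - u y\<bar> \<le> ?D" if "a \<le> y" "y \<le> z" "z \<le> b" for y z
  proof -
    have c: "continuous_on {y..z} u'" using cu' by (rule continuous_on_subset) (use that in auto)
    have "(u' has_integral (u z - u y)) {y..z}"
      by (rule fundamental_theorem_of_calculus)
        (use that in \<open>auto intro!: has_field_derivative_at_within[OF der]
           simp flip: has_real_derivative_iff_has_vector_derivative\<close>)
    then have "\<bar>u z - u y\<bar> = norm (integral {y..z} u')" by (simp add: integral_unique)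
    also have "\<dots> \<le> integral {y..z} (\<lambda>y. \<bar>u' y\<bar>)"
      using c continuous_on_rabs[OF c] by (intro integral_norm_bound_integral integrable_continuous_real) auto
    also have "\<dots> \<le> ?D"
      using that continuous_on_rabs[OF c] continuous_on_rabs[OF cu']
      by (intro integral_subset_le integrable_continuous_real) auto
    finally show ?thesis .
  qed
  have le: "\<bar>u x\<bar> \<le> \<bar>u y\<bar> + ?D" if "y \<in> {a..b}" for y
    using inc[of x y] inc[of y x] that x by (cases "x \<le> y") auto
  have "integral {a..b} (\<lambda>y. \<bar>u x\<bar>) \<le> integral {a..b} (\<lambda>y. \<bar>u y\<bar> + ?D)"
    by (rule integral_le)
      (use le continuous_on_rabs[OF cu] in \<open>auto intro!: integrable_continuous_real continuous_intros\<close>)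
  also have "\<dots> = integral {a..b} (\<lambda>y. \<bar>u y\<bar>) + (b - a) * ?D"
    using ab continuous_on_rabs[OF cu] by (subst integral_add) (auto intro: integrable_continuous_real)
  finally have "(b - a) * \<bar>u x\<bar> \<le> integral {a..b} (\<lambda>y. \<bar>u y\<bar>) + (b - a) * ?D" using ab by simp
  then have "\<bar>u x\<bar> \<le> (integral {a..b} (\<lambda>y. \<bar>u y\<bar>) + (b - a) * ?D) / (b - a)"
    using ab by (simp add: pos_le_divide_eq mult.commute)
  then show ?thesis using ab by (simp add: add_divide_distrib)
qed

section \<open>Absolute continuity and uniqueness of the representative\<close>

lemma absolutely_continuous_on_subset:
  "absolutely_continuous_on S g \<Longrightarrow> T \<subseteq> S \<Longrightarrow> absolutely_continuous_on T g"
  unfolding absolutely_continuous_on_def by (meson order_trans)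

lemma absolutely_continuous_on_cong:
  assumes "absolutely_continuous_on {a..b} g" "\<And>x. x \<in> {a..b} \<Longrightarrow> g x = h x"
  shows "absolutely_continuous_on {a..b} h"
  unfolding absolutely_continuous_on_def
proof (intro allI impI)
  fix e :: real assume "0 < e"
  then obtain \<delta> where \<delta>: "\<delta> > 0" "\<And>d. d division_of \<Union>d \<and> \<Union>d \<subseteq> {a..b} \<and> (\<Sum>K\<in>d. Sup K - Inf K) < \<delta>
      \<Longrightarrow> (\<Sum>K\<in>d. \<bar>g (Sup K) - g (Inf K)\<bar>) < e"
    using assms(1) unfolding absolutely_continuous_on_def by meson
  show "\<exists>\<delta>>0. \<forall>d. d division_of \<Union>d \<and> \<Union>d \<subseteq> {a..b} \<and> (\<Sum>K\<in>d. Sup K - Inf K) < \<delta>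
      \<longrightarrow> (\<Sum>K\<in>d. \<bar>h (Sup K) - h (Inf K)\<bar>) < e"
  proof (intro exI[of _ \<delta>] conjI allI impI \<delta>(1))
    fix d assume d: "d division_of \<Union>d \<and> \<Union>d \<subseteq> {a..b} \<and> (\<Sum>K\<in>d. Sup K - Inf K) < \<delta>"
    have "Sup K \<in> {a..b} \<and> Inf K \<in> {a..b}" if K: "K \<in> d" for K
    proof -
      have dd: "d division_of \<Union>d" using d by simp
      obtain u v where "K = cbox u v" using division_ofD(4)[OF dd K] by auto
      moreover have "K \<noteq> {}" by (rule division_ofD(3)[OF dd K])
      moreover have "K \<subseteq> {a..b}" using d K by auto
      ultimately show ?thesis by auto
    qed
    then have "(\<Sum>K\<in>d. \<bar>h (Sup K) - h (Inf K)\<bar>) = (\<Sum>K\<in>d. \<bar>g (Sup K) - g (Inf K)\<bar>)"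
      using assms(2) by (intro sum.cong) auto
    then show "(\<Sum>K\<in>d. \<bar>h (Sup K) - h (Inf K)\<bar>) < e" using \<delta>(2)[OF d] by simp
  qed
qed

lemma absolutely_continuous_imp_continuous_on:
  assumes "absolutely_continuous_on {a..b::real} g"
  shows "continuous_on {a..b} g"
  unfolding continuous_on_iff
proof (intro ballI allI impI)
  fix x e :: real assume x: "x \<in> {a..b}" and "0 < e"
  then obtain \<delta> where \<delta>: "\<delta> > 0" "\<And>d. d division_of \<Union>d \<and> \<Union>d \<subseteq> {a..b} \<and> (\<Sum>K\<in>d. Sup K - Inf K) < \<delta>
      \<Longrightarrow> (\<Sum>K\<in>d. \<bar>g (Sup K) - g (Inf K)\<bar>) < e"
    using assms unfolding absolutely_continuous_on_def by meson
  have *: "\<bar>g v - g u\<bar> < e" if "u \<le> v" "u \<in> {a..b}" "v \<in> {a..b}" "v - u < \<delta>" for u v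
  proof -
    have "{{u..v}} division_of \<Union>{{u..v}}"
      using that division_of_self[of u v] by (simp add: box_real)
    then show ?thesis using \<delta>(2)[of "{{u..v}}"] that by auto
  qed
  show "\<exists>d>0. \<forall>x'\<in>{a..b}. dist x' x < d \<longrightarrow> dist (g x') (g x) < e"
  proof (intro exI[of _ \<delta>] conjI ballI impI \<delta>(1))
    fix y assume "y \<in> {a..b}" "dist y x < \<delta>"
    then show "dist (g y) (g x) < e"
      using *[of x y] *[of y x] x by (cases "x \<le> y") (auto simp: dist_real_def abs_minus_commute)
  qed
qed

lemma B_space_continuous_on:
  assumes r: "1 \<le> r" and g: "g \<in> B_space p r"
  shows "continuous_on {-1<..<1} g"
proof (cases "r = 1")
  case True
  have "locally_absolutely_continuous g" using g True by (simp add: B_space_def)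
  then have c: "continuous_on {a..b} g" if "-1 < a" "a < b" "b < 1" for a b
    using that absolutely_continuous_imp_continuous_on by (simp add: locally_absolutely_continuous_def)
  show ?thesis
    unfolding continuous_on_eq_continuous_at[OF open_greaterThanLessThan]
  proof
    fix x :: real assume x: "x \<in> {-1<..<1}"
    have "continuous_on {(x - 1) / 2..(x + 1) / 2} g" using x by (intro c) auto
    then show "isCont g x" by (rule continuous_on_interior) (use x in auto)
  qed
next
  case False
  then have "g field_differentiable at x" if "x \<in> {-1<..<1}" for x
    using g r that by (auto simp: B_space_def dest!: spec[of _ 0])
  then show ?thesis
    by (meson continuous_at_imp_continuous_on field_differentiable_imp_continuous_at)
qed

text \<open>Both functions are continuous inside, so agreement almost everywhere is agreement, and
  then all values of \<open>deriv\<close> coincide, including those at points without an r-th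
  derivative. This allows the final result to speak about every representative.\<close>

lemma B_space_AE_eq_imp_eq:
  assumes r: "1 \<le> r" and g: "g \<in> B_space p r" and h: "h \<in> B_space p r"
    and ae: "AE x in lebesgue_on {-1..1}. g x = h x" and x: "x \<in> {-1<..<1}"
  shows "(deriv ^^ j) g x = (deriv ^^ j) h x"
proof -
  let ?N = "{x \<in> {-1<..<1}. g x - h x \<noteq> 0}"
  have "AE x in lebesgue. x \<in> {-1..1} \<longrightarrow> g x = h x"
    using ae by (subst (asm) AE_restrict_space_iff) auto
  then obtain N where N: "N \<in> null_sets lebesgue" "{x. \<not> (x \<in> {-1..1} \<longrightarrow> g x = h x)} \<subseteq> N"
    by (auto elim: AE_E3 simp: eventually_ae_filter)
  have "negligible ?N"
    by (rule negligible_subset[of N]) (use N in \<open>auto simp: negligible_iff_null_sets\<close>)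
  moreover have "open ?N"
  proof -
    have "continuous_on {-1<..<1} (\<lambda>x. g x - h x)"
      by (intro continuous_on_diff B_space_continuous_on[OF r g] B_space_continuous_on[OF r h])
    then have "open ({-1<..<1} \<inter> (\<lambda>x. g x - h x) -` (- {0}))"
      by (rule continuous_open_preimage) auto
    moreover have "{-1<..<1} \<inter> (\<lambda>x. g x - h x) -` (- {0}) = ?N" by auto
    ultimately show ?thesis by simp
  qed
  ultimately have "?N = {}" using open_not_negligible by blast
  then have eq: "g x = h x" if "x \<in> {-1<..<1}" for x using that by auto
  have "\<forall>x\<in>{-1<..<1}. (deriv ^^ j) g x = (deriv ^^ j) h x"
  proof (induction j)
    case (Suc j)
    show ?case
    proof
      fix x :: real assume "x \<in> {-1<..<1}"
      then have "eventually (\<lambda>y. y \<in> {-1<..<1}) (nhds x)" by (intro eventually_nhds_in_open) auto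
      then have "eventually (\<lambda>y. (deriv ^^ j) g y = (deriv ^^ j) h y) (nhds x)"
        by (rule eventually_mono) (use Suc in blast)
      then show "(deriv ^^ Suc j) g x = (deriv ^^ Suc j) h x"
        by (simp add: deriv_cong_ev)
    qed
  qed (use eq in auto)
  then show ?thesis using x by blast
qed

lemma field_differentiable_higher_pderiv:
  fixes R :: "real poly"
  shows "(poly ((pderiv ^^ i) R) has_real_derivative poly ((pderiv ^^ Suc i) R) x) (at x within S)"
  by (auto intro: poly_DERIV has_field_derivative_at_within)

section \<open>Termwise differentiation of the telescoping series\<close>

context
  fixes p :: ennreal and r :: nat and f :: "real \<Rightarrow> real" and R :: "nat \<Rightarrow> real poly"
    and b :: "nat \<Rightarrow> real" and J :: nat
  assumes p: "1 \<le> p" and r: "1 \<le> r"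
    and fm: "f \<in> borel_measurable (lebesgue_on {-1..1})"
    and deg: "\<And>j. degree (R j) < 2 ^ (J + j)"
    and R: "\<And>j. Lp_norm p {-1..1} (\<lambda>x. f x - poly (R j) x) \<le> ennreal (b j)"
    and b: "\<And>j. 0 \<le> b j" "\<And>j. b (Suc j) \<le> b j"
    and summ: "summable (\<lambda>j. (2 ^ (J + j)) ^ r * b j)"
begin

text \<open>The difference \<open>Q j\<close> has degree below 2^(J+j+1) and norm at most
  \<open>2 * b j\<close>. Bernstein's inequality contributes the base 4 * 2^(J+j+1) = 8 * 2^(J+j),
  so \<open>\<beta> j\<close> bounds its weighted derivatives of all orders up to r.\<close>

private definition "\<beta> j = 2 * 8 ^ r * ((2 ^ (J + j)) ^ r * b j)"

private definition "Q j = R (Suc j) - R j"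

private lemma \<beta>: "summable \<beta>" "0 \<le> \<beta> j"
  unfolding \<beta>_def[abs_def] using summ b by (auto intro!: summable_mult)

private lemma summable_b: "summable b"
proof (rule summable_comparison_test'[OF summ])
  fix j
  have "1 * b j \<le> (2 ^ (J + j)) ^ r * b j" using b by (intro mult_right_mono one_le_power) auto
  then show "norm (b j) \<le> (2 ^ (J + j)) ^ r * b j" using b by simp
qed

private lemma measurable_weighted:
  "(\<lambda>x. varphi x ^ i * poly q x) \<in> borel_measurable (lebesgue_on {-1..1})"
  by (intro continuous_on_imp_measurable_lebesgue_on continuous_intros) auto

private lemma norm_Q: "Lp_norm p {-1..1} (poly (Q j)) \<le> ennreal (2 * b j)"
proof -
  have m: "(\<lambda>x. f x - poly (R j) x) \<in> borel_measurable (lebesgue_on {-1..1})" for j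
    by (intro borel_measurable_diff fm continuous_on_imp_measurable_lebesgue_on continuous_intros) auto
  have "Lp_norm p {-1..1} (\<lambda>x. (f x - poly (R j) x) + (-1) * (f x - poly (R (Suc j)) x)) \<le> ennreal (b j + \<bar>-1\<bar> * b (Suc j))"
    by (intro Lp_norm_triangle p m R b Lp_norm_cmult_le borel_measurable_times borel_measurable_const) (use b in auto)
  also have "(\<lambda>x. (f x - poly (R j) x) + (-1) * (f x - poly (R (Suc j)) x)) = poly (Q j)"
    by (auto simp: Q_def)
  also have "ennreal (b j + \<bar>-1\<bar> * b (Suc j)) \<le> ennreal (2 * b j)"
    using b(2)[of j] by (intro ennreal_leI) auto
  finally show ?thesis .
qed

private lemma deg_Q: "degree (Q j) < 2 ^ Suc (J + j)"
proof -
  have "degree (Q j) \<le> max (degree (R (Suc j))) (degree (R j))" unfolding Q_def by (rule degree_diff_le_max)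
  also have "\<dots> < 2 ^ Suc (J + j)"
    using deg[of "Suc j"] deg[of j] by auto
  finally show ?thesis .
qed

private lemma norm_Q_deriv:
  assumes i: "i \<le> r"
  shows "Lp_norm p {-1..1} (\<lambda>x. varphi x ^ i * poly ((pderiv ^^ i) (Q j)) x) \<le> ennreal (\<beta> j)"
proof -
  have "Lp_norm p {-1..1} (\<lambda>x. varphi x ^ i * poly ((pderiv ^^ i) (Q j)) x) \<le> ennreal ((4 * real (2 ^ Suc (J + j))) ^ i * (2 * b j))"
    using b by (intro Lp_bernstein p deg_Q norm_Q) auto
  also have "\<dots> \<le> ennreal (\<beta> j)"
  proof (rule ennreal_leI)
    have "(1::real) \<le> 2 ^ (J + j)" by (rule one_le_power) simp
    then have "(8 * (2::real) ^ (J + j)) ^ i \<le> (8 * 2 ^ (J + j)) ^ r"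
      using i by (intro power_increasing) linarith+
    then have "(8 * (2::real) ^ (J + j)) ^ i * (2 * b j) \<le> (8 * 2 ^ (J + j)) ^ r * (2 * b j)"
      using b by (intro mult_right_mono) auto
    then show "(4 * real (2 ^ Suc (J + j))) ^ i * (2 * b j) \<le> \<beta> j"
      by (simp add: \<beta>_def power_mult_distrib mult_ac)
  qed
  finally show ?thesis .
qed

text \<open>Away from the end points the weight can be divided out: on [-s, s] it is at least
  \<open>varphi s\<close>, and as this is at most 1, the exponent i may be raised to r.\<close>

private lemma local_L1:
  assumes s: "0 < s" "s < 1" and u: "continuous_on {-1..1} u" and i: "i \<le> r"
    and B: "(\<integral>\<^sup>+x. ennreal \<bar>varphi x ^ i * u x\<bar> \<partial>lebesgue_on {-1..1}) \<le> ennreal B" "0 \<le> B"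
  shows "integral {-s..s} (\<lambda>x. \<bar>u x\<bar>) \<le> B / varphi s ^ r"
proof -
  have s': "varphi s > 0" "varphi s \<le> 1" using s varphi_pos[of s] by (auto simp: varphi_def)
  define C where "C = 1 / varphi s ^ r"
  have C: "C \<ge> 0" using s' by (simp add: C_def)
  have sub: "{-s..s} \<subseteq> {-1..1}" using s by auto
  have cu: "continuous_on {-s..s} u" using u sub by (rule continuous_on_subset)
  have le: "\<bar>u x\<bar> \<le> C * \<bar>varphi x ^ i * u x\<bar>" if x: "x \<in> {-s..s}" for x
  proof -
    have "x\<^sup>2 \<le> s\<^sup>2" using x s by (simp add: abs_le_square_iff[symmetric] abs_le_iff)
    then have ph: "varphi s \<le> varphi x" by (simp add: varphi_def)
    have "varphi s ^ r \<le> varphi s ^ i" using i s' by (intro power_decreasing) auto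
    also have "\<dots> \<le> varphi x ^ i" using ph s' by (intro power_mono) auto
    finally have "varphi s ^ r * \<bar>u x\<bar> \<le> varphi x ^ i * \<bar>u x\<bar>" by (rule mult_right_mono) simp
    moreover have "varphi x \<ge> 0" using ph s' by linarith
    ultimately show ?thesis using s' by (simp add: C_def field_simps abs_mult)
  qed
  have "ennreal (integral {-s..s} (\<lambda>x. \<bar>u x\<bar>)) = (\<integral>\<^sup>+x. ennreal \<bar>u x\<bar> \<partial>lebesgue_on {-s..s})"
    using continuous_on_rabs[OF cu]
    by (intro nn_integral_lebesgue_on_has_integral[symmetric] integrable_integral integrable_continuous_real) auto
  also have "\<dots> \<le> (\<integral>\<^sup>+x. ennreal C * ennreal \<bar>varphi x ^ i * u x\<bar> \<partial>lebesgue_on {-s..s})"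
    using le C by (intro nn_integral_mono) (auto simp: space_restrict_space ennreal_mult[symmetric] intro!: ennreal_leI)
  also have "\<dots> \<le> (\<integral>\<^sup>+x. ennreal C * ennreal \<bar>varphi x ^ i * u x\<bar> \<partial>lebesgue_on {-1..1})"
    by (rule nn_integral_lebesgue_on_mono[OF sub]) auto
  also have "\<dots> = ennreal C * (\<integral>\<^sup>+x. ennreal \<bar>varphi x ^ i * u x\<bar> \<partial>lebesgue_on {-1..1})"
  proof (rule nn_integral_cmult)
    have "(\<lambda>x. \<bar>varphi x ^ i * u x\<bar>) \<in> borel_measurable (lebesgue_on {-1..1})"
      by (intro continuous_on_imp_measurable_lebesgue_on continuous_intros u) auto
    then show "(\<lambda>x. ennreal \<bar>varphi x ^ i * u x\<bar>) \<in> borel_measurable (lebesgue_on {-1..1})" by simp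
  qed
  also have "\<dots> \<le> ennreal C * ennreal B" using B by (intro mult_left_mono) auto
  also have "\<dots> = ennreal (C * B)" using C B by (simp add: ennreal_mult)
  finally show ?thesis using C B by (simp add: C_def)
qed

private lemma local_bound:
  assumes s: "0 < s" "s < 1" and i: "i < r" and x: "x \<in> {-s..s}"
  shows "\<bar>poly ((pderiv ^^ i) (Q j)) x\<bar> \<le> 3 / varphi s ^ r * (1 / (2 * s) + 1) * \<beta> j"
proof -
  have L: "integral {-s..s} (\<lambda>x. \<bar>poly ((pderiv ^^ k) (Q j)) x\<bar>) \<le> 3 * \<beta> j / varphi s ^ r" if "k \<le> r" for k
    by (rule local_L1[OF s _ that])
      (use \<beta>(2)[of j] in \<open>auto intro!: continuous_intros Lp_norm_one_le[OF p measurable_weighted norm_Q_deriv[OF that]]\<close>)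
  have "\<bar>poly ((pderiv ^^ i) (Q j)) x\<bar> \<le> integral {-s..s} (\<lambda>x. \<bar>poly ((pderiv ^^ i) (Q j)) x\<bar>) / (s - (-s))
    + integral {-s..s} (\<lambda>x. \<bar>poly ((pderiv ^^ Suc i) (Q j)) x\<bar>)"
    by (rule abs_le_integral_add_derivative)
      (use s x in \<open>auto intro!: field_differentiable_higher_pderiv continuous_intros simp del: funpow.simps\<close>)
  also have "\<dots> \<le> (3 * \<beta> j / varphi s ^ r) / (s - (-s)) + 3 * \<beta> j / varphi s ^ r"
    using s i by (intro add_mono divide_right_mono L) auto
  also have "\<dots> = 3 / varphi s ^ r * (1 / (2 * s) + 1) * \<beta> j"
    by (simp add: algebra_simps)
  finally show ?thesis .
qed

text \<open>Candidate for the i-th derivative of the limit. For i < r the series converges at every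
  inner point, for i = r almost everywhere, through the weighted L_p norms.\<close>

private definition "S i x = poly ((pderiv ^^ i) (R 0)) x + (\<Sum>j. poly ((pderiv ^^ i) (Q j)) x)"

private lemma R_eq_sum:
  "poly ((pderiv ^^ i) (R n)) x = poly ((pderiv ^^ i) (R 0)) x + (\<Sum>j<n. poly ((pderiv ^^ i) (Q j)) x)"
proof (induction n)
  case (Suc n)
  have "R (Suc n) = R n + Q n" by (simp add: Q_def)
  then show ?case using Suc by (simp add: higher_pderiv_add)
qed simp

private lemma inner_radius:
  assumes "x \<in> {-1<..<1::real}"
  obtains s where "0 < s" "s < 1" "x \<in> {-s<..<s}"
  by (rule that[of "(1 + \<bar>x\<bar>) / 2"]) (use assms in \<open>auto simp: abs_if field_simps\<close>)

private lemma summable_Q: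
  assumes "i < r" "x \<in> {-1<..<1}"
  shows "summable (\<lambda>j. poly ((pderiv ^^ i) (Q j)) x)"
proof -
  obtain s where s: "0 < s" "s < 1" "x \<in> {-s<..<s}" using inner_radius[OF assms(2)] .
  show ?thesis
    by (rule summable_comparison_test'[OF summable_mult[OF \<beta>(1), of "3 / varphi s ^ r * (1 / (2 * s) + 1)"]])
      (use local_bound[OF s(1,2) assms(1), of x] s(3) in auto)
qed

private lemma R_tendsto_S:
  assumes "i < r" "x \<in> {-1<..<1}"
  shows "(\<lambda>n. poly ((pderiv ^^ i) (R n)) x) \<longlonglongrightarrow> S i x"
proof -
  have "(\<lambda>n. poly ((pderiv ^^ i) (R 0)) x + (\<Sum>j<n. poly ((pderiv ^^ i) (Q j)) x)) \<longlonglongrightarrow> S i x"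
    unfolding S_def by (intro tendsto_intros summable_LIMSEQ summable_Q assms)
  then show ?thesis by (simp only: R_eq_sum[of i _ x, symmetric])
qed

text \<open>Stops at order r - 1: the local uniform bound uses one derivative more than it
  estimates, and Bernstein's inequality is summable only up to order r.\<close>

private lemma S_has_derivative:
  assumes i: "Suc i < r" and x: "x \<in> {-1<..<1}"
  shows "(S i has_real_derivative S (Suc i) x) (at x)"
proof -
  obtain s where s: "0 < s" "s < 1" "x \<in> {-s<..<s}" using inner_radius[OF x] .
  have "((\<lambda>x. \<Sum>j. poly ((pderiv ^^ i) (Q j)) x) has_field_derivative (\<Sum>j. poly ((pderiv ^^ Suc i) (Q j)) x)) (at x)"
  proof (rule has_field_derivative_series'(2)[of "{-s..s}"])
    show "uniformly_convergent_on {-s..s} (\<lambda>n x. \<Sum>j<n. poly ((pderiv ^^ Suc i) (Q j)) x)"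
      by (rule Weierstrass_m_test'[OF _ summable_mult[OF \<beta>(1), of "3 / varphi s ^ r * (1 / (2 * s) + 1)"]])
        (use local_bound[OF s(1,2) i] in auto)
    show "summable (\<lambda>j. poly ((pderiv ^^ i) (Q j)) x)" using summable_Q[of i x] i x by simp
  qed (use s field_differentiable_higher_pderiv in auto)
  then show ?thesis
    unfolding S_def[abs_def] by (intro DERIV_add field_differentiable_higher_pderiv)
qed

private lemma higher_deriv_S:
  "i < r \<Longrightarrow> x \<in> {-1<..<1} \<Longrightarrow> (deriv ^^ i) (S 0) x = S i x"
proof (induction i arbitrary: x)
  case (Suc i)
  have "eventually (\<lambda>y. y \<in> {-1<..<1}) (nhds x)" using Suc.prems by (intro eventually_nhds_in_open) auto
  then have "eventually (\<lambda>y. (deriv ^^ i) (S 0) y = S i y) (nhds x)"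
    by (rule eventually_mono) (use Suc in auto)
  then have "deriv ((deriv ^^ i) (S 0)) x = deriv (S i) x" by (simp add: deriv_cong_ev)
  also have "\<dots> = S (Suc i) x" by (rule DERIV_imp_deriv[OF S_has_derivative[OF Suc.prems]])
  finally show ?case by simp
qed simp

private lemma measurable_S: "S r \<in> borel_measurable (lebesgue_on {-1..1})"
  unfolding S_def[abs_def]
  by (intro borel_measurable_add borel_measurable_suminf continuous_on_imp_measurable_lebesgue_on continuous_intros) auto

private lemma norm_S_remainder:
  "Lp_norm p {-1..1} (\<lambda>x. (S r x - poly ((pderiv ^^ r) (R m)) x) * varphi x ^ r) \<le> ennreal (\<Sum>j. \<beta> (j + m))"
proof -
  define q where "q j x = varphi x ^ r * poly ((pderiv ^^ r) (Q (j + m))) x" for j x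
  have s\<beta>: "summable (\<lambda>j. \<beta> (j + m))" using \<beta>(1) by (simp add: summable_iff_shift)
  have q: "q j \<in> borel_measurable (lebesgue_on {-1..1})" "Lp_norm p {-1..1} (q j) \<le> ennreal (\<beta> (j + m))" for j
    unfolding q_def[abs_def] by (rule measurable_weighted, rule norm_Q_deriv, rule order_refl)
  note ser = Lp_norm_series[OF p q \<beta>(2) s\<beta>]
  have "AE x in lebesgue_on {-1..1}. (S r x - poly ((pderiv ^^ r) (R m)) x) * varphi x ^ r = (\<Sum>j. q j x)"
    using ser(1) AE_unit_interior
  proof eventually_elim
    case (elim x)
    then have ph: "varphi x > 0" by (intro varphi_pos) auto
    have sq: "summable (\<lambda>j. q j x)" using elim(1) by (rule summable_rabs_cancel)
    then have "summable (\<lambda>j. (1 / varphi x ^ r) * q j x)" by (rule summable_mult)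
    then have sm: "summable (\<lambda>j. poly ((pderiv ^^ r) (Q (j + m))) x)" using ph by (simp add: q_def)
    then have "summable (\<lambda>j. poly ((pderiv ^^ r) (Q j)) x)" by (subst (asm) summable_iff_shift)
    then have "(\<Sum>j. poly ((pderiv ^^ r) (Q j)) x) = (\<Sum>j. poly ((pderiv ^^ r) (Q (j + m))) x) + (\<Sum>j<m. poly ((pderiv ^^ r) (Q j)) x)"
      by (rule suminf_split_initial_segment)
    then have "S r x - poly ((pderiv ^^ r) (R m)) x = (\<Sum>j. poly ((pderiv ^^ r) (Q (j + m))) x)"
      unfolding R_eq_sum[of r m x] S_def by simp
    then show ?case using suminf_mult[OF sm, of "varphi x ^ r"] by (simp add: q_def mult.commute)
  qed
  then have "Lp_norm p {-1..1} (\<lambda>x. (S r x - poly ((pderiv ^^ r) (R m)) x) * varphi x ^ r) = Lp_norm p {-1..1} (\<lambda>x. \<Sum>j. q j x)"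
    by (intro Lp_norm_cong_AE p borel_measurable_times borel_measurable_diff measurable_S borel_measurable_suminf q
        continuous_on_imp_measurable_lebesgue_on continuous_intros) auto
  then show ?thesis using ser(2) by simp
qed

private lemma S_L1_local:
  assumes s: "0 < s" "s < 1"
  shows "(\<lambda>n. \<integral>\<^sup>+x. ennreal \<bar>S r x - poly ((pderiv ^^ r) (R n)) x\<bar> \<partial>lebesgue_on {-s..s}) \<longlonglongrightarrow> 0"
proof -
  define C where "C = 1 / varphi s ^ r"
  have s': "varphi s > 0" using s by (intro varphi_pos) auto
  have C: "C \<ge> 0" using s' by (simp add: C_def)
  have sub: "{-s..s} \<subseteq> {-1..1}" using s by auto
  have \<beta>0: "0 \<le> (\<Sum>j. \<beta> (j + n))" for n
    using \<beta> by (intro suminf_nonneg) (auto simp: summable_iff_shift)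
  have m: "(\<lambda>x. (S r x - poly ((pderiv ^^ r) (R n)) x) * varphi x ^ r) \<in> borel_measurable (lebesgue_on {-1..1})" for n
    by (intro borel_measurable_times borel_measurable_diff measurable_S continuous_on_imp_measurable_lebesgue_on continuous_intros) auto
  have le: "(\<integral>\<^sup>+x. ennreal \<bar>S r x - poly ((pderiv ^^ r) (R n)) x\<bar> \<partial>lebesgue_on {-s..s}) \<le> ennreal (C * (3 * (\<Sum>j. \<beta> (j + n))))" for n
  proof -
    have "(\<integral>\<^sup>+x. ennreal \<bar>S r x - poly ((pderiv ^^ r) (R n)) x\<bar> \<partial>lebesgue_on {-s..s})
      \<le> (\<integral>\<^sup>+x. ennreal C * ennreal \<bar>(S r x - poly ((pderiv ^^ r) (R n)) x) * varphi x ^ r\<bar> \<partial>lebesgue_on {-s..s})"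
    proof (rule nn_integral_mono)
      fix x assume "x \<in> space (lebesgue_on {-s..s})"
      then have "x \<in> {-s..s}" by (simp add: space_restrict_space)
      then have "x\<^sup>2 \<le> s\<^sup>2" using s by (simp add: abs_le_square_iff[symmetric] abs_le_iff)
      then have "varphi s ^ r \<le> varphi x ^ r" using s' by (intro power_mono) (auto simp: varphi_def)
      then have "1 \<le> C * \<bar>varphi x ^ r\<bar>" using s' by (simp add: C_def)
      then have "\<bar>S r x - poly ((pderiv ^^ r) (R n)) x\<bar> * 1 \<le> \<bar>S r x - poly ((pderiv ^^ r) (R n)) x\<bar> * (C * \<bar>varphi x ^ r\<bar>)"
        by (intro mult_left_mono) auto
      then show "ennreal \<bar>S r x - poly ((pderiv ^^ r) (R n)) x\<bar> \<le> ennreal C * ennreal \<bar>(S r x - poly ((pderiv ^^ r) (R n)) x) * varphi x ^ r\<bar>"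
        using C by (simp add: ennreal_mult[symmetric] abs_mult mult_ac ennreal_leI)
    qed
    also have "\<dots> \<le> (\<integral>\<^sup>+x. ennreal C * ennreal \<bar>(S r x - poly ((pderiv ^^ r) (R n)) x) * varphi x ^ r\<bar> \<partial>lebesgue_on {-1..1})"
      by (rule nn_integral_lebesgue_on_mono[OF sub]) auto
    also have "\<dots> = ennreal C * (\<integral>\<^sup>+x. ennreal \<bar>(S r x - poly ((pderiv ^^ r) (R n)) x) * varphi x ^ r\<bar> \<partial>lebesgue_on {-1..1})"
      using m by (intro nn_integral_cmult) auto
    also have "\<dots> \<le> ennreal C * ennreal (3 * (\<Sum>j. \<beta> (j + n)))"
      by (intro mult_left_mono Lp_norm_one_le[OF p m norm_S_remainder \<beta>0]) simp
    also have "\<dots> = ennreal (C * (3 * (\<Sum>j. \<beta> (j + n))))" using C \<beta>0 by (simp add: ennreal_mult)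
    finally show ?thesis .
  qed
  have "(\<lambda>n. \<Sum>j. \<beta> (j + n)) \<longlonglongrightarrow> 0" by (rule suminf_exist_split2[OF \<beta>(1)])
  then have "(\<lambda>n. ennreal (C * (3 * (\<Sum>j. \<beta> (j + n))))) \<longlonglongrightarrow> ennreal (C * (3 * 0))"
    by (intro tendsto_intros)
  then have "(\<lambda>n. ennreal (C * (3 * (\<Sum>j. \<beta> (j + n))))) \<longlonglongrightarrow> 0" by simp
  then show ?thesis
    by (rule tendsto_sandwich[OF _ _ tendsto_const, rotated 2]) (use le in auto)
qed

private lemma S_AC:
  assumes s: "0 < s" "s < 1"
  shows "absolutely_continuous_on {-s..s} (S (r - 1))"
    and "negligible {x \<in> {-s<..<s}. \<not> (S (r - 1) has_real_derivative S r x) (at x)}"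
proof -
  have m: "S r \<in> borel_measurable (lebesgue_on {-s..s})"
    using measurable_S by (rule measurable_restrict_mono) (use s in auto)
  have d: "(poly ((pderiv ^^ (r - 1)) (R n)) has_real_derivative poly ((pderiv ^^ r) (R n)) x) (at x)" for n x
    using field_differentiable_higher_pderiv[of "r - 1" "R n" x UNIV] r by simp
  have c: "continuous_on {-s..s} (poly ((pderiv ^^ r) (R n)))" for n by (intro continuous_intros)
  have l: "(\<lambda>n. poly ((pderiv ^^ (r - 1)) (R n)) x) \<longlonglongrightarrow> S (r - 1) x" if "x \<in> {-s..s}" for x
    using that s r by (intro R_tendsto_S) auto
  show "absolutely_continuous_on {-s..s} (S (r - 1))"
    by (rule absolutely_continuous_on_L1_limit[OF m d c S_L1_local[OF s] l])
  show "negligible {x \<in> {-s<..<s}. \<not> (S (r - 1) has_real_derivative S r x) (at x)}"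
    by (rule L1_limit_derivative_AE[OF m d c S_L1_local[OF s] l])
qed

text \<open>Derivatives below order r come from uniform convergence on compact intervals, absolute
  continuity and the r-th derivative from convergence in L_1. The tail bound is the distance of the
  r-th derivative to that of \<open>R m\<close>, on which the estimate of the modulus rests.\<close>

lemma derivative_limit_in_B_space:
  "\<exists>g\<in>B_space p r. (AE x in lebesgue_on {-1..1}. g x = f x) \<and>
    (deriv ^^ r) g \<in> borel_measurable (lebesgue_on {-1..1}) \<and>
    (\<forall>m. Lp_norm p {-1..1} (\<lambda>x. ((deriv ^^ r) g x - poly ((pderiv ^^ r) (R m)) x) * varphi x ^ r)
      \<le> ennreal (2 * 8 ^ r * (\<Sum>j. (2 ^ (J + (j + m))) ^ r * b (j + m))))"
proof -
  define g where "g = S 0"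
  define F where "F = (deriv ^^ r) g"
  have r': "r - 1 < r" "Suc (r - 1) = r" using r by auto
  have dg: "(deriv ^^ i) g x = S i x" if "i < r" "x \<in> {-1<..<1}" for i x
    using higher_deriv_S[OF that] by (simp add: g_def)
  define N where "N = {x \<in> {-1<..<1}. \<not> (S (r - 1) has_real_derivative S r x) (at x)}"
  have N: "negligible N"
  proof (rule negligible_subset)
    \<comment> \<open>Countably many compactly contained intervals exhaust (-1, 1).\<close>
    show "negligible (\<Union>n. {x \<in> {-(1 - 1 / real (n + 2))<..<1 - 1 / real (n + 2)}. \<not> (S (r - 1) has_real_derivative S r x) (at x)})"
      by (intro negligible_Union_nat S_AC(2)) auto
    show "N \<subseteq> (\<Union>n. {x \<in> {-(1 - 1 / real (n + 2))<..<1 - 1 / real (n + 2)}. \<not> (S (r - 1) has_real_derivative S r x) (at x)})"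
    proof
      fix x assume x: "x \<in> N"
      then have "0 < 1 - \<bar>x\<bar>" by (auto simp: N_def)
      then obtain n where n: "inverse (real (Suc n)) < 1 - \<bar>x\<bar>" using reals_Archimedean by blast
      have "1 / real (n + 2) \<le> inverse (real (Suc n))" by (simp add: field_simps)
      then have "x \<in> {-(1 - 1 / real (n + 2))<..<1 - 1 / real (n + 2)}" using n by auto
      then show "x \<in> (\<Union>n. {x \<in> {-(1 - 1 / real (n + 2))<..<1 - 1 / real (n + 2)}. \<not> (S (r - 1) has_real_derivative S r x) (at x)})"
        using x unfolding N_def by blast
    qed
  qed
  have ev: "eventually (\<lambda>y. (deriv ^^ i) g y = S i y) (nhds x)" if "i < r" "x \<in> {-1<..<1}" for i x
    using eventually_nhds_in_open[of "{-1<..<1}" x] that by (auto elim!: eventually_mono simp: dg)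
  have F_eq: "AE x in lebesgue_on {-1..1}. S r x = F x"
  proof (rule AE_lebesgue_on_unit_I[OF N])
    fix x :: real assume x: "x \<in> {-1<..<1}" "x \<notin> N"
    then have "deriv (S (r - 1)) x = S r x" by (auto simp: N_def intro: DERIV_imp_deriv)
    moreover have "F x = deriv ((deriv ^^ (r - 1)) g) x" unfolding F_def using r'(2) by (metis funpow.simps(2) o_apply)
    ultimately show "S r x = F x" using deriv_cong_ev[OF ev[OF r'(1) x(1)] refl] by simp
  qed
  have mF: "F \<in> borel_measurable (lebesgue_on {-1..1})"
    by (rule borel_measurable_lebesgue_on_AE[OF measurable_S _ F_eq]) simp
  have mcomb: "(\<lambda>x. (h x - poly q x) * varphi x ^ r) \<in> borel_measurable (lebesgue_on {-1..1})"
    if "h \<in> borel_measurable (lebesgue_on {-1..1})" for h q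
    by (intro borel_measurable_times borel_measurable_diff that continuous_on_imp_measurable_lebesgue_on continuous_intros) auto
  have norm: "Lp_norm p {-1..1} (\<lambda>x. (F x - poly ((pderiv ^^ r) (R m)) x) * varphi x ^ r) \<le> ennreal (\<Sum>j. \<beta> (j + m))" for m
  proof -
    have "Lp_norm p {-1..1} (\<lambda>x. (F x - poly ((pderiv ^^ r) (R m)) x) * varphi x ^ r)
      = Lp_norm p {-1..1} (\<lambda>x. (S r x - poly ((pderiv ^^ r) (R m)) x) * varphi x ^ r)"
      by (intro Lp_norm_cong_AE p mcomb mF measurable_S) (use F_eq in \<open>auto elim: eventually_mono\<close>)
    then show ?thesis using norm_S_remainder by simp
  qed
  have "(\<lambda>x. F x * varphi x ^ r) \<in> Lp p {-1..1}"
  proof -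
    \<comment> \<open>The distance to this polynomial has finite weighted norm, and the polynomial
      itself is bounded.\<close>
    let ?q = "(pderiv ^^ r) (R 0)"
    have "bounded ((\<lambda>x. poly ?q x * varphi x ^ r) ` {-1..1})"
      by (intro compact_imp_bounded compact_continuous_image continuous_intros compact_Icc)
    then obtain B where B: "0 < B" "\<And>x. x \<in> {-1..1} \<Longrightarrow> \<bar>poly ?q x * varphi x ^ r\<bar> \<le> B"
      unfolding bounded_pos by auto
    have mq: "(\<lambda>x. poly ?q x * varphi x ^ r) \<in> borel_measurable (lebesgue_on {-1..1})"
      by (intro continuous_on_imp_measurable_lebesgue_on continuous_intros) auto
    have "Lp_norm p {-1..1} (\<lambda>x. (F x - poly ?q x) * varphi x ^ r + poly ?q x * varphi x ^ r) \<le> ennreal ((\<Sum>j. \<beta> (j + 0)) + 2 * B)"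
      by (intro Lp_norm_triangle p mcomb mF mq norm Lp_norm_bounded B(2))
        (use B(1) \<beta> in \<open>auto intro: suminf_nonneg\<close>)
    then have "Lp_norm p {-1..1} (\<lambda>x. F x * varphi x ^ r) \<le> ennreal ((\<Sum>j. \<beta> (j + 0)) + 2 * B)"
      by (simp add: algebra_simps)
    moreover have "(\<lambda>x. F x * varphi x ^ r) \<in> borel_measurable (lebesgue_on {-1..1})"
      using mcomb[OF mF, of 0] by simp
    ultimately show ?thesis by (auto simp: Lp_def intro: le_less_trans)
  qed
  moreover have "locally_absolutely_continuous ((deriv ^^ (r - 1)) g)"
    unfolding locally_absolutely_continuous_def
  proof (intro allI impI)
    fix a c :: real assume ac: "-1 < a \<and> a < c \<and> c < 1"
    define s where "s = max \<bar>a\<bar> \<bar>c\<bar>"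
    have s: "0 < s" "s < 1" "{a..c} \<subseteq> {-s..s}" using ac by (auto simp: s_def)
    show "absolutely_continuous_on {a..c} ((deriv ^^ (r - 1)) g)"
      by (rule absolutely_continuous_on_cong[OF absolutely_continuous_on_subset[OF S_AC(1)[OF s(1,2)] s(3)]])
        (use dg[OF r'(1)] ac in auto)
  qed
  moreover have "(deriv ^^ j) g field_differentiable at x" if "j < r - 1" "x \<in> {-1<..<1}" for j x
  proof -
    have "(S j has_real_derivative S (Suc j) x) (at x)" using that by (intro S_has_derivative) auto
    then have "((deriv ^^ j) g has_real_derivative S (Suc j) x) (at x)"
      by (rule has_field_derivative_transform_within_open[of _ _ _ "{-1<..<1}"]) (use that dg in auto)
    then show ?thesis by (auto simp: field_differentiable_def)
  qed
  ultimately have g: "g \<in> B_space p r" using r by (auto simp: B_space_def F_def)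
  have mfR: "(\<lambda>x. f x - poly (R j) x) \<in> borel_measurable (lebesgue_on {-1..1})" for j
    by (intro borel_measurable_diff fm continuous_on_imp_measurable_lebesgue_on continuous_intros) auto
  \<comment> \<open>The errors are summable, so \<open>R j\<close> tends to f almost everywhere; at
    every inner point it tends to \<open>S 0\<close>.\<close>
  have ae: "AE x in lebesgue_on {-1..1}. g x = f x"
    using Lp_norm_series(1)[OF p mfR R b(1) summable_b] AE_unit_interior
  proof eventually_elim
    case (elim x)
    have "(\<lambda>j. f x - poly (R j) x) \<longlonglongrightarrow> 0"
      by (rule summable_LIMSEQ_zero[OF summable_rabs_cancel[OF elim(1)]])
    moreover have "(\<lambda>j. f x - poly (R j) x) \<longlonglongrightarrow> f x - S 0 x"
      using R_tendsto_S[of 0 x] r elim(2) by (intro tendsto_intros) simp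
    ultimately have "f x - S 0 x = 0" by (metis LIMSEQ_unique)
    then show ?case by (simp add: g_def)
  qed
  have sum_\<beta>: "(\<Sum>j. \<beta> (j + m)) = 2 * 8 ^ r * (\<Sum>j. (2 ^ (J + (j + m))) ^ r * b (j + m))" for m
    unfolding \<beta>_def using summ by (intro suminf_mult) (subst summable_iff_shift)
  show ?thesis
  proof (intro bexI[of _ g] conjI allI)
    show "AE x in lebesgue_on {-1..1}. g x = f x" by (rule ae)
    show "(deriv ^^ r) g \<in> borel_measurable (lebesgue_on {-1..1})" using mF by (simp only: F_def)
    show "Lp_norm p {-1..1} (\<lambda>x. ((deriv ^^ r) g x - poly ((pderiv ^^ r) (R m)) x) * varphi x ^ r)
      \<le> ennreal (2 * 8 ^ r * (\<Sum>j. (2 ^ (J + (j + m))) ^ r * b (j + m)))" for m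
      using norm[of m] by (simp only: F_def sum_\<beta>)
  qed (rule g)
qed

end

section \<open>The inverse theorem\<close>

abbreviation head_integral :: "nat \<Rightarrow> (real \<Rightarrow> real) \<Rightarrow> real \<Rightarrow> ennreal" where
  "head_integral r \<phi> t \<equiv> \<integral>\<^sup>+u\<in>{0..t}. ennreal (real r * \<phi> u / u ^ (r + 1)) \<partial>lborel"

abbreviation tail_integral :: "nat \<Rightarrow> (real \<Rightarrow> real) \<Rightarrow> real \<Rightarrow> ennreal" where
  "tail_integral m \<phi> t \<equiv> \<integral>\<^sup>+u\<in>{t..1}. ennreal (\<phi> u / u ^ (m + 1)) \<partial>lborel"

text \<open>On [s, 2 s) the integrand is at least \<phi> s / (2 s)^(m+1), and the length of this
  interval is s.\<close>

lemma dyadic_block_le: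
  assumes \<phi>: "mono_on {0..1} \<phi>" "\<And>u. u \<in> {0..1} \<Longrightarrow> 0 \<le> \<phi> u" and s: "0 < s" "2 * s \<le> 1"
  shows "ennreal (\<phi> s / s ^ m) \<le> ennreal (2 ^ Suc m) * (\<integral>\<^sup>+u\<in>{s..<2 * s}. ennreal (\<phi> u / u ^ (m + 1)) \<partial>lborel)"
proof -
  define K where "K = \<phi> s / (2 * s) ^ Suc m"
  have \<phi>s: "0 \<le> \<phi> s" using \<phi>(2) s by simp
  have "ennreal (\<phi> s / s ^ m) = ennreal (2 ^ Suc m) * (ennreal K * ennreal s)"
    using s \<phi>s by (simp add: K_def ennreal_mult[symmetric] power_mult_distrib)
  also have "ennreal K * ennreal s = (\<integral>\<^sup>+u\<in>{s..<2 * s}. ennreal K \<partial>lborel)"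
    using s by (simp add: nn_integral_cmult_indicator)
  also have "\<dots> \<le> (\<integral>\<^sup>+u\<in>{s..<2 * s}. ennreal (\<phi> u / u ^ (m + 1)) \<partial>lborel)"
  proof (rule nn_integral_mono)
    fix u
    have "K \<le> \<phi> u / u ^ (m + 1)" if u: "u \<in> {s..<2 * s}"
    proof -
      have "\<phi> s \<le> \<phi> u" using mono_onD[OF \<phi>(1), of s u] u s by auto
      moreover have "u ^ Suc m \<le> (2 * s) ^ Suc m" using u s by (intro power_mono) auto
      ultimately show ?thesis unfolding K_def using u s \<phi>s by (auto intro!: frac_le simp del: power_Suc)
    qed
    then show "ennreal K * indicator {s..<2 * s} u \<le> ennreal (\<phi> u / u ^ (m + 1)) * indicator {s..<2 * s} u"
      by (auto split: split_indicator intro: ennreal_leI)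
  qed
  finally show ?thesis by (simp add: mult_left_mono)
qed

text \<open>Clamping the argument to [0, 1] makes \<phi> monotone on the whole line, hence Borel
  measurable.\<close>

lemma measurable_mono_on_unit:
  assumes "mono_on {0..1} (\<phi> :: real \<Rightarrow> real)"
  shows "(\<lambda>u. ennreal (\<phi> u / u ^ m) * indicator {0..1} u) \<in> borel_measurable borel"
proof -
  let ?\<psi> = "\<lambda>u. \<phi> (max 0 (min 1 u))"
  have "mono ?\<psi>"
    by (intro monoI mono_onD[OF assms]) auto
  then have [measurable]: "?\<psi> \<in> borel_measurable borel" by (rule borel_measurable_mono)
  have "(\<lambda>u. ennreal (?\<psi> u / u ^ m) * indicator {0..1} u) \<in> borel_measurable borel" by measurable
  also have "(\<lambda>u. ennreal (?\<psi> u / u ^ m) * indicator {0..1} u) = (\<lambda>u. ennreal (\<phi> u / u ^ m) * indicator {0..1} u)"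
    by (auto split: split_indicator)
  finally show ?thesis .
qed

text \<open>The half-open blocks for different j are disjoint, so the block estimates add up to one
  integral; j \<ge> 1 keeps the blocks inside [0, 1].\<close>

lemma dyadic_sum_le:
  assumes \<phi>: "mono_on {0..1} \<phi>" "\<And>u. u \<in> {0..1} \<Longrightarrow> 0 \<le> \<phi> u"
    and F: "finite F" "\<And>j. j \<in> F \<Longrightarrow> 1 \<le> j \<and> {(1/2) ^ j..<2 * (1/2) ^ j} \<subseteq> A" and A: "A \<subseteq> {0..1}" "A \<in> sets borel"
    and I: "(\<integral>\<^sup>+u\<in>A. ennreal (\<phi> u / u ^ (m + 1)) \<partial>lborel) \<le> ennreal i" "0 \<le> i"
  shows "(\<Sum>j\<in>F. (2 ^ j) ^ m * \<phi> ((1/2) ^ j)) \<le> 2 ^ Suc m * i"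
proof -
  define B where "B j = {(1/2::real) ^ j..<2 * (1/2) ^ j}" for j :: nat
  have in01: "(1/2::real) ^ j \<in> {0..1}" for j by (auto simp: power_le_one)
  have \<phi>0: "0 \<le> (2 ^ j) ^ m * \<phi> ((1/2) ^ j)" for j using \<phi>(2)[OF in01] by simp
  have BA: "B j \<subseteq> A" if "j \<in> F" for j using F(2)[OF that] by (simp add: B_def)
  have "ennreal (\<Sum>j\<in>F. (2 ^ j) ^ m * \<phi> ((1/2) ^ j)) = (\<Sum>j\<in>F. ennreal ((2 ^ j) ^ m * \<phi> ((1/2) ^ j)))"
    using \<phi>0 by (intro sum_ennreal[symmetric]) auto
  also have "\<dots> \<le> (\<Sum>j\<in>F. ennreal (2 ^ Suc m) * (\<integral>\<^sup>+u\<in>B j. ennreal (\<phi> u / u ^ (m + 1)) \<partial>lborel))"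
  proof (rule sum_mono)
    fix j assume "j \<in> F"
    then have j: "1 \<le> j" using F(2) by blast
    have "2 * (1/2::real) ^ j \<le> 1"
      using power_decreasing[OF j, of "1/2::real"] by simp
    then have "ennreal (\<phi> ((1/2) ^ j) / ((1/2) ^ j) ^ m) \<le> ennreal (2 ^ Suc m) * (\<integral>\<^sup>+u\<in>B j. ennreal (\<phi> u / u ^ (m + 1)) \<partial>lborel)"
      unfolding B_def by (intro dyadic_block_le \<phi>) auto
    moreover have "\<phi> ((1/2) ^ j) / ((1/2) ^ j) ^ m = (2 ^ j) ^ m * \<phi> ((1/2) ^ j)"
      by (simp add: power_one_over)
    ultimately show "ennreal ((2 ^ j) ^ m * \<phi> ((1/2) ^ j)) \<le> ennreal (2 ^ Suc m) * (\<integral>\<^sup>+u\<in>B j. ennreal (\<phi> u / u ^ (m + 1)) \<partial>lborel)"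
      by simp
  qed
  also have "\<dots> = ennreal (2 ^ Suc m) * (\<Sum>j\<in>F. \<integral>\<^sup>+u. (ennreal (\<phi> u / u ^ (m + 1)) * indicator A u) * indicator (B j) u \<partial>lborel)"
    unfolding sum_distrib_left
  proof (rule sum.cong[OF refl], rule arg_cong[of _ _ "\<lambda>z. ennreal (2 ^ Suc m) * z"], rule nn_integral_cong)
    fix j u assume "j \<in> F"
    then show "ennreal (\<phi> u / u ^ (m + 1)) * indicator (B j) u = ennreal (\<phi> u / u ^ (m + 1)) * indicator A u * indicator (B j) u"
      using BA[of j] by (cases "u \<in> B j") auto
  qed
  also have "\<dots> \<le> ennreal (2 ^ Suc m) * (\<integral>\<^sup>+u\<in>A. ennreal (\<phi> u / u ^ (m + 1)) \<partial>lborel)"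
  proof (intro mult_left_mono sum_nn_integral_disjoint_le)
    have "(\<lambda>u. (ennreal (\<phi> u / u ^ (m + 1)) * indicator {0..1} u) * indicator A u) \<in> borel_measurable borel"
      using A(2) by (intro borel_measurable_times_ennreal measurable_mono_on_unit[OF \<phi>(1)]) auto
    also have "(\<lambda>u. (ennreal (\<phi> u / u ^ (m + 1)) * indicator {0..1} u) * indicator A u) = (\<lambda>u. ennreal (\<phi> u / u ^ (m + 1)) * indicator A u)"
      using A(1) by (intro ext) (auto simp: indicator_def)
    finally show "(\<lambda>u. ennreal (\<phi> u / u ^ (m + 1)) * indicator A u) \<in> borel_measurable lborel" by simp
    have "B i \<inter> B j = {}" if "i < j" for i j
    proof -
      have "2 * (1/2::real) ^ j \<le> (1/2) ^ i"
        using power_decreasing[of "Suc i" j "1/2::real"] that by simp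
      then show ?thesis by (auto simp: B_def)
    qed
    then show "disjoint_family_on B F"
      unfolding disjoint_family_on_def by (metis Int_commute linorder_neqE_nat)
  qed (use F(1) in \<open>auto simp: B_def\<close>)
  also have "\<dots> \<le> ennreal (2 ^ Suc m) * ennreal i" using I(1) by (intro mult_left_mono) auto
  also have "\<dots> = ennreal (2 ^ Suc m * i)" using I(2) by (simp add: ennreal_mult)
  finally show ?thesis using I(2) by (simp add: ennreal_le_iff)
qed

text \<open>If the block [s, 2 s) fits below t, the head integral sees it. Otherwise, and always for
  r = 0 where the head integral is 0, \<phi> s \<le> \<phi> t is used, and the block [t, 2 t) lies
  in the tail because t \<le> 1/2. The constant is 2^r from (t / 2)^r times 2^(k+r+1) from the
  block.\<close>

lemma point_value_le:
  assumes \<phi>: "mono_on {0..1} \<phi>" "\<And>u. u \<in> {0..1} \<Longrightarrow> 0 \<le> \<phi> u"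
    and s: "0 < s" "s \<le> t" and t: "t \<le> 1/2"
    and I1: "head_integral r \<phi> t \<le> ennreal i1" "0 \<le> i1"
    and I2: "tail_integral (k + r) \<phi> t \<le> ennreal i2" "0 \<le> i2"
  shows "\<phi> s / s ^ r \<le> 2 ^ (k + 2 * r + 1) * (i1 + t ^ k * i2)"
proof (cases "r = 0 \<or> t \<le> 2 * s")
  case True
  have \<phi>t: "0 \<le> \<phi> t" "0 \<le> \<phi> s" "\<phi> s \<le> \<phi> t" using \<phi>(2) mono_onD[OF \<phi>(1), of s t] s t by auto
  have "\<phi> s / s ^ r \<le> \<phi> t / (t / 2) ^ r"
  proof (cases "r = 0")
    case False
    then have "(t / 2) ^ r \<le> s ^ r" using True s by (intro power_mono) auto
    then show ?thesis using s \<phi>t by (intro frac_le) auto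
  qed (use \<phi>t in simp)
  also have "\<dots> = 2 ^ r * (t ^ k * (\<phi> t / t ^ (k + r)))"
    using s by (simp add: power_divide power_add)
  also have "\<dots> \<le> 2 ^ r * (t ^ k * (2 ^ Suc (k + r) * i2))"
  proof (intro mult_left_mono)
    have "ennreal (\<phi> t / t ^ (k + r)) \<le> ennreal (2 ^ Suc (k + r)) * (\<integral>\<^sup>+u\<in>{t..<2 * t}. ennreal (\<phi> u / u ^ (k + r + 1)) \<partial>lborel)"
      using s t by (intro dyadic_block_le \<phi>) auto
    also have "\<dots> \<le> ennreal (2 ^ Suc (k + r)) * ennreal i2"
    proof (rule mult_left_mono[OF order_trans[OF nn_integral_mono I2(1)]])
      show "ennreal (\<phi> u / u ^ (k + r + 1)) * indicator {t..<2 * t} u \<le> ennreal (\<phi> u / u ^ (k + r + 1)) * indicator {t..1} u" for u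
        using t by (auto split: split_indicator)
    qed simp
    finally show "\<phi> t / t ^ (k + r) \<le> 2 ^ Suc (k + r) * i2"
      using I2(2) by (simp add: ennreal_mult[symmetric])
  qed (use s in auto)
  also have "\<dots> = 2 ^ (k + 2 * r + 1) * (t ^ k * i2)"
  proof -
    have "(2::real) ^ (k + 2 * r + 1) = 2 ^ r * 2 ^ Suc (k + r)"
      unfolding power_add[symmetric] by (rule arg_cong[of _ _ "power 2"]) simp
    then show ?thesis by (simp only: mult_ac)
  qed
  also have "\<dots> \<le> 2 ^ (k + 2 * r + 1) * (i1 + t ^ k * i2)" using I1(2) by (intro mult_left_mono) auto
  finally show ?thesis .
next
  case False
  then have r: "1 \<le> r" and st: "2 * s < t" by auto
  have "ennreal (\<phi> s / s ^ r) \<le> ennreal (2 ^ Suc r) * (\<integral>\<^sup>+u\<in>{s..<2 * s}. ennreal (\<phi> u / u ^ (r + 1)) \<partial>lborel)"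
    using s t st by (intro dyadic_block_le \<phi>) auto
  also have "\<dots> \<le> ennreal (2 ^ Suc r) * ennreal i1"
  proof (rule mult_left_mono[OF order_trans[OF nn_integral_mono I1(1)]])
    fix u
    have "\<phi> u / u ^ (r + 1) \<le> real r * \<phi> u / u ^ (r + 1)" if "u \<in> {s..<2 * s}"
      using that s st t r \<phi>(2)[of u] by (intro divide_right_mono) (auto intro: mult_right_mono[of 1 "real r", simplified])
    then show "ennreal (\<phi> u / u ^ (r + 1)) * indicator {s..<2 * s} u \<le> ennreal (real r * \<phi> u / u ^ (r + 1)) * indicator {0..t} u"
      using s st by (auto split: split_indicator intro!: ennreal_leI)
  qed simp
  finally have "\<phi> s / s ^ r \<le> 2 ^ Suc r * i1"
    using I1(2) by (simp add: ennreal_mult[symmetric])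
  also have "\<dots> \<le> 2 ^ (k + 2 * r + 1) * (i1 + t ^ k * i2)"
    using I1(2) I2(2) s by (intro mult_mono power_increasing) auto
  finally show ?thesis .
qed

section \<open>The modulus in terms of given approximants\<close>

lemma symm_difference_add:
  "symm_difference k h (\<lambda>x. F x + G x) x = symm_difference k h F x + symm_difference k h G x"
  by (simp add: symm_difference_def distrib_left sum.distrib)

lemma symm_difference_zero: "symm_difference k h (\<lambda>x. 0) x = 0"
  by (simp add: symm_difference_def)

lemma symm_difference_sum:
  "symm_difference k h (\<lambda>x. \<Sum>j\<in>I. F j x) x = (\<Sum>j\<in>I. symm_difference k h (F j) x)"
  by (induction I rule: infinite_finite_induct) (simp_all add: symm_difference_add symm_difference_zero)

lemma Lp_norm_diff_le:
  assumes p: "1 \<le> p" and m: "f \<in> borel_measurable (lebesgue_on {-1..1})"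
    and P: "Lp_norm p {-1..1} (\<lambda>x. f x - poly P x) \<le> ennreal a" "0 \<le> a"
    and Q: "Lp_norm p {-1..1} (\<lambda>x. f x - poly Q x) \<le> ennreal b" "0 \<le> b"
  shows "Lp_norm p {-1..1} (poly (P - Q)) \<le> ennreal (a + b)"
proof -
  have mp: "(\<lambda>x. f x - poly q x) \<in> borel_measurable (lebesgue_on {-1..1})" for q
    by (intro borel_measurable_diff m continuous_on_imp_measurable_lebesgue_on continuous_intros) auto
  have "Lp_norm p {-1..1} (\<lambda>x. (-1) * (f x - poly P x) + (f x - poly Q x)) \<le> ennreal (\<bar>-1\<bar> * a + b)"
    by (intro Lp_norm_triangle p mp Q Lp_norm_cmult_le P borel_measurable_times borel_measurable_const) (use P in auto)
  also have "(\<lambda>x. (-1) * (f x - poly P x) + (f x - poly Q x)) = poly (P - Q)" by auto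
  finally show ?thesis by (simp only: abs_neg_one mult_1_left)
qed

lemma higher_pderiv_diff: "(pderiv ^^ n) (P - Q) = (pderiv ^^ n) P - (pderiv ^^ n) (Q :: real poly)"
  by (induction n) (simp_all add: pderiv_diff)

definition poly_const :: "nat \<Rightarrow> nat \<Rightarrow> real" where
  "poly_const k r = 2 ^ k * 4 ^ r * exp (8 * real k)"

definition point_const :: "nat \<Rightarrow> nat \<Rightarrow> real" where
  "point_const k r = 2 ^ (k + 2 * r + 1)"

text \<open>The three summands belong to the remainder after \<open>R m\<close>, to the telescoping
  differences, and to the part of \<open>R 0 - P\<close> that is measured by \<phi>.\<close>

definition rate_const :: "nat \<Rightarrow> nat \<Rightarrow> real" where
  "rate_const k r = 2 ^ Suc k * (2 * 8 ^ r * (point_const k r + 2 ^ Suc r))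
    + poly_const k r * 2 ^ Suc (k + r) * 2 ^ Suc (k + r)
    + (poly_const k r * 2 ^ Suc (k + r) + 2 ^ Suc k * 4 ^ r * point_const k r)"

text \<open>Measures the part of \<open>R 0 - P\<close> that is due to E; the summands serve small
  and large t. Through the degree bound 2^J it depends on N.\<close>

definition start_const :: "nat \<Rightarrow> nat \<Rightarrow> nat \<Rightarrow> real" where
  "start_const k r J = (poly_const k r + 2 ^ Suc k * 4 ^ r) * (2 ^ J) ^ (k + r)"

lemma const_nonneg: "0 \<le> poly_const k r" "0 \<le> point_const k r" "0 \<le> start_const k r J"
  by (auto simp: poly_const_def point_const_def start_const_def)

lemma rate_const_pos: "0 < rate_const k r"
  unfolding rate_const_def
  by (intro add_pos_nonneg mult_pos_pos mult_nonneg_nonneg add_nonneg_nonneg)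
    (auto simp: poly_const_def point_const_def intro!: add_nonneg_pos)

text \<open>Uses the decomposition $f = (f - R_m) + \sum_{j<m} (R_{j+1} - R_j) + (R_0 - P^*) + P^*$
  with \<open>R j\<close> of degree less than \<open>2 ^ (J + j)\<close>, and $m$ such that $2^{-(J+m)}$ is comparable to $t$,
  except that $m = 0$ when $t$ is large.\<close>

lemma omega_le_of_approximation:
  fixes R :: "nat \<Rightarrow> real poly"
  assumes p: "1 \<le> p" and k: "1 \<le> k"
    and \<phi>: "mono_on {0..1} \<phi>" "\<And>u. u \<in> {0..1} \<Longrightarrow> 0 \<le> \<phi> u"
    and f: "f \<in> borel_measurable (lebesgue_on {-1..1})"
    and J: "1 \<le> J" "k + r \<le> 2 ^ J"
    and deg: "\<And>j. degree (R j) < 2 ^ (J + j)"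
    and R: "\<And>j. Lp_norm p {-1..1} (\<lambda>x. f x - poly (R j) x) \<le> ennreal (\<phi> ((1/2) ^ (J + j)))"
    and P: "degree P < k + r" "Lp_norm p {-1..1} (\<lambda>x. f x - poly P x) \<le> ennreal E" "0 \<le> E"
    and F: "F \<in> borel_measurable (lebesgue_on {-1..1})"
    and FR: "\<And>m i1. 0 \<le> i1 \<Longrightarrow> head_integral r \<phi> ((1/2) ^ (J + m)) \<le> ennreal i1 \<Longrightarrow>
      Lp_norm p {-1..1} (\<lambda>x. (F x - poly ((pderiv ^^ r) (R m)) x) * varphi x ^ r)
      \<le> ennreal (2 * 8 ^ r * ((2 ^ (J + m)) ^ r * \<phi> ((1/2) ^ (J + m)) + 2 ^ Suc r * i1))"
    and t: "0 < t" "t \<le> 1/2"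
    and I1: "head_integral r \<phi> t \<le> ennreal i1" "0 \<le> i1"
    and I2: "tail_integral (k + r) \<phi> t \<le> ennreal i2" "0 \<le> i2"
  shows "omega k r F t p \<le> ennreal (rate_const k r * (i1 + t ^ k * i2) + start_const k r J * t ^ k * E)"
  unfolding omega_def
proof (rule SUP_least)
  fix h assume "h \<in> {0<..t}"
  then have h: "0 < h" "h \<le> t" by auto
  let ?S = "D_set (real k * h)"
  let ?D = "\<lambda>G x. W_weight (real k * h) x ^ r * symm_difference k (h * varphi x) G x"
  let ?X = "i1 + t ^ k * i2"
  define b where "b j = \<phi> ((1/2) ^ (J + j))" for j
  have in01: "(1/2::real) ^ j \<in> {0..1}" for j by (auto simp: power_le_one)
  have b0: "0 \<le> b j" for j unfolding b_def by (rule \<phi>(2)[OF in01])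
  have X0: "0 \<le> ?X" using I1 I2 t by simp
  have S: "?S \<in> sets lebesgue" using k h by (intro D_set_sets) simp
  have pv: "(2 ^ j) ^ r * \<phi> ((1/2) ^ j) \<le> point_const k r * ?X" if "(1/2) ^ j \<le> t" for j
  proof -
    have "\<phi> ((1/2) ^ j) / ((1/2) ^ j) ^ r \<le> point_const k r * ?X"
      unfolding point_const_def by (rule point_value_le[OF \<phi> _ that t(2) I1 I2]) auto
    then show ?thesis by (simp add: power_one_over mult.commute)
  qed
  \<comment> \<open>2^-L is the largest power of 1/2 not exceeding t; its exponent is positive since
    t \<le> 1/2.\<close>
  obtain L where L: "(1/2::real) ^ L \<le> t" "t < 2 * (1/2) ^ L"
  proof -
    obtain n where "(1/2::real) ^ n < t" using real_arch_pow_inv[OF t(1), of "1/2"] by auto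
    then have ex: "\<exists>n. (1/2::real) ^ n \<le> t" using less_imp_le by blast
    define L where "L = (LEAST n. (1/2::real) ^ n \<le> t)"
    have 1: "(1/2::real) ^ L \<le> t" unfolding L_def using ex by (rule LeastI_ex)
    have "L \<noteq> 0" using 1 t by (cases L) auto
    then have "\<not> (1/2::real) ^ (L - 1) \<le> t" unfolding L_def by (intro not_less_Least) auto
    then have "t < 2 * (1/2) ^ L" using \<open>L \<noteq> 0\<close> by (cases L) auto
    with 1 show ?thesis by (rule that)
  qed
  have L2: "t * 2 ^ L < 2" using L(2) by (simp add: power_one_over field_simps)
  have L1: "1 \<le> t * 2 ^ L" using L(1) by (simp add: power_one_over field_simps)
  \<comment> \<open>Truncated subtraction: m = 0 exactly when L \<le> J, that is, when t is at least
    2^-J.\<close>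
  define m where "m = L - J"
  have Jm: "(1/2::real) ^ (J + m) \<le> t"
    by (rule order_trans[OF _ L(1)]) (auto simp: m_def intro!: power_decreasing)
  define Q where "Q j = R (Suc j) - R j" for j
  have R_sum: "poly ((pderiv ^^ r) (R m)) x = poly ((pderiv ^^ r) (R 0)) x + (\<Sum>j<m. poly ((pderiv ^^ r) (Q j)) x)" for x
  proof (induction m)
    case (Suc n)
    have "R (Suc n) = R n + Q n" by (simp add: Q_def)
    then show ?case using Suc by (simp add: higher_pderiv_add)
  qed simp
  have mq: "(\<lambda>x. poly q x) \<in> borel_measurable (lebesgue_on {-1..1})" for q :: "real poly"
    by (intro continuous_on_imp_measurable_lebesgue_on continuous_intros) auto
  have mD: "?D (poly q) \<in> borel_measurable (lebesgue_on ?S)" for q :: "real poly"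
    by (intro measurable_W_symm_difference k h continuous_on_imp_measurable_lebesgue_on S continuous_intros)

  have A: "?D (\<lambda>x. F x - poly ((pderiv ^^ r) (R m)) x) \<in> borel_measurable (lebesgue_on ?S)"
    "Lp_norm p ?S (?D (\<lambda>x. F x - poly ((pderiv ^^ r) (R m)) x)) \<le> ennreal (2 ^ Suc k * (2 * 8 ^ r * (point_const k r + 2 ^ Suc r)) * ?X)"
  proof -
    define Ba where "Ba = 2 * 8 ^ r * ((2 ^ (J + m)) ^ r * \<phi> ((1/2) ^ (J + m)) + 2 ^ Suc r * i1)"
    have Ba0: "0 \<le> Ba" using \<phi>(2)[OF in01] I1 by (simp add: Ba_def)
    have I: "head_integral r \<phi> ((1/2) ^ (J + m)) \<le> ennreal i1"
      by (rule order_trans[OF _ I1(1)], rule nn_integral_mono) (use Jm in \<open>auto split: split_indicator\<close>)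
    note W = Lp_norm_W_difference[OF p k h(1) borel_measurable_diff[OF F mq] FR[OF I1(2) I, folded Ba_def] Ba0]
    show "?D (\<lambda>x. F x - poly ((pderiv ^^ r) (R m)) x) \<in> borel_measurable (lebesgue_on ?S)" by (rule W(1))
    have "Ba \<le> 2 * 8 ^ r * (point_const k r * ?X + 2 ^ Suc r * ?X)"
      unfolding Ba_def using pv[OF Jm] t I2 by (intro mult_left_mono add_mono) auto
    also have "\<dots> = 2 * 8 ^ r * (point_const k r + 2 ^ Suc r) * ?X" by (simp only: distrib_right mult.assoc)
    finally have "2 ^ Suc k * Ba \<le> 2 ^ Suc k * (2 * 8 ^ r * (point_const k r + 2 ^ Suc r) * ?X)"
      by (rule mult_left_mono) simp
    also have "\<dots> = 2 ^ Suc k * (2 * 8 ^ r * (point_const k r + 2 ^ Suc r)) * ?X" by (simp only: mult.assoc)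
    finally show "Lp_norm p ?S (?D (\<lambda>x. F x - poly ((pderiv ^^ r) (R m)) x)) \<le> ennreal (2 ^ Suc k * (2 * 8 ^ r * (point_const k r + 2 ^ Suc r)) * ?X)"
      by (intro order_trans[OF W(2)] ennreal_leI)
  qed

  define c where "c j = poly_const k r * 2 ^ Suc (k + r) * t ^ k * ((2 ^ (J + j)) ^ (k + r) * b j)" for j
  have B: "Lp_norm p ?S (?D (poly ((pderiv ^^ r) (Q j)))) \<le> ennreal (c j)" if j: "j < m" for j
  proof -
    define n :: nat where "n = 2 ^ Suc (J + j)"
    have n: "real n = 2 * 2 ^ (J + j)" by (simp add: n_def)
    have "degree (Q j) \<le> max (degree (R (Suc j))) (degree (R j))" unfolding Q_def by (rule degree_diff_le_max)
    also have "\<dots> < n" using deg[of "Suc j"] deg[of j] by (auto simp: n_def)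
    finally have dQ: "degree (Q j) < n" .
    have "\<phi> ((1/2) ^ (J + Suc j)) \<le> \<phi> ((1/2) ^ (J + j))"
      by (rule mono_onD[OF \<phi>(1) in01 in01], rule power_decreasing) auto
    then have "b (Suc j) + b j \<le> 2 * b j" unfolding b_def by linarith
    moreover have "Lp_norm p {-1..1} (poly (Q j)) \<le> ennreal (b (Suc j) + b j)"
      unfolding Q_def by (rule Lp_norm_diff_le[OF p f R[folded b_def] b0 R[folded b_def] b0])
    ultimately have nQ: "Lp_norm p {-1..1} (poly (Q j)) \<le> ennreal (2 * b j)" by (meson ennreal_leI order_trans)
    \<comment> \<open>For j < m the degree of \<open>Q j\<close> is below 2^L, and t 2^L < 2; this
      gives the condition h n \<le> 2 of the Taylor estimate.\<close>
    have "2 ^ Suc (J + j) \<le> (2::real) ^ L" using j by (intro power_increasing) (auto simp: m_def)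
    then have "h * real n \<le> t * 2 ^ L" unfolding n_def using h by (intro mult_mono) auto
    then have hn: "h * real n \<le> 2" using L2 by linarith
    have "Lp_norm p ?S (?D (poly ((pderiv ^^ r) (Q j)))) \<le> ennreal (poly_const k r * (h * real n) ^ k * real n ^ r * (2 * b j))"
      unfolding poly_const_def by (rule Lp_norm_W_difference_poly[OF p k dQ nQ _ h(1) hn]) (use b0 in simp)
    also have "\<dots> \<le> ennreal (poly_const k r * (t * real n) ^ k * real n ^ r * (2 * b j))"
      using h t b0 const_nonneg by (intro ennreal_leI mult_right_mono mult_left_mono power_mono) auto
    also have "poly_const k r * (t * real n) ^ k * real n ^ r * (2 * b j) = c j"
      unfolding c_def n by (simp add: power_mult_distrib power_add mult_ac)
    finally show ?thesis .
  qed
  have c0: "0 \<le> c j" for j using b0 const_nonneg t by (simp add: c_def)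
  have c_sum: "(\<Sum>j<m. c j) \<le> poly_const k r * 2 ^ Suc (k + r) * 2 ^ Suc (k + r) * ?X"
    and b_start: "J < L \<Longrightarrow> t ^ k * ((2 ^ J) ^ (k + r) * b 0) \<le> 2 ^ Suc (k + r) * ?X"
  proof -
    have sub: "1 \<le> j \<and> {(1/2::real) ^ j..<2 * (1/2) ^ j} \<subseteq> {t..1}" if "j \<in> {J..<L}" for j
    proof -
      have "1 \<le> j" using that J by simp
      then have "2 * (1/2::real) ^ j \<le> 1" using power_decreasing[of 1 j "1/2::real"] by simp
      moreover have "2 * (1/2::real) ^ L \<le> (1/2) ^ j"
        using that power_decreasing[of "Suc j" L "1/2::real"] by simp
      ultimately show ?thesis using L(2) \<open>1 \<le> j\<close> by auto
    qed
    have "(\<Sum>j\<in>{J..<L}. (2 ^ j) ^ (k + r) * \<phi> ((1/2) ^ j)) \<le> 2 ^ Suc (k + r) * i2"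
      by (rule dyadic_sum_le[OF \<phi> _ sub _ _ I2]) (use t in auto)
    then have "t ^ k * (\<Sum>j\<in>{J..<L}. (2 ^ j) ^ (k + r) * \<phi> ((1/2) ^ j)) \<le> t ^ k * (2 ^ Suc (k + r) * i2)"
      using t by (intro mult_left_mono) auto
    also have "\<dots> \<le> 2 ^ Suc (k + r) * ?X" using I1 by (simp add: algebra_simps)
    finally have sum: "t ^ k * (\<Sum>j\<in>{J..<L}. (2 ^ j) ^ (k + r) * \<phi> ((1/2) ^ j)) \<le> 2 ^ Suc (k + r) * ?X" .
    have "(\<Sum>j\<in>{J..<L}. (2 ^ j) ^ (k + r) * \<phi> ((1/2) ^ j)) = (\<Sum>j<m. (2 ^ (J + j)) ^ (k + r) * b j)"
      unfolding m_def b_def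
      by (rule sum.reindex_bij_witness[of _ "\<lambda>j. J + j" "\<lambda>j. j - J"]) auto
    then have eq: "(\<Sum>j<m. c j) = poly_const k r * 2 ^ Suc (k + r) * (t ^ k * (\<Sum>j\<in>{J..<L}. (2 ^ j) ^ (k + r) * \<phi> ((1/2) ^ j)))"
      by (simp only: c_def sum_distrib_left mult.assoc)
    have "(\<Sum>j<m. c j) \<le> poly_const k r * 2 ^ Suc (k + r) * (2 ^ Suc (k + r) * ?X)"
      unfolding eq using const_nonneg sum by (intro mult_left_mono) auto
    then show "(\<Sum>j<m. c j) \<le> poly_const k r * 2 ^ Suc (k + r) * 2 ^ Suc (k + r) * ?X" by (simp only: mult.assoc)
    \<comment> \<open>\<open>b 0\<close> is then the value of \<phi> at the left end of one of the
      blocks inside [t, 1], so the tail integral absorbs it.\<close>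
    assume "J < L"
    then have "(2 ^ J) ^ (k + r) * \<phi> ((1/2) ^ J) \<le> (\<Sum>j\<in>{J..<L}. (2 ^ j) ^ (k + r) * \<phi> ((1/2) ^ j))"
      using \<phi>(2)[OF in01] by (intro member_le_sum) auto
    then have "t ^ k * ((2 ^ J) ^ (k + r) * b 0) \<le> t ^ k * (\<Sum>j\<in>{J..<L}. (2 ^ j) ^ (k + r) * \<phi> ((1/2) ^ j))"
      using t by (intro mult_left_mono) (auto simp: b_def)
    then show "t ^ k * ((2 ^ J) ^ (k + r) * b 0) \<le> 2 ^ Suc (k + r) * ?X" using sum by linarith
  qed

  have C: "Lp_norm p ?S (?D (poly ((pderiv ^^ r) (R 0 - P)))) \<le>
    ennreal ((poly_const k r * 2 ^ Suc (k + r) + 2 ^ Suc k * 4 ^ r * point_const k r) * ?X + start_const k r J * t ^ k * E)"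
  proof -
    define n :: nat where "n = 2 ^ J"
    have n: "real n = 2 ^ J" by (simp add: n_def)
    have "degree (R 0 - P) \<le> max (degree (R 0)) (degree P)" by (rule degree_diff_le_max)
    also have "\<dots> < n" using deg[of 0] P(1) J by (auto simp: n_def)
    finally have dR: "degree (R 0 - P) < n" .
    have nR: "Lp_norm p {-1..1} (poly (R 0 - P)) \<le> ennreal (b 0 + E)"
      unfolding b_def using R[of 0] b0[of 0] by (intro Lp_norm_diff_le[OF p f] P) (auto simp: b_def)
    have bE: "0 \<le> b 0 + E" using b0[of 0] P by simp
    show ?thesis
    proof (cases "J < L")
      case True
      have "2 ^ J \<le> (2::real) ^ L" using True by (intro power_increasing) auto
      then have "h * real n \<le> t * 2 ^ L" unfolding n using h by (intro mult_mono) auto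
      then have hn: "h * real n \<le> 2" using L2 by linarith
      have "Lp_norm p ?S (?D (poly ((pderiv ^^ r) (R 0 - P)))) \<le> ennreal (poly_const k r * (h * real n) ^ k * real n ^ r * (b 0 + E))"
        unfolding poly_const_def by (rule Lp_norm_W_difference_poly[OF p k dR nR bE h(1) hn])
      also have "\<dots> \<le> ennreal (poly_const k r * (t * real n) ^ k * real n ^ r * (b 0 + E))"
        using h t bE const_nonneg by (intro ennreal_leI mult_right_mono mult_left_mono power_mono) auto
      also have "\<dots> \<le> ennreal ((poly_const k r * 2 ^ Suc (k + r) + 2 ^ Suc k * 4 ^ r * point_const k r) * ?X + start_const k r J * t ^ k * E)"
      proof (rule ennreal_leI)
        have "poly_const k r * (t * real n) ^ k * real n ^ r * (b 0 + E) =
          poly_const k r * (t ^ k * ((2 ^ J) ^ (k + r) * b 0)) + poly_const k r * (2 ^ J) ^ (k + r) * t ^ k * E"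
          unfolding n by (simp add: power_mult_distrib power_add algebra_simps)
        also have "\<dots> \<le> poly_const k r * (2 ^ Suc (k + r) * ?X) + start_const k r J * t ^ k * E"
        proof (intro add_mono mult_left_mono mult_right_mono b_start True)
          show "poly_const k r * (2 ^ J) ^ (k + r) \<le> start_const k r J"
            unfolding start_const_def by (intro mult_right_mono) auto
        qed (use const_nonneg t P in auto)
        also have "\<dots> \<le> (poly_const k r * 2 ^ Suc (k + r) + 2 ^ Suc k * 4 ^ r * point_const k r) * ?X + start_const k r J * t ^ k * E"
          using X0 const_nonneg by (simp only: distrib_right mult.assoc) simp
        finally show "poly_const k r * (t * real n) ^ k * real n ^ r * (b 0 + E) \<le> \<dots>" .
      qed
      finally show ?thesis .
    next
      \<comment> \<open>Here t is at least 2^-J and h n need not be small. The crude bound of the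
        difference and Bernstein's inequality replace the Taylor estimate, and the missing factor
        t^k is recovered from (2^J t)^k \<ge> 1.\<close>
      case False
      then have LJ: "(1/2::real) ^ J \<le> t" using L(1) power_decreasing[of L J "1/2::real"] by linarith
      have "Lp_norm p {-1..1} (\<lambda>x. poly ((pderiv ^^ r) (R 0 - P)) x * varphi x ^ r) \<le> ennreal ((4 * real n) ^ r * (b 0 + E))"
        using Lp_bernstein[OF p dR nR bE, of r] by (simp only: mult.commute)
      then have "Lp_norm p ?S (?D (poly ((pderiv ^^ r) (R 0 - P)))) \<le> ennreal (2 ^ Suc k * ((4 * real n) ^ r * (b 0 + E)))"
        by (intro Lp_norm_W_difference(2)[OF p k h(1) mq]) (use bE in auto)
      also have "\<dots> \<le> ennreal ((poly_const k r * 2 ^ Suc (k + r) + 2 ^ Suc k * 4 ^ r * point_const k r) * ?X + start_const k r J * t ^ k * E)"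
      proof (rule ennreal_leI)
        have one: "1 \<le> (2 ^ J) ^ k * t ^ k"
        proof -
          have "1 \<le> 2 ^ J * t" using LJ by (simp add: power_one_over field_simps)
          then have "1 \<le> (2 ^ J * t) ^ k" by (rule one_le_power)
          then show ?thesis by (simp add: power_mult_distrib)
        qed
        have "2 ^ Suc k * ((4 * real n) ^ r * (b 0 + E)) =
          2 ^ Suc k * 4 ^ r * ((2 ^ J) ^ r * \<phi> ((1/2) ^ J)) + 2 ^ Suc k * 4 ^ r * ((2 ^ J) ^ r * 1 * E)"
          unfolding n by (simp add: b_def power_mult_distrib algebra_simps)
        also have "\<dots> \<le> 2 ^ Suc k * 4 ^ r * (point_const k r * ?X) + 2 ^ Suc k * 4 ^ r * ((2 ^ J) ^ r * ((2 ^ J) ^ k * t ^ k) * E)"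
          using P one by (intro add_mono mult_left_mono mult_right_mono pv[OF LJ]) auto
        also have "2 ^ Suc k * 4 ^ r * ((2 ^ J) ^ r * ((2 ^ J) ^ k * t ^ k) * E) = (2 ^ Suc k * 4 ^ r * (2 ^ J) ^ (k + r)) * t ^ k * E"
          by (simp add: power_add mult_ac)
        also have "\<dots> \<le> start_const k r J * t ^ k * E"
          unfolding start_const_def using P t const_nonneg by (intro mult_right_mono) auto
        also have "2 ^ Suc k * 4 ^ r * (point_const k r * ?X) \<le> (poly_const k r * 2 ^ Suc (k + r) + 2 ^ Suc k * 4 ^ r * point_const k r) * ?X"
          using X0 const_nonneg by (simp only: distrib_right mult.assoc) simp
        finally show "2 ^ Suc k * ((4 * real n) ^ r * (b 0 + E)) \<le>
          (poly_const k r * 2 ^ Suc (k + r) + 2 ^ Suc k * 4 ^ r * point_const k r) * ?X + start_const k r J * t ^ k * E"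
          by simp
      qed
      finally show ?thesis .
    qed
  qed

  \<comment> \<open>The r-th derivative of P has degree less than k, so P enters the estimate only
    through its distance E to f.\<close>
  have zero: "symm_difference k (h * varphi x) (poly ((pderiv ^^ r) P)) x = 0" if "x \<in> ?S" for x
    by (rule symm_difference_poly_eq_0[OF that h(1)]) (use P(1) k degree_higher_pderiv[of r P] in auto)
  have split: "?D F x = ?D (\<lambda>x. F x - poly ((pderiv ^^ r) (R m)) x) x + ((\<Sum>j<m. ?D (poly ((pderiv ^^ r) (Q j))) x)
    + ?D (poly ((pderiv ^^ r) (R 0 - P))) x)" if x: "x \<in> ?S" for x
  proof -
    have "F = (\<lambda>x. (F x - poly ((pderiv ^^ r) (R m)) x) + ((\<Sum>j<m. poly ((pderiv ^^ r) (Q j)) x)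
      + (poly ((pderiv ^^ r) (R 0 - P)) x + poly ((pderiv ^^ r) P) x)))"
      by (rule ext) (simp add: R_sum higher_pderiv_diff)
    then have "symm_difference k (h * varphi x) F x = symm_difference k (h * varphi x) (\<lambda>x. (F x - poly ((pderiv ^^ r) (R m)) x) + ((\<Sum>j<m. poly ((pderiv ^^ r) (Q j)) x)
      + (poly ((pderiv ^^ r) (R 0 - P)) x + poly ((pderiv ^^ r) P) x))) x" by (rule arg_cong)
    then show ?thesis
      by (simp only: symm_difference_add symm_difference_sum zero[OF x] distrib_left sum_distrib_left add_0_right)
  qed
  have mB: "(\<lambda>x. \<Sum>j<m. ?D (poly ((pderiv ^^ r) (Q j))) x) \<in> borel_measurable (lebesgue_on ?S)"
    by (intro borel_measurable_sum mD)
  have mBC: "(\<lambda>x. (\<Sum>j<m. ?D (poly ((pderiv ^^ r) (Q j))) x) + ?D (poly ((pderiv ^^ r) (R 0 - P))) x) \<in> borel_measurable (lebesgue_on ?S)"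
    by (intro borel_measurable_add mB mD)
  have mA: "(\<lambda>x. ?D (\<lambda>x. F x - poly ((pderiv ^^ r) (R m)) x) x + ((\<Sum>j<m. ?D (poly ((pderiv ^^ r) (Q j))) x)
    + ?D (poly ((pderiv ^^ r) (R 0 - P))) x)) \<in> borel_measurable (lebesgue_on ?S)"
    by (intro borel_measurable_add A(1) mBC)
  have mF: "?D F \<in> borel_measurable (lebesgue_on ?S)"
    by (rule measurable_cong[THEN iffD2, OF _ mA]) (use split in \<open>auto simp: space_restrict_space\<close>)
  have "Lp_norm p ?S (?D F) \<le> Lp_norm p ?S (\<lambda>x. ?D (\<lambda>x. F x - poly ((pderiv ^^ r) (R m)) x) x + ((\<Sum>j<m. ?D (poly ((pderiv ^^ r) (Q j))) x)
    + ?D (poly ((pderiv ^^ r) (R 0 - P))) x))"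
    by (rule Lp_norm_mono[OF p mF]) (use split in simp)
  also have "\<dots> \<le> ennreal (2 ^ Suc k * (2 * 8 ^ r * (point_const k r + 2 ^ Suc r)) * ?X + ((\<Sum>j<m. c j)
    + ((poly_const k r * 2 ^ Suc (k + r) + 2 ^ Suc k * 4 ^ r * point_const k r) * ?X + start_const k r J * t ^ k * E)))"
    by (intro Lp_norm_triangle p A mBC mB mD C Lp_norm_sum_le B finite_lessThan)
      (use X0 c0 const_nonneg P t in \<open>auto intro!: sum_nonneg add_nonneg_nonneg mult_nonneg_nonneg\<close>)
  also have "\<dots> \<le> ennreal (rate_const k r * ?X + start_const k r J * t ^ k * E)"
  proof (rule ennreal_leI)
    define A B C where "A = 2 ^ Suc k * (2 * 8 ^ r * (point_const k r + 2 ^ Suc r))"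
      and "B = poly_const k r * 2 ^ Suc (k + r) * 2 ^ Suc (k + r)"
      and "C = poly_const k r * 2 ^ Suc (k + r) + 2 ^ Suc k * 4 ^ r * point_const k r"
    have "rate_const k r * ?X = A * ?X + B * ?X + C * ?X"
      by (simp only: rate_const_def A_def[symmetric] B_def[symmetric] C_def[symmetric] distrib_right)
    then show "2 ^ Suc k * (2 * 8 ^ r * (point_const k r + 2 ^ Suc r)) * ?X + ((\<Sum>j<m. c j)
      + ((poly_const k r * 2 ^ Suc (k + r) + 2 ^ Suc k * 4 ^ r * point_const k r) * ?X + start_const k r J * t ^ k * E))
      \<le> rate_const k r * ?X + start_const k r J * t ^ k * E"
      using c_sum unfolding A_def[symmetric] B_def[symmetric] C_def[symmetric] by linarith
  qed
  finally show "Lp_norm p ?S (?D F) \<le> ennreal (rate_const k r * ?X + start_const k r J * t ^ k * E)" .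
qed

lemma approximation_imp_omega_le:
  assumes p: "1 \<le> p" and k: "1 \<le> k" and N: "1 \<le> N"
    and \<phi>: "mono_on {0..1} \<phi>" "\<And>u. u \<in> {0..1} \<Longrightarrow> 0 \<le> \<phi> u"
    and I: "head_integral r \<phi> 1 < \<infinity>"
    and f: "f \<in> Lp p {-1..1}"
    and appr: "\<And>n. N \<le> n \<Longrightarrow> \<exists>Q. (Q = 0 \<or> degree Q < n) \<and>
      Lp_norm p {-1..1} (\<lambda>x. f x - poly Q x) \<le> ennreal (\<phi> (1 / real n))"
    and P: "P = 0 \<or> degree P < k + r" "Lp_norm p {-1..1} (\<lambda>x. f x - poly P x) \<le> ennreal E" "0 \<le> E"
  shows "\<exists>g\<in>B_space p r. AE x in lebesgue_on {-1..1}. g x = f x"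
    and "\<And>g t i1 i2. g \<in> B_space p r \<Longrightarrow> AE x in lebesgue_on {-1..1}. g x = f x \<Longrightarrow> 0 < t \<Longrightarrow> t \<le> 1/2 \<Longrightarrow>
      head_integral r \<phi> t \<le> ennreal i1 \<Longrightarrow> 0 \<le> i1 \<Longrightarrow>
      tail_integral (k + r) \<phi> t \<le> ennreal i2 \<Longrightarrow> 0 \<le> i2 \<Longrightarrow>
      omega k r ((deriv ^^ r) g) t p \<le>
        ennreal (rate_const k r * (i1 + t ^ k * i2) + start_const k r (N + k + r) * t ^ k * E)"
proof -
  \<comment> \<open>As n < 2^n, this choice gives both N \<le> 2^J and k + r \<le> 2^J.\<close>
  define J where "J = N + k + r"
  have J: "1 \<le> J" "k + r \<le> 2 ^ J"
  proof -
    show "1 \<le> J" using N by (simp add: J_def)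
    have "k + r \<le> J" by (simp add: J_def)
    also have "J \<le> 2 ^ J" by (rule less_imp_le[OF less_exp])
    finally show "k + r \<le> 2 ^ J" .
  qed
  have NJ: "N \<le> 2 ^ (J + j)" for j
  proof -
    have "N \<le> J + j" by (simp add: J_def)
    also have "J + j \<le> 2 ^ (J + j)" by (rule less_imp_le[OF less_exp])
    finally show ?thesis .
  qed
  have fm: "f \<in> borel_measurable (lebesgue_on {-1..1})" using f by (simp add: Lp_def)
  define b where "b j = \<phi> ((1/2) ^ (J + j))" for j
  have in01: "(1/2::real) ^ j \<in> {0..1}" for j by (auto simp: power_le_one)
  have b: "0 \<le> b j" "b (Suc j) \<le> b j" for j
    unfolding b_def by (rule \<phi>(2)[OF in01], rule mono_onD[OF \<phi>(1) in01 in01], rule power_decreasing) auto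
  have "\<exists>Q. degree Q < 2 ^ (J + j) \<and> Lp_norm p {-1..1} (\<lambda>x. f x - poly Q x) \<le> ennreal (b j)" for j
  proof -
    obtain Q where "Q = 0 \<or> degree Q < 2 ^ (J + j)"
      "Lp_norm p {-1..1} (\<lambda>x. f x - poly Q x) \<le> ennreal (\<phi> (1 / real (2 ^ (J + j))))"
      using appr[OF NJ] by blast
    then have "degree Q < 2 ^ (J + j)" "Lp_norm p {-1..1} (\<lambda>x. f x - poly Q x) \<le> ennreal (b j)"
      by (auto simp: b_def power_one_over)
    then show ?thesis by blast
  qed
  then obtain R where R: "\<And>j. degree (R j) < 2 ^ (J + j)"
    "\<And>j. Lp_norm p {-1..1} (\<lambda>x. f x - poly (R j) x) \<le> ennreal (b j)" by metis
  have dP: "degree P < k + r" using P(1) k by auto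
  have mR: "(\<lambda>x. (h x - poly q x) * varphi x ^ r) \<in> borel_measurable (lebesgue_on {-1..1})"
    if "h \<in> borel_measurable (lebesgue_on {-1..1})" for h q
    by (intro borel_measurable_times borel_measurable_diff that continuous_on_imp_measurable_lebesgue_on continuous_intros) auto
  \<comment> \<open>What the estimate of the modulus asks of an r-th derivative. It depends on F
    only up to null sets, so it passes from the constructed representative to all others.\<close>
  define good where "good F \<longleftrightarrow> F \<in> borel_measurable (lebesgue_on {-1..1}) \<and>
    (\<forall>m i1. 0 \<le> i1 \<and> head_integral r \<phi> ((1/2) ^ (J + m)) \<le> ennreal i1 \<longrightarrow>
      Lp_norm p {-1..1} (\<lambda>x. (F x - poly ((pderiv ^^ r) (R m)) x) * varphi x ^ r)
      \<le> ennreal (2 * 8 ^ r * ((2 ^ (J + m)) ^ r * \<phi> ((1/2) ^ (J + m)) + 2 ^ Suc r * i1)))" for F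
  have good_cong: "good G" if "good F" "AE x in lebesgue_on {-1..1}. F x = G x" for F G
  proof -
    have Fm: "F \<in> borel_measurable (lebesgue_on {-1..1})" using that(1) by (simp add: good_def)
    then have Gm: "G \<in> borel_measurable (lebesgue_on {-1..1})"
      by (rule borel_measurable_lebesgue_on_AE[OF _ _ that(2)]) simp
    have "Lp_norm p {-1..1} (\<lambda>x. (G x - poly q x) * varphi x ^ r) = Lp_norm p {-1..1} (\<lambda>x. (F x - poly q x) * varphi x ^ r)" for q
      by (intro Lp_norm_cong_AE p mR Fm Gm) (use that(2) in \<open>auto elim: eventually_mono\<close>)
    then show ?thesis using that(1) Gm by (simp add: good_def)
  qed
  have main: "(\<exists>g\<in>B_space p r. AE x in lebesgue_on {-1..1}. g x = f x) \<and>
    (\<forall>g\<in>B_space p r. (AE x in lebesgue_on {-1..1}. g x = f x) \<longrightarrow> good ((deriv ^^ r) g))"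
  proof (cases "r = 0")
    case True
    have "good f"
      unfolding good_def
    proof (intro conjI allI impI fm)
      fix m :: nat and i1 :: real
      assume i1: "0 \<le> i1 \<and> head_integral r \<phi> ((1/2) ^ (J + m)) \<le> ennreal i1"
      have "b m \<le> 2 * 8 ^ r * ((2 ^ (J + m)) ^ r * \<phi> ((1/2) ^ (J + m)) + 2 ^ Suc r * i1)"
        using True i1 b(1)[of m] by (simp add: b_def)
      then show "Lp_norm p {-1..1} (\<lambda>x. (f x - poly ((pderiv ^^ r) (R m)) x) * varphi x ^ r)
        \<le> ennreal (2 * 8 ^ r * ((2 ^ (J + m)) ^ r * \<phi> ((1/2) ^ (J + m)) + 2 ^ Suc r * i1))"
        using R(2)[of m] True by (auto intro: order_trans ennreal_leI)
    qed
    then have "good g" if "AE x in lebesgue_on {-1..1}. g x = f x" for g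
      by (rule good_cong[OF _ eventually_mono[OF that]]) auto
    then show ?thesis using True f by (auto simp: B_space_def)
  next
    case False
    then have r: "1 \<le> r" by simp
    have drop_r: "(\<integral>\<^sup>+u\<in>A. ennreal (\<phi> u / u ^ (r + 1)) \<partial>lborel) \<le> (\<integral>\<^sup>+u\<in>A. ennreal (real r * \<phi> u / u ^ (r + 1)) \<partial>lborel)"
      if "A \<subseteq> {0..1}" for A
    proof (rule nn_integral_mono)
      fix u
      have "\<phi> u / u ^ (r + 1) \<le> real r * \<phi> u / u ^ (r + 1)" if "u \<in> {0..1}"
        using that r \<phi>(2)[OF that] by (intro divide_right_mono) (auto intro: mult_right_mono[of 1 "real r", simplified])
      then show "ennreal (\<phi> u / u ^ (r + 1)) * indicator A u \<le> ennreal (real r * \<phi> u / u ^ (r + 1)) * indicator A u"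
        using that by (auto split: split_indicator intro!: ennreal_leI)
    qed
    have block: "1 \<le> j \<and> {(1/2::real) ^ j..<2 * (1/2) ^ j} \<subseteq> {0..(1/2) ^ l}" if "l < j" for j l
      using power_decreasing[of "Suc l" j "1/2::real"] that by (auto intro: order_trans[OF zero_le_power])
    have sum_le: "(\<Sum>j\<in>F. (2 ^ j) ^ r * \<phi> ((1/2) ^ j)) \<le> 2 ^ Suc r * i1"
      if F: "finite F" "\<And>j. j \<in> F \<Longrightarrow> l < j" and i1: "0 \<le> i1"
        "head_integral r \<phi> ((1/2) ^ l) \<le> ennreal i1" for F l i1
    proof (rule dyadic_sum_le[OF \<phi> F(1) block[OF F(2)] _ _ order_trans[OF drop_r i1(2)] i1(1)])
      show "{0..(1/2::real) ^ l} \<subseteq> {0..1}" "{0..(1/2::real) ^ l} \<subseteq> {0..1}" using in01[of l] by auto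
    qed auto
    obtain i0 where i0: "head_integral r \<phi> ((1/2) ^ 0) = ennreal i0" "0 \<le> i0"
      using I by (cases "head_integral r \<phi> 1") auto
    have shift_sum: "(\<Sum>j<n. (2 ^ (l + j)) ^ r * \<phi> ((1/2) ^ (l + j))) = (\<Sum>j\<in>{l..<l + n}. (2 ^ j) ^ r * \<phi> ((1/2) ^ j))" for l n
      by (rule sum.reindex_bij_witness[of _ "\<lambda>j. j - l" "\<lambda>j. l + j"]) auto
    \<comment> \<open>The dyadic blocks turn finiteness of the head integral over [0, 1] into a
      bound for all partial sums.\<close>
    have summ: "summable (\<lambda>j. (2 ^ (J + j)) ^ r * b j)"
    proof (rule bounded_imp_summable)
      show "0 \<le> (2 ^ (J + j)) ^ r * b j" for j using b by simp
      show "(\<Sum>j\<le>n. (2 ^ (J + j)) ^ r * b j) \<le> 2 ^ Suc r * i0" for n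
        unfolding b_def lessThan_Suc_atMost[symmetric] shift_sum
        by (rule sum_le[OF _ _ i0(2) eq_refl[OF i0(1)]]) (use J in auto)
    qed
    obtain g0 where g0: "g0 \<in> B_space p r" "AE x in lebesgue_on {-1..1}. g0 x = f x"
      "(deriv ^^ r) g0 \<in> borel_measurable (lebesgue_on {-1..1})"
      "\<And>m. Lp_norm p {-1..1} (\<lambda>x. ((deriv ^^ r) g0 x - poly ((pderiv ^^ r) (R m)) x) * varphi x ^ r)
        \<le> ennreal (2 * 8 ^ r * (\<Sum>j. (2 ^ (J + (j + m))) ^ r * b (j + m)))"
      using derivative_limit_in_B_space[OF p r fm R b summ] by blast
    have "good ((deriv ^^ r) g0)"
      unfolding good_def
    proof (intro conjI allI impI g0(3))
      fix m :: nat and i1 :: real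
      assume i1: "0 \<le> i1 \<and> head_integral r \<phi> ((1/2) ^ (J + m)) \<le> ennreal i1"
      \<comment> \<open>The term j = 0 remains a value of \<phi>, because its block lies to the
        right of the head interval [0, 2^-(J+m)]; the blocks of all later terms lie inside.\<close>
      define a where "a j = (2 ^ (J + (j + m))) ^ r * b (j + m)" for j
      have sa: "summable a" using summ unfolding a_def by (subst summable_iff_shift)
      have "(\<Sum>j. a (Suc j)) \<le> 2 ^ Suc r * i1"
      proof (rule suminf_le_const)
        show "summable (\<lambda>j. a (Suc j))" using sa by (subst summable_Suc_iff)
        fix n
        have "(\<Sum>j<n. a (Suc j)) = (\<Sum>j<n. (2 ^ ((J + m + 1) + j)) ^ r * \<phi> ((1/2) ^ ((J + m + 1) + j)))"
          unfolding a_def b_def by (intro sum.cong refl) (simp add: add_ac)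
        also have "\<dots> \<le> 2 ^ Suc r * i1"
          unfolding shift_sum by (rule sum_le[of _ "J + m"]) (use i1 in auto)
        finally show "(\<Sum>j<n. a (Suc j)) \<le> 2 ^ Suc r * i1" .
      qed
      then have "suminf a \<le> (2 ^ (J + m)) ^ r * \<phi> ((1/2) ^ (J + m)) + 2 ^ Suc r * i1"
        using suminf_split_head[OF sa] by (simp add: a_def b_def)
      then have "2 * 8 ^ r * suminf a \<le> 2 * 8 ^ r * ((2 ^ (J + m)) ^ r * \<phi> ((1/2) ^ (J + m)) + 2 ^ Suc r * i1)"
        by (intro mult_left_mono) auto
      then show "Lp_norm p {-1..1} (\<lambda>x. ((deriv ^^ r) g0 x - poly ((pderiv ^^ r) (R m)) x) * varphi x ^ r)
        \<le> ennreal (2 * 8 ^ r * ((2 ^ (J + m)) ^ r * \<phi> ((1/2) ^ (J + m)) + 2 ^ Suc r * i1))"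
        using g0(4)[of m] unfolding a_def by (meson ennreal_leI order_trans)
    qed
    moreover have "AE x in lebesgue_on {-1..1}. (deriv ^^ r) g0 x = (deriv ^^ r) g x"
      if g: "g \<in> B_space p r" "AE x in lebesgue_on {-1..1}. g x = f x" for g
    proof (rule AE_lebesgue_on_unit_I[OF negligible_empty])
      have "AE x in lebesgue_on {-1..1}. g0 x = g x"
        using g0(2) g(2) by eventually_elim simp
      then show "(deriv ^^ r) g0 x = (deriv ^^ r) g x" if "x \<in> {-1<..<1}" for x
        using that by (rule B_space_AE_eq_imp_eq[OF r g0(1) g(1)])
    qed
    ultimately show ?thesis using g0(1,2) good_cong by blast
  qed
  then show "\<exists>g\<in>B_space p r. AE x in lebesgue_on {-1..1}. g x = f x" by blast
  fix g t i1 i2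
  assume g: "g \<in> B_space p r" "AE x in lebesgue_on {-1..1}. g x = f x" and t: "0 < t" "t \<le> 1/2"
    and I1: "head_integral r \<phi> t \<le> ennreal i1" "0 \<le> i1"
    and I2: "tail_integral (k + r) \<phi> t \<le> ennreal i2" "0 \<le> i2"
  have gd: "good ((deriv ^^ r) g)" using main g by blast
  then have Fm: "(deriv ^^ r) g \<in> borel_measurable (lebesgue_on {-1..1})" by (simp add: good_def)
  have FR: "Lp_norm p {-1..1} (\<lambda>x. ((deriv ^^ r) g x - poly ((pderiv ^^ r) (R m)) x) * varphi x ^ r)
      \<le> ennreal (2 * 8 ^ r * ((2 ^ (J + m)) ^ r * \<phi> ((1/2) ^ (J + m)) + 2 ^ Suc r * i1))"
    if "0 \<le> i1" "head_integral r \<phi> ((1/2) ^ (J + m)) \<le> ennreal i1" for m i1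
    using gd that unfolding good_def by blast
  show "omega k r ((deriv ^^ r) g) t p \<le>
      ennreal (rate_const k r * (i1 + t ^ k * i2) + start_const k r (N + k + r) * t ^ k * E)"
    unfolding J_def[symmetric]
    by (rule omega_le_of_approximation[OF p k \<phi> fm J R(1) R(2)[unfolded b_def] dP P(2,3) Fm FR t I1 I2])
qed

section \<open>From given approximants to best approximation\<close>

lemma best_approx_less_imp:
  assumes "best_approx n f p < ennreal a"
  shows "\<exists>Q. (Q = 0 \<or> degree Q < n) \<and> Lp_norm p {-1..1} (\<lambda>x. f x - poly Q x) \<le> ennreal a"
  using assms unfolding best_approx_def by (auto simp: INF_less_iff less_imp_le)

text \<open>The infimum in \<open>best_approx\<close> need not be known to be attained: \<open>\<phi>\<close> is perturbed to
  $\phi_\varepsilon(u) = \phi(u) + \varepsilon u^{r+1}$, whose integrals exceed those of \<open>\<phi>\<close> by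
  $O(\varepsilon)$ only.\<close>

lemma best_approx_imp_omega_le:
  assumes p: "1 \<le> p" and k: "1 \<le> k" and N: "1 \<le> N"
    and \<phi>: "\<phi> \<in> Phi"
    and I: "head_integral r \<phi> 1 < \<infinity>"
    and f: "f \<in> Lp p {-1..1}"
    and appr: "\<forall>n\<ge>N. best_approx n f p \<le> ennreal (\<phi> (1 / real n))"
  shows "\<exists>g\<in>B_space p r. AE x in lebesgue_on {-1..1}. g x = f x"
    and "\<And>g t. g \<in> B_space p r \<Longrightarrow> AE x in lebesgue_on {-1..1}. g x = f x \<Longrightarrow> t \<in> {0..1/2} \<Longrightarrow>
      omega k r ((deriv ^^ r) g) t p \<le>
        ennreal (rate_const k r) * head_integral r \<phi> t
        + ennreal (rate_const k r) * ennreal (t ^ k) * tail_integral (k + r) \<phi> t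
        + ennreal (start_const k r (N + k + r)) * ennreal (t ^ k) * best_approx (k + r) f p"
proof -
  have \<phi>m: "mono_on {0..1} \<phi>" and \<phi>0: "\<And>u. u \<in> {0..1} \<Longrightarrow> 0 \<le> \<phi> u" using \<phi> by (auto simp: Phi_def)
  \<comment> \<open>The exponent r + 1 adds the constant \<open>real r * e\<close> to the head
    integrand away from 0, and e / u^k \<le> e / t^k to the tail integrand.\<close>
  define \<psi> where "\<psi> e u = \<phi> u + e * u ^ (r + 1)" for e u
  have \<psi>m: "mono_on {0..1} (\<psi> e)" if "0 < e" for e
    unfolding \<psi>_def using that
    by (intro mono_onI add_mono mult_left_mono power_mono mono_onD[OF \<phi>m]) auto
  have \<psi>0: "0 \<le> \<psi> e u" if "0 < e" "u \<in> {0..1}" for e u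
    unfolding \<psi>_def using that \<phi>0[OF that(2)] by (intro add_nonneg_nonneg mult_nonneg_nonneg zero_le_power) auto
  have \<psi>I: "head_integral r (\<psi> e) t
    \<le> head_integral r \<phi> t + ennreal (real r * e)" if e: "0 < e" and t: "0 \<le> t" "t \<le> 1" for e t
  proof -
    have "head_integral r (\<psi> e) t \<le>
      (\<integral>\<^sup>+u. ennreal (real r * \<phi> u / u ^ (r + 1)) * indicator {0..t} u + ennreal (real r * e) * indicator {0..t} u \<partial>lborel)"
    proof (rule nn_integral_mono)
      fix u
      have "real r * \<psi> e u / u ^ (r + 1) \<le> real r * \<phi> u / u ^ (r + 1) + real r * e" "0 \<le> real r * \<phi> u / u ^ (r + 1)" if "u \<in> {0..t}"
      proof -
        have u: "u \<in> {0..1}" using that t by auto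
        show "0 \<le> real r * \<phi> u / u ^ (r + 1)" using \<phi>0[OF u] u by auto
        show "real r * \<psi> e u / u ^ (r + 1) \<le> real r * \<phi> u / u ^ (r + 1) + real r * e"
          using e by (cases "u = 0") (auto simp: \<psi>_def add_divide_distrib distrib_left)
      qed
      then show "ennreal (real r * \<psi> e u / u ^ (r + 1)) * indicator {0..t} u
        \<le> ennreal (real r * \<phi> u / u ^ (r + 1)) * indicator {0..t} u + ennreal (real r * e) * indicator {0..t} u"
        using e by (auto split: split_indicator simp flip: ennreal_plus intro!: ennreal_leI)
    qed
    also have "\<dots> = head_integral r \<phi> t + ennreal (real r * e) * ennreal t"
    proof (subst nn_integral_add)
      have "mono_on {0..1} (\<lambda>u. real r * \<phi> u)"
        by (intro mono_onI mult_left_mono mono_onD[OF \<phi>m]) auto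
      from measurable_mono_on_unit[OF this, of "r + 1"]
      have "(\<lambda>u. (ennreal (real r * \<phi> u / u ^ (r + 1)) * indicator {0..1} u) * indicator {0..t} u) \<in> borel_measurable borel"
        by measurable
      also have "(\<lambda>u. (ennreal (real r * \<phi> u / u ^ (r + 1)) * indicator {0..1} u) * indicator {0..t} u)
        = (\<lambda>u. ennreal (real r * \<phi> u / u ^ (r + 1)) * indicator {0..t} u)"
        using t by (intro ext) (auto simp: indicator_def)
      finally show "(\<lambda>u. ennreal (real r * \<phi> u / u ^ (r + 1)) * indicator {0..t} u) \<in> borel_measurable lborel" by simp
    qed (use t in \<open>auto simp: nn_integral_cmult_indicator\<close>)
    also have "\<dots> \<le> head_integral r \<phi> t + ennreal (real r * e)"
      using t e by (intro add_left_mono) (auto simp flip: ennreal_mult intro!: ennreal_leI mult_left_le)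
    finally show ?thesis .
  qed
  have \<psi>I2: "tail_integral (k + r) (\<psi> e) t
    \<le> tail_integral (k + r) \<phi> t + ennreal (e / t ^ k)" if e: "0 < e" and t: "0 < t" "t \<le> 1" for e t
  proof -
    have "tail_integral (k + r) (\<psi> e) t \<le>
      (\<integral>\<^sup>+u. ennreal (\<phi> u / u ^ (k + r + 1)) * indicator {t..1} u + ennreal (e / t ^ k) * indicator {t..1} u \<partial>lborel)"
    proof (rule nn_integral_mono)
      fix u
      have "\<psi> e u / u ^ (k + r + 1) \<le> \<phi> u / u ^ (k + r + 1) + e / t ^ k" "0 \<le> \<phi> u / u ^ (k + r + 1)" if "u \<in> {t..1}"
      proof -
        have u: "u \<in> {0..1}" "0 < u" "t \<le> u" using that t by auto
        show "0 \<le> \<phi> u / u ^ (k + r + 1)" using \<phi>0[OF u(1)] u by auto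
        have "\<psi> e u / u ^ (k + r + 1) = \<phi> u / u ^ (k + r + 1) + e / u ^ k"
          using u by (simp add: \<psi>_def add_divide_distrib power_add)
        also have "e / u ^ k \<le> e / t ^ k" using e t u by (intro divide_left_mono power_mono mult_pos_pos) auto
        finally show "\<psi> e u / u ^ (k + r + 1) \<le> \<phi> u / u ^ (k + r + 1) + e / t ^ k" by simp
      qed
      then show "ennreal (\<psi> e u / u ^ (k + r + 1)) * indicator {t..1} u
        \<le> ennreal (\<phi> u / u ^ (k + r + 1)) * indicator {t..1} u + ennreal (e / t ^ k) * indicator {t..1} u"
        using e t by (auto split: split_indicator simp flip: ennreal_plus intro!: ennreal_leI)
    qed
    also have "\<dots> = tail_integral (k + r) \<phi> t + ennreal (e / t ^ k) * ennreal (1 - t)"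
    proof (subst nn_integral_add)
      have "(\<lambda>u. (ennreal (\<phi> u / u ^ (k + r + 1)) * indicator {0..1} u) * indicator {t..1} u) \<in> borel_measurable borel"
        using measurable_mono_on_unit[OF \<phi>m, of "k + r + 1"] by measurable
      also have "(\<lambda>u. (ennreal (\<phi> u / u ^ (k + r + 1)) * indicator {0..1} u) * indicator {t..1} u)
        = (\<lambda>u. ennreal (\<phi> u / u ^ (k + r + 1)) * indicator {t..1} u)"
        using t by (intro ext) (auto simp: indicator_def)
      finally show "(\<lambda>u. ennreal (\<phi> u / u ^ (k + r + 1)) * indicator {t..1} u) \<in> borel_measurable lborel" by simp
    qed (use t in \<open>auto simp: nn_integral_cmult_indicator\<close>)
    also have "\<dots> \<le> tail_integral (k + r) \<phi> t + ennreal (e / t ^ k)"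
      using t e by (intro add_left_mono) (auto simp flip: ennreal_mult intro!: ennreal_leI mult_left_le divide_right_mono)
    finally show ?thesis .
  qed
  have \<psi>fin: "head_integral r (\<psi> e) 1 < \<infinity>" if "0 < e" for e
    using \<psi>I[OF that, of 1] I by (simp add: order_le_less_trans)
  have \<psi>appr: "\<exists>Q. (Q = 0 \<or> degree Q < n) \<and> Lp_norm p {-1..1} (\<lambda>x. f x - poly Q x) \<le> ennreal (\<psi> e (1 / real n))"
    if "0 < e" "N \<le> n" for e n
  proof (rule best_approx_less_imp)
    have n: "0 < real n" using that N by simp
    then have "\<phi> (1 / real n) < \<psi> e (1 / real n)" "0 \<le> \<phi> (1 / real n)"
      using that by (auto simp: \<psi>_def intro!: \<phi>0)
    then have "ennreal (\<phi> (1 / real n)) < ennreal (\<psi> e (1 / real n))" by (simp add: ennreal_less_iff)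
    then show "best_approx n f p < ennreal (\<psi> e (1 / real n))" using appr that(2) by (meson le_less_trans)
  qed
  have "best_approx (k + r) f p \<le> Lp_norm p {-1..1} (\<lambda>x. f x - poly 0 x)"
    unfolding best_approx_def by (rule INF_lower) simp
  then have "best_approx (k + r) f p < \<infinity>" using f by (auto simp: Lp_def intro: le_less_trans)
  then obtain E where E: "best_approx (k + r) f p = ennreal E" "0 \<le> E"
    by (cases "best_approx (k + r) f p") auto
  have near: "\<exists>P. (P = 0 \<or> degree P < k + r) \<and> Lp_norm p {-1..1} (\<lambda>x. f x - poly P x) \<le> ennreal (E + e)" if "0 < e" for e
    by (rule best_approx_less_imp) (use E that in \<open>simp add: ennreal_less_iff\<close>)
  obtain P where "(P = 0 \<or> degree P < k + r) \<and> Lp_norm p {-1..1} (\<lambda>x. f x - poly P x) \<le> ennreal (E + 1)"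
    using near[of 1] by auto
  then show "\<exists>g\<in>B_space p r. AE x in lebesgue_on {-1..1}. g x = f x"
    using approximation_imp_omega_le(1)[OF p k N \<psi>m \<psi>0 \<psi>fin f \<psi>appr, of 1 P "E + 1"] E by simp
  fix g t
  assume g: "g \<in> B_space p r" "AE x in lebesgue_on {-1..1}. g x = f x" and t: "t \<in> {0..1/2::real}"
  let ?c = "rate_const k r" and ?s = "start_const k r (N + k + r)"
  let ?I1 = "head_integral r \<phi> t"
  let ?I2 = "tail_integral (k + r) \<phi> t"
  let ?RHS = "ennreal ?c * ?I1 + ennreal ?c * ennreal (t ^ k) * ?I2 + ennreal ?s * ennreal (t ^ k) * best_approx (k + r) f p"
  have c0: "0 < ?c" "0 \<le> ?s" using rate_const_pos const_nonneg by auto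
  show "omega k r ((deriv ^^ r) g) t p \<le> ?RHS"
  \<comment> \<open>For t = 0 the modulus is a supremum over the empty set. For t > 0 an infinite
    tail integral makes the right side infinite. In the remaining case all terms on the right are
    real.\<close>
  proof (cases "t = 0 \<or> ?I2 = \<infinity>")
    case True
    then show ?thesis
    proof
      assume "t = 0"
      then show ?thesis by (simp add: omega_def bot_ennreal)
    next
      assume I2: "?I2 = \<infinity>"
      show ?thesis
      proof (cases "t = 0")
        case False
        then have "ennreal ?c * ennreal (t ^ k) \<noteq> 0" using c0 t by simp
        then show ?thesis using I2 by (simp add: ennreal_mult_top)
      qed (simp add: omega_def bot_ennreal)
    qed
  next
    case False
    then have t0: "0 < t" "t \<le> 1/2" and "?I2 \<noteq> \<infinity>" using t by auto
    then obtain i2 where i2: "?I2 = ennreal i2" "0 \<le> i2" by (cases ?I2) auto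
    have "?I1 \<le> head_integral r \<phi> 1"
      using t0 by (intro nn_integral_mono) (auto split: split_indicator)
    then have "?I1 < \<infinity>" using I by (rule le_less_trans)
    then obtain i1 where i1: "?I1 = ennreal i1" "0 \<le> i1" by (cases ?I1) auto
    have RHS: "?RHS = ennreal (?c * (i1 + t ^ k * i2) + ?s * t ^ k * E)"
      unfolding i1 i2 E using i1 i2 E c0 t0
      by (simp add: ennreal_mult[symmetric] ennreal_plus[symmetric] algebra_simps del: ennreal_plus)
    show ?thesis
    proof (rule ennreal_le_epsilon)
      fix d :: real assume d: "0 < d"
      \<comment> \<open>The total factor of e: the head gives \<open>?c * real r\<close>, the tail
        \<open>?c\<close> because t^k cancels the division by t^k, and the start at most
        \<open>?s\<close> because t^k \<le> 1.\<close>
      define K where "K = ?c * (real r + 1) + ?s"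
      have K: "0 < K" using c0 by (simp add: K_def add_pos_nonneg)
      define e where "e = d / K"
      have e: "0 < e" using d K by (simp add: e_def)
      obtain P where P: "P = 0 \<or> degree P < k + r" "Lp_norm p {-1..1} (\<lambda>x. f x - poly P x) \<le> ennreal (E + e)"
        using near[OF e] by blast
      have J1: "head_integral r (\<psi> e) t \<le> ennreal (i1 + real r * e)"
        using \<psi>I[OF e, of t] t0 i1 e by simp
      have J2: "tail_integral (k + r) (\<psi> e) t \<le> ennreal (i2 + e / t ^ k)"
        using \<psi>I2[OF e, of t] t0 i2 e by simp
      have "omega k r ((deriv ^^ r) g) t p \<le> ennreal (?c * ((i1 + real r * e) + t ^ k * (i2 + e / t ^ k)) + ?s * t ^ k * (E + e))"
        by (rule approximation_imp_omega_le(2)[OF p k N \<psi>m[OF e] \<psi>0[OF e] \<psi>fin[OF e] f \<psi>appr[OF e] P _ g t0 J1 _ J2])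
          (use E e i1 i2 t0 in auto)
      also have "\<dots> \<le> ennreal ((?c * (i1 + t ^ k * i2) + ?s * t ^ k * E) + d)"
      proof (rule ennreal_leI)
        have "?s * t ^ k * e \<le> ?s * 1 * e"
          using c0 t0 e by (intro mult_right_mono mult_left_mono power_le_one) auto
        moreover have "?c * ((i1 + real r * e) + t ^ k * (i2 + e / t ^ k)) = ?c * (i1 + t ^ k * i2) + ?c * (real r + 1) * e"
          using t0 by (simp add: field_simps)
        moreover have "?c * (real r + 1) * e + ?s * 1 * e = d"
        proof -
          have "?c * (real r + 1) * e + ?s * 1 * e = K * e" by (simp only: K_def distrib_right mult_1_right)
          then show ?thesis using K by (simp add: e_def)
        qed
        ultimately show "?c * ((i1 + real r * e) + t ^ k * (i2 + e / t ^ k)) + ?s * t ^ k * (E + e)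
          \<le> (?c * (i1 + t ^ k * i2) + ?s * t ^ k * E) + d"
          by (simp only: distrib_left)
      qed
      also have "\<dots> = ?RHS + ennreal d"
        unfolding RHS using d i1 i2 E c0 t0 by (intro ennreal_plus) auto
      finally show "omega k r ((deriv ^^ r) g) t p \<le> ?RHS + ennreal d" .
    qed
  qed
qed

text \<open>For k + r \<ge> 2 the point 1 / (k + r) is at most 1/2, so the value of \<phi> there is
  dominated through the block [1/2, 1), which lies in the range of the tail integral. At the point 1
  this would fail, since \<phi> may jump there.\<close>

lemma best_approx_le_tail_integral:
  assumes "\<phi> \<in> Phi" "2 \<le> k + r" "best_approx (k + r) f p \<le> ennreal (\<phi> (1 / real (k + r)))" "t \<le> 1/2"
  shows "best_approx (k + r) f p \<le> 2 * tail_integral (k + r) \<phi> t"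
proof -
  have \<phi>m: "mono_on {0..1} \<phi>" and \<phi>0: "\<And>u. u \<in> {0..1} \<Longrightarrow> 0 \<le> \<phi> u" using assms(1) by (auto simp: Phi_def)
  have "best_approx (k + r) f p \<le> ennreal (\<phi> (1 / real (k + r)))" by (rule assms)
  also have "\<dots> \<le> ennreal (\<phi> (1/2))"
    using assms(2) by (intro ennreal_leI mono_onD[OF \<phi>m]) (auto simp: field_simps)
  also have "\<dots> \<le> ennreal 2 * (\<integral>\<^sup>+u\<in>{1/2..<2 * (1/2)}. ennreal (\<phi> u / u ^ (0 + 1)) \<partial>lborel)"
    using dyadic_block_le[OF \<phi>m \<phi>0, of "1/2" 0] by simp
  also have "\<dots> \<le> ennreal 2 * tail_integral (k + r) \<phi> t"
  proof (rule mult_left_mono[OF nn_integral_mono])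
    fix u
    have "\<phi> u / u ^ (0 + 1) \<le> \<phi> u / u ^ (k + r + 1)" if "u \<in> {1/2..<1}"
      using that \<phi>0[of u] by (intro divide_left_mono mult_pos_pos power_decreasing) auto
    then show "ennreal (\<phi> u / u ^ (0 + 1)) * indicator {1/2..<2 * (1/2)} u \<le> ennreal (\<phi> u / u ^ (k + r + 1)) * indicator {t..1} u"
      using assms(4) by (auto split: split_indicator intro!: ennreal_leI)
  qed simp
  finally show ?thesis by simp
qed

text \<open>The second estimate assumes 2 \<le> k + r because it fails for k = 1, r = 0, N = 1: take
  f x = x and let \<phi> be 0 on [0, 1) and 2 at 1. The hypotheses hold and the right side is 0, but
  the modulus is positive for t > 0. At t = 0 the convention that 0 times \<infinity> is 0 is that
  of \<open>ennreal\<close>.\<close>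

theorem theorem9p1:
  fixes p :: ennreal and k r :: nat
  assumes "1 \<le> p" and "1 \<le> k"
  shows "\<exists>c::real. 0 \<le> c \<and> (\<forall>N::nat. 1 \<le> N \<longrightarrow> (\<exists>cN::real. 0 \<le> cN \<and>
    (\<forall>\<phi> f. \<phi> \<in> Phi \<and>
       (\<integral>\<^sup>+u\<in>{0..1}. ennreal (real r * \<phi> u / u ^ (r + 1)) \<partial>lborel) < \<infinity> \<and>
       f \<in> Lp p {-1..1} \<and>
       (\<forall>n\<ge>N. best_approx n f p \<le> ennreal (\<phi> (1 / real n)))
     \<longrightarrow>
       (\<exists>g\<in>B_space p r. AE x in lebesgue_on {-1..1}. g x = f x) \<and>
       (\<forall>g\<in>B_space p r. (AE x in lebesgue_on {-1..1}. g x = f x) \<longrightarrow>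
         (\<forall>t\<in>{0..1/2}.
            omega k r ((deriv ^^ r) g) t p
              \<le> ennreal c * (\<integral>\<^sup>+u\<in>{0..t}. ennreal (real r * \<phi> u / u ^ (r + 1)) \<partial>lborel)
                + ennreal c * ennreal (t ^ k)
                    * (\<integral>\<^sup>+u\<in>{t..1}. ennreal (\<phi> u / u ^ (k + r + 1)) \<partial>lborel)
                + ennreal cN * ennreal (t ^ k) * best_approx (k + r) f p) \<and>
         (N \<le> k + r \<and> 2 \<le> k + r \<longrightarrow> (\<forall>t\<in>{0..1/2}.
            omega k r ((deriv ^^ r) g) t p
              \<le> ennreal c * (\<integral>\<^sup>+u\<in>{0..t}. ennreal (real r * \<phi> u / u ^ (r + 1)) \<partial>lborel)
                + ennreal c * ennreal (t ^ k)
                    * (\<integral>\<^sup>+u\<in>{t..1}. ennreal (\<phi> u / u ^ (k + r + 1)) \<partial>lborel)))))))"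
proof -
  \<comment> \<open>For the second estimate the hypothesis is used from n = k + r on, so the
    starting constant is the one for N = k + r and depends on k and r alone. The 2 in c is the
    constant of \<open>best_approx_le_tail_integral\<close>.\<close>
  define s where "s = start_const k r ((k + r) + k + r)"
  define c where "c = rate_const k r + 2 * s"
  have c: "0 \<le> rate_const k r" "0 \<le> s" "0 \<le> c" "rate_const k r \<le> c"
    using rate_const_pos[of k r] const_nonneg by (auto simp: c_def s_def)
  show ?thesis
  proof (rule exI[of _ c], intro conjI allI impI c(3))
    fix N :: nat assume N: "1 \<le> N"
    show "\<exists>cN::real. 0 \<le> cN \<and>
      (\<forall>\<phi> f. \<phi> \<in> Phi \<and>
       (\<integral>\<^sup>+u\<in>{0..1}. ennreal (real r * \<phi> u / u ^ (r + 1)) \<partial>lborel) < \<infinity> \<and>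
       f \<in> Lp p {-1..1} \<and>
       (\<forall>n\<ge>N. best_approx n f p \<le> ennreal (\<phi> (1 / real n)))
     \<longrightarrow>
       (\<exists>g\<in>B_space p r. AE x in lebesgue_on {-1..1}. g x = f x) \<and>
       (\<forall>g\<in>B_space p r. (AE x in lebesgue_on {-1..1}. g x = f x) \<longrightarrow>
         (\<forall>t\<in>{0..1/2}.
            omega k r ((deriv ^^ r) g) t p
              \<le> ennreal c * (\<integral>\<^sup>+u\<in>{0..t}. ennreal (real r * \<phi> u / u ^ (r + 1)) \<partial>lborel)
                + ennreal c * ennreal (t ^ k)
                    * (\<integral>\<^sup>+u\<in>{t..1}. ennreal (\<phi> u / u ^ (k + r + 1)) \<partial>lborel)
                + ennreal cN * ennreal (t ^ k) * best_approx (k + r) f p) \<and>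
         (N \<le> k + r \<and> 2 \<le> k + r \<longrightarrow> (\<forall>t\<in>{0..1/2}.
            omega k r ((deriv ^^ r) g) t p
              \<le> ennreal c * (\<integral>\<^sup>+u\<in>{0..t}. ennreal (real r * \<phi> u / u ^ (r + 1)) \<partial>lborel)
                + ennreal c * ennreal (t ^ k)
                    * (\<integral>\<^sup>+u\<in>{t..1}. ennreal (\<phi> u / u ^ (k + r + 1)) \<partial>lborel)))))"
    proof (rule exI[of _ "start_const k r (N + k + r)"], intro conjI allI impI const_nonneg ballI; (elim conjE)?)
      fix \<phi> f
      assume \<phi>: "\<phi> \<in> Phi" and I: "head_integral r \<phi> 1 < \<infinity>"
        and f: "f \<in> Lp p {-1..1}" and appr: "\<forall>n\<ge>N. best_approx n f p \<le> ennreal (\<phi> (1 / real n))"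
      show "\<exists>g\<in>B_space p r. AE x in lebesgue_on {-1..1}. g x = f x"
        by (rule best_approx_imp_omega_le(1)[OF assms N \<phi> I f appr])
      fix g t
      assume g: "g \<in> B_space p r" "AE x in lebesgue_on {-1..1}. g x = f x" and t: "t \<in> {0..1/2::real}"
      let ?I1 = "head_integral r \<phi> t"
      let ?I2 = "tail_integral (k + r) \<phi> t"
      have "omega k r ((deriv ^^ r) g) t p \<le> ennreal (rate_const k r) * ?I1 + ennreal (rate_const k r) * ennreal (t ^ k) * ?I2
        + ennreal (start_const k r (N + k + r)) * ennreal (t ^ k) * best_approx (k + r) f p"
        by (rule best_approx_imp_omega_le(2)[OF assms N \<phi> I f appr g t])
      also have "\<dots> \<le> ennreal c * ?I1 + ennreal c * ennreal (t ^ k) * ?I2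
        + ennreal (start_const k r (N + k + r)) * ennreal (t ^ k) * best_approx (k + r) f p"
        using c by (intro add_mono mult_right_mono ennreal_leI) auto
      finally show "omega k r ((deriv ^^ r) g) t p \<le> ennreal c * ?I1 + ennreal c * ennreal (t ^ k) * ?I2
        + ennreal (start_const k r (N + k + r)) * ennreal (t ^ k) * best_approx (k + r) f p" .
      assume Nkr: "N \<le> k + r" "2 \<le> k + r"
      have appr': "\<forall>n\<ge>k + r. best_approx n f p \<le> ennreal (\<phi> (1 / real n))" using appr Nkr by auto
      have "omega k r ((deriv ^^ r) g) t p \<le> ennreal (rate_const k r) * ?I1 + ennreal (rate_const k r) * ennreal (t ^ k) * ?I2
        + ennreal s * ennreal (t ^ k) * best_approx (k + r) f p"
        unfolding s_def using Nkr by (intro best_approx_imp_omega_le(2)[OF assms _ \<phi> I f appr' g t]) auto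
      also have "\<dots> \<le> ennreal (rate_const k r) * ?I1 + ennreal (rate_const k r) * ennreal (t ^ k) * ?I2
        + ennreal s * ennreal (t ^ k) * (2 * ?I2)"
        using appr' t by (intro add_mono mult_left_mono best_approx_le_tail_integral \<phi> Nkr) auto
      also have "\<dots> = ennreal (rate_const k r) * ?I1 + ennreal c * ennreal (t ^ k) * ?I2"
      proof -
        have "ennreal c = ennreal (rate_const k r) + ennreal s * 2"
          unfolding c_def using c by (simp add: ennreal_plus ennreal_mult mult.commute)
        then show ?thesis by (simp add: algebra_simps)
      qed
      also have "\<dots> \<le> ennreal c * ?I1 + ennreal c * ennreal (t ^ k) * ?I2"
        using c by (intro add_mono mult_right_mono ennreal_leI order_refl) auto
      finally show "omega k r ((deriv ^^ r) g) t p \<le> ennreal c * ?I1 + ennreal c * ennreal (t ^ k) * ?I2" .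
    qed
  qed
qed

end
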